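(* Let $\mathcal A$ be a semisimple commutative separable unital Banach algebra with $\Delta(\mathcal A)\neq\emptyset$, let $G$ be an abelian compact Hausdorff group, and let $1<p<\infty$. Then $L^p(G,\mathcal A)$ is a BSE-algebra if and only if $\mathcal A$ is a BSE-algebra and $G$ is finite.
   Context: All algebras are over $\mathbb C$. For a commutative Banach algebra $\mathcal B$, $\Delta(\mathcal B)$ is the set of nonzero multiplicative linear functionals on $\mathcal B$, with the weak$^*$ topology from $\mathcal B^*$; $C_b(\Delta(\mathcal B))$ is the space of bounded continuous complex functions on it; $\widehat b(\varphi)=\varphi(b)$ is the Gelfand transform. $\mathcal B$ is semisimple if $\widehat b=0$ implies $b=0$, and without order if $b\mathcal B=\{0\}$ implies $b=0$ (semisimple implies without order). Let $\mathcal B$ be commutative and without order. A multiplier of $\mathcal B$ is a bounded linear operator $T:\mathcal B\to\mathcal B$ with $T(ab)=aT(b)$ for all $a,b\in\mathcal B$; $M(\mathcal B)$ is the set of multipliers. For each $T\in M(\mathcal B)$ there is a unique $\widehat T\in C_b(\Delta(\mathcal B))$ with $\widehat{T(b)}(\varphi)=\widehat T(\varphi)\widehat b(\varphi)$ for all $b\in\mathcal B$, $\varphi\in\Delta(\mathcal B)$; put $\widehat{M(\mathcal B)}=\{\widehat T:T\in M(\mathcal B)\}$. A function $\sigma\in C_b(\Delta(\mathcal B))$ is a BSE-function if there is $\beta>0$ with $\left|\sum_{k=1}^n\alpha_k\sigma(\varphi_k)\right|\le\beta\left\|\sum_{k=1}^n\alpha_k\varphi_k\right\|_{\mathcal B^*}$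 for all $n$, $\alpha_1,\dots,\alpha_n\in\mathbb C$, $\varphi_1,\dots,\varphi_n\in\Delta(\mathcal B)$; $C_{BSE}(\Delta(\mathcal B))$ is the set of BSE-functions. $\mathcal B$ is a BSE-algebra if $\widehat{M(\mathcal B)}=C_{BSE}(\Delta(\mathcal B))$. $\lambda$ is the Haar measure on $G$ with $\lambda(G)=1$. $L^p(G,\mathcal A)$ is the space of (classes modulo $\lambda$-a.e. equality of) Borel measurable $f:G\to\mathcal A$ with $\|f\|_{p,\mathcal A}=\left(\int_G\|f(x)\|_{\mathcal A}^p\,d\lambda(x)\right)^{1/p}<\infty$, a commutative Banach algebra under convolution $(f*g)(x)=\int_G f(y)g(y^{-1}x)\,d\lambda(y)$. *)

theory Defs
  imports "HOL-Analysis.Analysis"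
begin

section \<open>Separable metric spaces and complex normed algebras as type classes\<close>

class separable_metric_space = metric_space +
  assumes ex_countable_dense: "\<exists>D. countable D \<and> (\<forall>x. \<forall>e>0. \<exists>d\<in>D. dist d x < e)"

text \<open>Bochner integration in the library asks for second countability, which for metric
  spaces follows from separability.\<close>

instance separable_metric_space \<subseteq> second_countable_topology
proof
  obtain D :: "'a set" where D: "countable D" "\<And>x e. e > 0 \<Longrightarrow> \<exists>d\<in>D. dist d x < e"
    using ex_countable_dense by blast
  define B where "B = (\<lambda>(d, q). ball d (real_of_rat q)) ` (D \<times> (UNIV :: rat set))"
  have cB: "countable B"
    unfolding B_def using D(1) by (intro countable_image countable_SIGMA) auto
  have "topological_basis B"
  proof (rule topological_basisI)
    fix U assume "U \<in> B"
    then show "open U" by (auto simp: B_def)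
  next
    fix U :: "'a set" and x assume U: "open U" "x \<in> U"
    then obtain e where e: "e > 0" "ball x e \<subseteq> U"
      using open_contains_ball by blast
    obtain q where q: "0 < real_of_rat q" "real_of_rat q < e / 2"
      using of_rat_dense[of 0 "e / 2"] e(1) by fastforce
    obtain d where d: "d \<in> D" "dist d x < real_of_rat q"
      using D(2)[OF q(1)] by blast
    have "ball d (real_of_rat q) \<subseteq> ball x e"
    proof
      fix z assume "z \<in> ball d (real_of_rat q)"
      then have "dist d z < e / 2" "dist x d < e / 2"
        using d(2) q(2) by (auto simp: dist_commute)
      then have "dist x z < e"
        using dist_triangle[of x z d] by linarith
      then show "z \<in> ball x e" by simp
    qed
    moreover have "x \<in> ball d (real_of_rat q)" using d(2) by simp
    moreover have "ball d (real_of_rat q) \<in> B" using d(1) by (auto simp: B_def)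
    ultimately show "\<exists>V\<in>B. x \<in> V \<and> V \<subseteq> U" using e(2) by blast
  qed
  then show "\<exists>B::'a set set. countable B \<and> open = generate_topology B"
    using cB topological_basis_imp_subbasis by blast
qed

class complex_vector = real_vector +
  fixes scaleC :: "complex \<Rightarrow> 'a \<Rightarrow> 'a"
  assumes scaleC_add_right: "scaleC c (x + y) = scaleC c x + scaleC c y"
    and scaleC_add_left: "scaleC (c + d) x = scaleC c x + scaleC d x"
    and scaleC_scaleC: "scaleC c (scaleC d x) = scaleC (c * d) x"
    and scaleC_of_real: "scaleC (complex_of_real r) x = r *\<^sub>R x"

class complex_normed_algebra = complex_vector + real_normed_algebra +
  assumes mult_scaleC_left: "scaleC c x * y = scaleC c (x * y)"
    and mult_scaleC_right: "x * scaleC c y = scaleC c (x * y)"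
    and norm_scaleC: "norm (scaleC c x) = cmod c * norm x"


section \<open>Normed algebras with an explicit carrier\<close>

text \<open>The spaces $L^p(G,A)$ depend on a measure and on an exponent and are therefore not types;
  the notions below are formulated for algebras given by a carrier set and operations on it.
  They are meant for commutative Banach algebras without order. All maps defined on a carrier
  (or on the character space) are taken to be \<^const>\<open>extensional\<close>, so that they correspond
  one-to-one to maps in the usual sense.\<close>

record 'b normed_alg =
  alg_carrier :: "'b set"
  alg_zero :: 'b
  alg_add :: "'b \<Rightarrow> 'b \<Rightarrow> 'b"
  alg_scale :: "complex \<Rightarrow> 'b \<Rightarrow> 'b"
  alg_mult :: "'b \<Rightarrow> 'b \<Rightarrow> 'b"
  alg_norm :: "'b \<Rightarrow> real"

definition type_algebra :: "'a::complex_normed_algebra itself \<Rightarrow> 'a normed_alg" where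
  "type_algebra _ = \<lparr>alg_carrier = UNIV, alg_zero = 0, alg_add = (+), alg_scale = scaleC,
     alg_mult = (*), alg_norm = norm\<rparr>"

definition linear_functionals :: "'b normed_alg \<Rightarrow> ('b \<Rightarrow> complex) set" where
  "linear_functionals B = {\<phi> \<in> extensional (alg_carrier B).
     (\<forall>a\<in>alg_carrier B. \<forall>b\<in>alg_carrier B. \<phi> (alg_add B a b) = \<phi> a + \<phi> b) \<and>
     (\<forall>c. \<forall>b\<in>alg_carrier B. \<phi> (alg_scale B c b) = c * \<phi> b)}"

definition dual_space :: "'b normed_alg \<Rightarrow> ('b \<Rightarrow> complex) set" where
  "dual_space B = {\<phi> \<in> linear_functionals B.
     \<exists>K. \<forall>b\<in>alg_carrier B. cmod (\<phi> b) \<le> K * alg_norm B b}"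

definition dual_norm :: "'b normed_alg \<Rightarrow> ('b \<Rightarrow> complex) \<Rightarrow> real" where
  "dual_norm B \<phi> = (SUP b\<in>{b \<in> alg_carrier B. alg_norm B b \<le> 1}. cmod (\<phi> b))"

text \<open>The weak* topology on the dual is the topology of pointwise convergence on the carrier.\<close>

definition weak_star_topology :: "'b normed_alg \<Rightarrow> ('b \<Rightarrow> complex) topology" where
  "weak_star_topology B =
     subtopology (product_topology (\<lambda>_. euclidean) (alg_carrier B)) (dual_space B)"

text \<open>Characters of a Banach algebra are automatically bounded, so no boundedness is required
  in the following definition.\<close>

definition characters :: "'b normed_alg \<Rightarrow> ('b \<Rightarrow> complex) set" ("\<Delta>") where
  "\<Delta> B = {\<phi> \<in> linear_functionals B.
     (\<forall>a\<in>alg_carrier B. \<forall>b\<in>alg_carrier B. \<phi> (alg_mult B a b) = \<phi> a * \<phi> b) \<and>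
     (\<exists>b\<in>alg_carrier B. \<phi> b \<noteq> 0)}"

definition character_topology :: "'b normed_alg \<Rightarrow> ('b \<Rightarrow> complex) topology" where
  "character_topology B = subtopology (weak_star_topology B) (\<Delta> B)"

definition semisimple :: "'b normed_alg \<Rightarrow> bool" where
  "semisimple B \<longleftrightarrow>
     (\<forall>b\<in>alg_carrier B. (\<forall>\<phi>\<in>\<Delta> B. \<phi> b = 0) \<longrightarrow> b = alg_zero B)"

definition Cb_characters :: "'b normed_alg \<Rightarrow> (('b \<Rightarrow> complex) \<Rightarrow> complex) set" where
  "Cb_characters B = {\<sigma> \<in> extensional (\<Delta> B).
     continuous_map (character_topology B) euclidean \<sigma> \<and> bounded (\<sigma> ` \<Delta> B)}"

definition multipliers :: "'b normed_alg \<Rightarrow> ('b \<Rightarrow> 'b) set" where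
  "multipliers B = {T \<in> alg_carrier B \<rightarrow>\<^sub>E alg_carrier B.
     (\<forall>a\<in>alg_carrier B. \<forall>b\<in>alg_carrier B. T (alg_add B a b) = alg_add B (T a) (T b)) \<and>
     (\<forall>c. \<forall>b\<in>alg_carrier B. T (alg_scale B c b) = alg_scale B c (T b)) \<and>
     (\<exists>K. \<forall>b\<in>alg_carrier B. alg_norm B (T b) \<le> K * alg_norm B b) \<and>
     (\<forall>a\<in>alg_carrier B. \<forall>b\<in>alg_carrier B. T (alg_mult B a b) = alg_mult B a (T b))}"

definition multiplier_transform ::
    "'b normed_alg \<Rightarrow> ('b \<Rightarrow> 'b) \<Rightarrow> ('b \<Rightarrow> complex) \<Rightarrow> complex" where
  "multiplier_transform B T = (THE \<sigma>. \<sigma> \<in> Cb_characters B \<and>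
     (\<forall>b\<in>alg_carrier B. \<forall>\<phi>\<in>\<Delta> B. \<phi> (T b) = \<sigma> \<phi> * \<phi> b))"

definition BSE_functions :: "'b normed_alg \<Rightarrow> (('b \<Rightarrow> complex) \<Rightarrow> complex) set" where
  "BSE_functions B = {\<sigma> \<in> Cb_characters B. \<exists>\<beta>>0.
     \<forall>(n::nat) (\<alpha> :: nat \<Rightarrow> complex) (\<phi> :: nat \<Rightarrow> 'b \<Rightarrow> complex).
       (\<forall>k\<in>{1..n}. \<phi> k \<in> \<Delta> B) \<longrightarrow>
       cmod (\<Sum>k=1..n. \<alpha> k * \<sigma> (\<phi> k))
         \<le> \<beta> * dual_norm B (\<lambda>b\<in>alg_carrier B. \<Sum>k=1..n. \<alpha> k * \<phi> k b)}"

definition BSE_algebra :: "'b normed_alg \<Rightarrow> bool" where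
  "BSE_algebra B \<longleftrightarrow> multiplier_transform B ` multipliers B = BSE_functions B"


section \<open>Normalized Haar measure and the algebra $L^p(G,A)$\<close>

text \<open>Abelian groups are written additively. Haar measure is the translation invariant regular
  Borel probability measure; regularity is not automatic, since the group need not be
  metrizable.\<close>

definition haar_prob :: "'g::topological_ab_group_add measure \<Rightarrow> bool" where
  "haar_prob \<mu> \<longleftrightarrow> sets \<mu> = sets borel \<and> emeasure \<mu> UNIV = 1 \<and>
     (\<forall>x. \<forall>E\<in>sets borel. emeasure \<mu> ((+) x ` E) = emeasure \<mu> E) \<and>
     (\<forall>E\<in>sets borel. emeasure \<mu> E = (INF U\<in>{U. open U \<and> E \<subseteq> U}. emeasure \<mu> U)) \<and>
     (\<forall>U. open U \<longrightarrow> emeasure \<mu> U = (SUP K\<in>{K. compact K \<and> K \<subseteq> U}. emeasure \<mu> K))"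

definition Lp_functions ::
    "'g measure \<Rightarrow> real \<Rightarrow> ('g \<Rightarrow> 'a::{banach, second_countable_topology}) set" where
  "Lp_functions \<mu> p = {f \<in> borel_measurable \<mu>. (\<integral>\<^sup>+ x. ennreal (norm (f x) powr p) \<partial>\<mu>) < \<infinity>}"

definition Lp_norm ::
    "'g measure \<Rightarrow> real \<Rightarrow> ('g \<Rightarrow> 'a::{banach, second_countable_topology}) \<Rightarrow> real" where
  "Lp_norm \<mu> p f = (\<integral>x. norm (f x) powr p \<partial>\<mu>) powr (1 / p)"

definition ae_class ::
    "'g measure \<Rightarrow> ('g \<Rightarrow> 'a::{banach, second_countable_topology}) \<Rightarrow> ('g \<Rightarrow> 'a) set" where
  "ae_class \<mu> f = {g \<in> borel_measurable \<mu>. AE x in \<mu>. g x = f x}"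

definition class_rep :: "('g \<Rightarrow> 'a) set \<Rightarrow> 'g \<Rightarrow> 'a" where
  "class_rep X = (SOME f. f \<in> X)"

text \<open>In multiplicative notation the integrand is $f(y)\,g(y^{-1}x)$. For \<open>f\<close> and \<open>g\<close> in $L^p$ the
  integral exists for almost every \<open>x\<close>; elsewhere the library's integral is \<open>0\<close>.\<close>

definition convolution ::
    "'g::topological_ab_group_add measure \<Rightarrow>
     ('g \<Rightarrow> 'a::{real_normed_algebra, banach, second_countable_topology}) \<Rightarrow>
     ('g \<Rightarrow> 'a) \<Rightarrow> 'g \<Rightarrow> 'a" where
  "convolution \<mu> f g x = (\<integral>y. f y * g (- y + x) \<partial>\<mu>)"

definition Lp_algebra ::
    "'g::topological_ab_group_add measure \<Rightarrow> real \<Rightarrow>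
     ('g \<Rightarrow> 'a::{complex_normed_algebra, banach, second_countable_topology}) set normed_alg" where
  "Lp_algebra \<mu> p = \<lparr>
     alg_carrier = ae_class \<mu> ` Lp_functions \<mu> p,
     alg_zero = ae_class \<mu> (\<lambda>_. 0),
     alg_add = (\<lambda>X Y. ae_class \<mu> (\<lambda>x. class_rep X x + class_rep Y x)),
     alg_scale = (\<lambda>c X. ae_class \<mu> (\<lambda>x. scaleC c (class_rep X x))),
     alg_mult = (\<lambda>X Y. ae_class \<mu> (convolution \<mu> (class_rep X) (class_rep Y))),
     alg_norm = (\<lambda>X. Lp_norm \<mu> p (class_rep X))\<rparr>"

end

theory Submission
  imports Defs "HOL-Probability.Probability_Measure" "HOL-Complex_Analysis.Great_Picard"
begin


text \<open>If \<open>L\<^sup>p(G, A)\<close> is a BSE-algebra, then \<open>1\<close>, the transform of the identity multiplier, is a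
  BSE-function. Pairing the BSE inequality with the mean of \<open>N\<close> distinct characters \<open>\<xi> \<otimes> \<phi>\<close>, where \<open>\<phi>\<close> is
  fixed and \<open>\<xi>\<close> runs through characters of \<open>G\<close>, bounds \<open>N\<close>, because this mean tends to \<open>0\<close> in the
  dual of \<open>L\<^sup>p\<close>. So \<open>G\<close> has finitely many characters. Since they separate the continuous functions on \<open>G\<close>
  (no nonzero continuous function is orthogonal to all of them), every continuous function is its finite
  Fourier sum, hence \<open>cmod (f 0)\<close> is bounded by a multiple of \<open>\<integral> cmod f\<close>, points have positive measure
  and \<open>G\<close> is finite.

  For finite \<open>G\<close> the algebra \<open>L\<^sup>p(G, A)\<close> is unital and all its characters have the form \<open>\<xi> \<otimes> \<phi>\<close>. In a unital
  algebra multipliers are multiplications, so being BSE means that every BSE-function is a Gelfand transform.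
  This passes from \<open>L\<^sup>p(G, A)\<close> to \<open>A\<close> along the point mass at \<open>0\<close>, and from \<open>A\<close> to \<open>L\<^sup>p(G, A)\<close> by solving for
  each \<open>\<xi>\<close> separately and Fourier inversion.\<close>

section \<open>Multiplier transforms and BSE functions of unital algebras\<close>

text \<open>The separation of continuous functions by characters carries most of the weight. It is
  obtained variationally: for a given \<open>h\<close>, the squared L2 norm of the correlation of
  \<open>h\<close> with the autocorrelation of \<open>f\<close> is pushed towards its supremum over
  unit vectors \<open>f\<close>. A maximiser need not exist among continuous functions, so almost
  maximisers are used, with every estimate made quantitative. The autocorrelations themselves have
  no evident limit, but their correlations with \<open>h\<close> are equicontinuous and do; the
  wanted character is read off from how that limit behaves under translation.

  The exponent enters through \<open>R powr (1 - p)\<close>, which tends to 0 only for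
  \<open>p > 1\<close>. For \<open>p = 1\<close> the mean of N characters of \<open>G\<close> has
  value 1 at 0 and hence sup norm 1, so it does not become small in the dual.

  For infinite \<open>G\<close> no classification of the characters of the algebra is used, since
  the BSE inequality may be tested on any chosen family of them. The full list of characters is
  computed only for finite \<open>G\<close>, where point masses generate the algebra.\<close>

lemma multiplier_transform_eq:
  assumes "\<sigma> \<in> Cb_characters B"
    and "\<And>b \<phi>. b \<in> alg_carrier B \<Longrightarrow> \<phi> \<in> \<Delta> B \<Longrightarrow> \<phi> (T b) = \<sigma> \<phi> * \<phi> b"
  shows "multiplier_transform B T = \<sigma>"
  unfolding multiplier_transform_def
proof (rule the_equality)
  show "\<sigma> \<in> Cb_characters B \<and> (\<forall>b\<in>alg_carrier B. \<forall>\<phi>\<in>\<Delta> B. \<phi> (T b) = \<sigma> \<phi> * \<phi> b)"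
    using assms by blast
next
  fix \<tau> assume \<tau>: "\<tau> \<in> Cb_characters B \<and> (\<forall>b\<in>alg_carrier B. \<forall>\<phi>\<in>\<Delta> B. \<phi> (T b) = \<tau> \<phi> * \<phi> b)"
  show "\<tau> = \<sigma>"
  proof (rule extensionalityI)
    show "\<tau> \<in> extensional (\<Delta> B)" "\<sigma> \<in> extensional (\<Delta> B)"
      using \<tau> assms(1) by (auto simp: Cb_characters_def)
    fix \<phi> assume \<phi>: "\<phi> \<in> \<Delta> B"
    \<comment> \<open>A character is nonzero somewhere, and there the value of a transform is forced
      by division.\<close>
    then obtain b where b: "b \<in> alg_carrier B" "\<phi> b \<noteq> 0" by (auto simp: characters_def)
    have "\<tau> \<phi> * \<phi> b = \<sigma> \<phi> * \<phi> b" using \<tau> assms(2)[OF b(1) \<phi>] b(1) \<phi> by auto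
    then show "\<tau> \<phi> = \<sigma> \<phi>" using b(2) by simp
  qed
qed

lemma characters_extensional: "\<Delta> B \<subseteq> extensional (alg_carrier B)"
  by (auto simp: characters_def linear_functionals_def)

lemma character_add:
  "\<phi> \<in> \<Delta> B \<Longrightarrow> a \<in> alg_carrier B \<Longrightarrow> b \<in> alg_carrier B \<Longrightarrow> \<phi> (alg_add B a b) = \<phi> a + \<phi> b"
  by (auto simp: characters_def linear_functionals_def)

lemma character_scale:
  "\<phi> \<in> \<Delta> B \<Longrightarrow> b \<in> alg_carrier B \<Longrightarrow> \<phi> (alg_scale B c b) = c * \<phi> b"
  by (auto simp: characters_def linear_functionals_def)

lemma character_mult:
  "\<phi> \<in> \<Delta> B \<Longrightarrow> a \<in> alg_carrier B \<Longrightarrow> b \<in> alg_carrier B \<Longrightarrow> \<phi> (alg_mult B a b) = \<phi> a * \<phi> b"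
  by (auto simp: characters_def)

lemma topspace_character_topology:
  assumes "\<Delta> B \<subseteq> dual_space B"
  shows "topspace (character_topology B) = \<Delta> B"
  using assms characters_extensional[of B]
  by (auto simp: character_topology_def weak_star_topology_def PiE_def)

lemma continuous_map_eval_character:
  assumes "b \<in> alg_carrier B"
  shows "continuous_map (character_topology B) euclidean (\<lambda>\<phi>. \<phi> b)"
  unfolding character_topology_def weak_star_topology_def
  by (intro continuous_map_from_subtopology continuous_map_product_projection assms)

text \<open>The weak* topology is initial for the evaluations at elements of the carrier, so it
  suffices to test continuity on them.\<close>

lemma continuous_map_into_characters:
  assumes "\<Delta> B \<subseteq> dual_space B" "\<Theta> ` topspace X \<subseteq> \<Delta> B"
    and "\<And>b. b \<in> alg_carrier B \<Longrightarrow> continuous_map X euclidean (\<lambda>\<phi>. \<Theta> \<phi> b)"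
  shows "continuous_map X (character_topology B) \<Theta>"
  unfolding character_topology_def weak_star_topology_def
  using assms characters_extensional[of B]
  by (auto simp: continuous_map_in_subtopology continuous_map_componentwise image_subset_iff)

text \<open>The common core of both transfers over a finite group. The BSE inequality for
  \<open>\<sigma>\<close> is applied to the characters \<open>\<Theta> (\<phi> k)\<close>, and
  \<open>bound\<close> converts the resulting dual norm at the cost of the factor \<open>C\<close>.
  It is used once with restriction to point masses at 0 as \<open>\<Theta>\<close>, and once with
  tensoring by a fixed group character.\<close>

lemma BSE_functions_pullback:
  assumes \<sigma>: "\<sigma> \<in> BSE_functions A"
    and dA: "\<Delta> A \<subseteq> dual_space A" and dB: "\<Delta> B \<subseteq> dual_space B"
    and \<Theta>: "\<And>\<phi>. \<phi> \<in> \<Delta> B \<Longrightarrow> \<Theta> \<phi> \<in> \<Delta> A"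
    and cont: "\<And>a. a \<in> alg_carrier A \<Longrightarrow> continuous_map (character_topology B) euclidean (\<lambda>\<phi>. \<Theta> \<phi> a)"
    and bound: "\<And>(n::nat) (\<alpha>::nat \<Rightarrow> complex) \<phi>. (\<And>k. k \<in> {1..n} \<Longrightarrow> \<phi> k \<in> \<Delta> B) \<Longrightarrow>
      dual_norm A (\<lambda>a\<in>alg_carrier A. \<Sum>k=1..n. \<alpha> k * \<Theta> (\<phi> k) a)
        \<le> C * dual_norm B (\<lambda>b\<in>alg_carrier B. \<Sum>k=1..n. \<alpha> k * \<phi> k b)"
    and C: "C > 0"
  shows "(\<lambda>\<phi>\<in>\<Delta> B. \<sigma> (\<Theta> \<phi>)) \<in> BSE_functions B"
proof -
  have top: "topspace (character_topology B) = \<Delta> B" by (rule topspace_character_topology[OF dB])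
  have c\<Theta>: "continuous_map (character_topology B) (character_topology A) \<Theta>"
    by (rule continuous_map_into_characters[OF dA _ cont]) (use \<Theta> top in auto)
  have c\<sigma>: "continuous_map (character_topology A) euclidean \<sigma>" and b\<sigma>: "bounded (\<sigma> ` \<Delta> A)"
    using \<sigma> by (auto simp: BSE_functions_def Cb_characters_def)
  have cb: "(\<lambda>\<phi>\<in>\<Delta> B. \<sigma> (\<Theta> \<phi>)) \<in> Cb_characters B"
    unfolding Cb_characters_def
  proof (intro CollectI conjI)
    have "continuous_map (character_topology B) euclidean (\<sigma> \<circ> \<Theta>)"
      by (rule continuous_map_compose[OF c\<Theta> c\<sigma>])
    then show "continuous_map (character_topology B) euclidean (\<lambda>\<phi>\<in>\<Delta> B. \<sigma> (\<Theta> \<phi>))"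
      by (rule continuous_map_eq) (simp add: top)
    show "bounded ((\<lambda>\<phi>\<in>\<Delta> B. \<sigma> (\<Theta> \<phi>)) ` \<Delta> B)"
      by (rule bounded_subset[OF b\<sigma>]) (use \<Theta> in auto)
  qed auto
  obtain \<beta> where \<beta>: "\<beta> > 0" and le: "\<And>(n::nat) (\<alpha>::nat \<Rightarrow> complex) \<phi>. (\<And>k. k \<in> {1..n} \<Longrightarrow> \<phi> k \<in> \<Delta> A) \<Longrightarrow>
       cmod (\<Sum>k=1..n. \<alpha> k * \<sigma> (\<phi> k))
         \<le> \<beta> * dual_norm A (\<lambda>b\<in>alg_carrier A. \<Sum>k=1..n. \<alpha> k * \<phi> k b)"
    using \<sigma> unfolding BSE_functions_def by blast
  have "cmod (\<Sum>k=1..n. \<alpha> k * (\<lambda>\<phi>\<in>\<Delta> B. \<sigma> (\<Theta> \<phi>)) (\<phi> k))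
         \<le> (\<beta> * C) * dual_norm B (\<lambda>b\<in>alg_carrier B. \<Sum>k=1..n. \<alpha> k * \<phi> k b)"
    if \<phi>: "\<And>k. k \<in> {1..n} \<Longrightarrow> \<phi> k \<in> \<Delta> B" for n :: nat and \<alpha> :: "nat \<Rightarrow> complex" and \<phi>
  proof -
    have "(\<Sum>k=1..n. \<alpha> k * (\<lambda>\<phi>\<in>\<Delta> B. \<sigma> (\<Theta> \<phi>)) (\<phi> k)) = (\<Sum>k=1..n. \<alpha> k * \<sigma> (\<Theta> (\<phi> k)))"
      by (rule sum.cong) (use \<phi> in auto)
    also have "cmod \<dots> \<le> \<beta> * dual_norm A (\<lambda>a\<in>alg_carrier A. \<Sum>k=1..n. \<alpha> k * \<Theta> (\<phi> k) a)"
      by (rule le) (use \<phi> \<Theta> in auto)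
    also have "\<dots> \<le> \<beta> * (C * dual_norm B (\<lambda>b\<in>alg_carrier B. \<Sum>k=1..n. \<alpha> k * \<phi> k b))"
      using bound[of n \<phi> \<alpha>] \<phi> \<beta> by (intro mult_left_mono) auto
    finally show ?thesis by (simp add: mult.assoc)
  qed
  moreover have "\<beta> * C > 0" using \<beta> C by simp
  ultimately show ?thesis using cb unfolding BSE_functions_def by blast
qed

text \<open>The supremum is taken in the reals, so the unit ball has to be known to be nonempty;
  \<open>b0\<close> witnesses this.\<close>

lemma dual_norm_le:
  assumes "b0 \<in> alg_carrier B" "alg_norm B b0 \<le> 1"
    and "\<And>b. b \<in> alg_carrier B \<Longrightarrow> alg_norm B b \<le> 1 \<Longrightarrow> cmod (\<psi> b) \<le> K"
  shows "dual_norm B \<psi> \<le> K"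
  unfolding dual_norm_def by (rule cSUP_least) (use assms in auto)

text \<open>Only those algebra laws that identify multipliers with multiplications. Boundedness is
  asked for with arbitrary constants (\<open>L\<close> may depend on \<open>b\<close>, and
  \<open>K\<close> need not be 1), so that crude estimates suffice for functions on a finite
  group.\<close>

locale unital_normed_alg =
  fixes B :: "'b normed_alg" and e :: 'b and K :: real
  assumes unit_closed: "e \<in> alg_carrier B"
    and mult_closed: "a \<in> alg_carrier B \<Longrightarrow> b \<in> alg_carrier B \<Longrightarrow> alg_mult B a b \<in> alg_carrier B"
    and add_closed: "a \<in> alg_carrier B \<Longrightarrow> b \<in> alg_carrier B \<Longrightarrow> alg_add B a b \<in> alg_carrier B"
    and scale_closed: "b \<in> alg_carrier B \<Longrightarrow> alg_scale B z b \<in> alg_carrier B"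
    and mult_unit: "b \<in> alg_carrier B \<Longrightarrow> alg_mult B b e = b"
    and mult_assoc: "a \<in> alg_carrier B \<Longrightarrow> b \<in> alg_carrier B \<Longrightarrow> d \<in> alg_carrier B \<Longrightarrow>
      alg_mult B (alg_mult B a b) d = alg_mult B a (alg_mult B b d)"
    and add_mult: "a \<in> alg_carrier B \<Longrightarrow> b \<in> alg_carrier B \<Longrightarrow> d \<in> alg_carrier B \<Longrightarrow>
      alg_mult B (alg_add B a b) d = alg_add B (alg_mult B a d) (alg_mult B b d)"
    and scale_mult: "a \<in> alg_carrier B \<Longrightarrow> b \<in> alg_carrier B \<Longrightarrow>
      alg_mult B (alg_scale B z a) b = alg_scale B z (alg_mult B a b)"
    and mult_bounded: "b \<in> alg_carrier B \<Longrightarrow>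
      \<exists>L. \<forall>a\<in>alg_carrier B. alg_norm B (alg_mult B a b) \<le> L * alg_norm B a"
    and norm_scale: "b \<in> alg_carrier B \<Longrightarrow> alg_norm B (alg_scale B z b) = cmod z * alg_norm B b"
    and norm_nonneg: "b \<in> alg_carrier B \<Longrightarrow> 0 \<le> alg_norm B b"
    and character_bounded: "\<phi> \<in> \<Delta> B \<Longrightarrow> b \<in> alg_carrier B \<Longrightarrow> cmod (\<phi> b) \<le> K * alg_norm B b"
begin

lemma characters_in_dual: "\<Delta> B \<subseteq> dual_space B"
  using character_bounded by (auto simp: dual_space_def characters_def)

lemma bdd_above_unit_ball:
  assumes "\<And>b. b \<in> alg_carrier B \<Longrightarrow> cmod (\<psi> b) \<le> L * alg_norm B b"
  shows "bdd_above ((\<lambda>b. cmod (\<psi> b)) ` {b \<in> alg_carrier B. alg_norm B b \<le> 1})"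
proof (rule bdd_aboveI2)
  fix b assume b: "b \<in> {b \<in> alg_carrier B. alg_norm B b \<le> 1}"
  have "cmod (\<psi> b) \<le> L * alg_norm B b" using assms b by auto
  also have "\<dots> \<le> \<bar>L\<bar> * 1" using b norm_nonneg[of b] by (intro mult_mono) auto
  finally show "cmod (\<psi> b) \<le> \<bar>L\<bar>" by simp
qed

lemma abs_le_dual_norm:
  assumes scale: "\<And>z b. b \<in> alg_carrier B \<Longrightarrow> \<psi> (alg_scale B z b) = z * \<psi> b"
    and bdd: "\<And>b. b \<in> alg_carrier B \<Longrightarrow> cmod (\<psi> b) \<le> L * alg_norm B b"
    and b: "b \<in> alg_carrier B"
  shows "cmod (\<psi> b) \<le> dual_norm B \<psi> * alg_norm B b"
proof (cases "alg_norm B b = 0")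
  case True
  \<comment> \<open>Definiteness of the norm is not part of the locale; an element of norm 0 cannot
    be normalised, but boundedness forces \<open>\<psi>\<close> to vanish there.\<close>
  then show ?thesis using bdd[OF b] by simp
next
  case False
  then have pos: "alg_norm B b > 0" using norm_nonneg[OF b] by simp
  define u where "u = alg_scale B (complex_of_real (1 / alg_norm B b)) b"
  have u: "u \<in> alg_carrier B" "alg_norm B u = 1"
    using pos b by (simp_all add: u_def scale_closed norm_scale norm_divide)
  have "cmod (\<psi> u) \<le> dual_norm B \<psi>"
    unfolding dual_norm_def by (rule cSUP_upper[OF _ bdd_above_unit_ball[OF bdd]]) (use u in auto)
  moreover have "cmod (\<psi> u) = cmod (\<psi> b) / alg_norm B b"
    unfolding u_def scale[OF b] using pos by (simp add: norm_mult norm_divide)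
  ultimately show ?thesis using pos by (simp add: field_simps)
qed

lemma combination_bounded:
  fixes N :: nat
  assumes "\<And>k. k \<in> {1..N} \<Longrightarrow> \<phi> k \<in> \<Delta> B" and b: "b \<in> alg_carrier B"
  shows "cmod (\<Sum>k=1..N. \<alpha> k * \<phi> k b) \<le> ((\<Sum>k=1..N. cmod (\<alpha> k)) * K) * alg_norm B b"
proof -
  have "cmod (\<Sum>k=1..N. \<alpha> k * \<phi> k b) \<le> (\<Sum>k=1..N. cmod (\<alpha> k) * (K * alg_norm B b))"
    by (rule sum_norm_le) (use assms(1) character_bounded[OF _ b] in
        \<open>auto simp: norm_mult intro!: mult_left_mono\<close>)
  also have "\<dots> = ((\<Sum>k=1..N. cmod (\<alpha> k)) * K) * alg_norm B b"
    by (simp add: sum_distrib_right mult.assoc)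
  finally show ?thesis .
qed

lemma abs_combination_le_dual_norm:
  fixes N :: nat
  assumes \<phi>: "\<And>k. k \<in> {1..N} \<Longrightarrow> \<phi> k \<in> \<Delta> B" and b: "b \<in> alg_carrier B"
  shows "cmod (\<Sum>k=1..N. \<alpha> k * \<phi> k b)
    \<le> dual_norm B (\<lambda>b\<in>alg_carrier B. \<Sum>k=1..N. \<alpha> k * \<phi> k b) * alg_norm B b"
proof -
  let ?\<psi> = "\<lambda>b\<in>alg_carrier B. \<Sum>k=1..N. \<alpha> k * \<phi> k b"
  have "cmod (?\<psi> b) \<le> dual_norm B ?\<psi> * alg_norm B b"
  proof (rule abs_le_dual_norm[OF _ _ b])
    fix z b assume b: "b \<in> alg_carrier B"
    have "(\<Sum>k=1..N. \<alpha> k * \<phi> k (alg_scale B z b)) = (\<Sum>k=1..N. z * (\<alpha> k * \<phi> k b))"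
      by (rule sum.cong) (simp_all add: \<phi> character_scale[OF _ b])
    then show "?\<psi> (alg_scale B z b) = z * ?\<psi> b"
      using b scale_closed[OF b] by (simp add: sum_distrib_left)
    show "cmod (?\<psi> b) \<le> ((\<Sum>k=1..N. cmod (\<alpha> k)) * K) * alg_norm B b"
      using combination_bounded[OF \<phi> b, where \<alpha>=\<alpha>] b by simp
  qed
  then show ?thesis using b by simp
qed

lemma dual_norm_combination_nonneg:
  fixes N :: nat
  assumes \<phi>: "\<And>k. k \<in> {1..N} \<Longrightarrow> \<phi> k \<in> \<Delta> B"
  shows "0 \<le> dual_norm B (\<lambda>b\<in>alg_carrier B. \<Sum>k=1..N. \<alpha> k * \<phi> k b)"
proof -
  let ?\<psi> = "\<lambda>b\<in>alg_carrier B. \<Sum>k=1..N. \<alpha> k * \<phi> k b"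
  \<comment> \<open>Any point of the unit ball shows that the supremum of absolute values is
    nonnegative; \<open>0 \<cdot> e\<close> is one that the locale provides.\<close>
  have z: "alg_scale B 0 e \<in> {b \<in> alg_carrier B. alg_norm B b \<le> 1}"
    by (simp add: scale_closed norm_scale unit_closed)
  have "bdd_above ((\<lambda>b. cmod (?\<psi> b)) ` {b \<in> alg_carrier B. alg_norm B b \<le> 1})"
    by (rule bdd_above_unit_ball[where L="(\<Sum>k=1..N. cmod (\<alpha> k)) * K"])
      (use combination_bounded[OF \<phi>, where \<alpha>=\<alpha>] in simp)
  from cSUP_upper[OF z this] have "cmod (?\<psi> (alg_scale B 0 e)) \<le> dual_norm B ?\<psi>"
    unfolding dual_norm_def .
  then show ?thesis using norm_ge_zero order_trans by blast
qed

lemma gelfand_BSE: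
  assumes b: "b \<in> alg_carrier B"
  shows "(\<lambda>\<phi>\<in>\<Delta> B. \<phi> b) \<in> BSE_functions B"
proof -
  have top: "topspace (character_topology B) = \<Delta> B"
    by (rule topspace_character_topology[OF characters_in_dual])
  have "(\<lambda>\<phi>\<in>\<Delta> B. \<phi> b) \<in> Cb_characters B"
    unfolding Cb_characters_def
  proof (intro CollectI conjI)
    show "continuous_map (character_topology B) euclidean (\<lambda>\<phi>\<in>\<Delta> B. \<phi> b)"
      by (rule continuous_map_eq[OF continuous_map_eval_character[OF b]]) (simp add: top)
    show "bounded ((\<lambda>\<phi>\<in>\<Delta> B. \<phi> b) ` \<Delta> B)"
      using character_bounded[OF _ b] by (auto simp: bounded_iff)
  qed auto
  \<comment> \<open>The BSE constant must be strictly positive while \<open>b\<close> may have norm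
    0, hence \<open>alg_norm B b + 1\<close>.\<close>
  moreover have "cmod (\<Sum>k=1..n. \<alpha> k * (\<lambda>\<phi>\<in>\<Delta> B. \<phi> b) (\<phi> k))
      \<le> (alg_norm B b + 1) * dual_norm B (\<lambda>b\<in>alg_carrier B. \<Sum>k=1..n. \<alpha> k * \<phi> k b)"
    if \<phi>: "\<And>k. k \<in> {1..n} \<Longrightarrow> \<phi> k \<in> \<Delta> B" for n :: nat and \<alpha> :: "nat \<Rightarrow> complex" and \<phi>
  proof -
    let ?D = "dual_norm B (\<lambda>b\<in>alg_carrier B. \<Sum>k=1..n. \<alpha> k * \<phi> k b)"
    have "0 \<le> ?D" by (rule dual_norm_combination_nonneg[OF \<phi>])
    have "(\<Sum>k=1..n. \<alpha> k * (\<lambda>\<phi>\<in>\<Delta> B. \<phi> b) (\<phi> k)) = (\<Sum>k=1..n. \<alpha> k * \<phi> k b)"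
      by (rule sum.cong) (use \<phi> in auto)
    also have "cmod \<dots> \<le> ?D * alg_norm B b"
      by (rule abs_combination_le_dual_norm[OF \<phi> b])
    also have "\<dots> \<le> (alg_norm B b + 1) * ?D" using \<open>0 \<le> ?D\<close> by (simp add: algebra_simps)
    finally show ?thesis .
  qed
  moreover have "alg_norm B b + 1 > 0" using norm_nonneg[OF b] by simp
  ultimately show ?thesis unfolding BSE_functions_def by blast
qed

lemma multiplier_transform_unital:
  assumes T: "T \<in> multipliers B"
  shows "multiplier_transform B T = (\<lambda>\<phi>\<in>\<Delta> B. \<phi> (T e))"
proof (rule multiplier_transform_eq)
  have Te: "T e \<in> alg_carrier B" using T unit_closed by (auto simp: multipliers_def)
  show "(\<lambda>\<phi>\<in>\<Delta> B. \<phi> (T e)) \<in> Cb_characters B"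
    using gelfand_BSE[OF Te] by (auto simp: BSE_functions_def)
  fix b \<phi> assume b: "b \<in> alg_carrier B" and \<phi>: "\<phi> \<in> \<Delta> B"
  \<comment> \<open>Write \<open>b\<close> as \<open>b e\<close> and use the multiplier
    identity.\<close>
  have "T b = alg_mult B b (T e)"
    using T b unit_closed mult_unit[OF b] unfolding multipliers_def by force
  then show "\<phi> (T b) = (\<lambda>\<phi>\<in>\<Delta> B. \<phi> (T e)) \<phi> * \<phi> b"
    using \<phi> character_mult[OF \<phi> b Te] by simp
qed

lemma mult_multiplier:
  assumes f: "f \<in> alg_carrier B"
  shows "(\<lambda>b\<in>alg_carrier B. alg_mult B b f) \<in> multipliers B"
  using f mult_bounded[OF f]
  by (auto simp: multipliers_def mult_closed add_closed scale_closed add_mult scale_mult mult_assoc)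

lemma BSE_algebra_iff:
  "BSE_algebra B \<longleftrightarrow> (\<forall>\<sigma>\<in>BSE_functions B. \<exists>f\<in>alg_carrier B. \<forall>\<phi>\<in>\<Delta> B. \<phi> f = \<sigma> \<phi>)"
proof
  assume B: "BSE_algebra B"
  show "\<forall>\<sigma>\<in>BSE_functions B. \<exists>f\<in>alg_carrier B. \<forall>\<phi>\<in>\<Delta> B. \<phi> f = \<sigma> \<phi>"
  proof
    fix \<sigma> assume "\<sigma> \<in> BSE_functions B"
    then obtain T where T: "T \<in> multipliers B" "\<sigma> = multiplier_transform B T"
      using B unfolding BSE_algebra_def by blast
    have "T e \<in> alg_carrier B" using T unit_closed by (auto simp: multipliers_def)
    then show "\<exists>f\<in>alg_carrier B. \<forall>\<phi>\<in>\<Delta> B. \<phi> f = \<sigma> \<phi>"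
      using multiplier_transform_unital[OF T(1)] T(2) by auto
  qed
next
  assume *: "\<forall>\<sigma>\<in>BSE_functions B. \<exists>f\<in>alg_carrier B. \<forall>\<phi>\<in>\<Delta> B. \<phi> f = \<sigma> \<phi>"
  show "BSE_algebra B"
    unfolding BSE_algebra_def
  proof (intro equalityI subsetI)
    fix \<sigma> assume "\<sigma> \<in> multiplier_transform B ` multipliers B"
    then obtain T where T: "T \<in> multipliers B" "\<sigma> = multiplier_transform B T" by blast
    have "T e \<in> alg_carrier B" using T unit_closed by (auto simp: multipliers_def)
    then show "\<sigma> \<in> BSE_functions B"
      using gelfand_BSE multiplier_transform_unital[OF T(1)] T(2) by simp
  next
    fix \<sigma> assume \<sigma>: "\<sigma> \<in> BSE_functions B"
    then obtain f where f: "f \<in> alg_carrier B" "\<And>\<phi>. \<phi> \<in> \<Delta> B \<Longrightarrow> \<phi> f = \<sigma> \<phi>" using * by blast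
    let ?T = "\<lambda>b\<in>alg_carrier B. alg_mult B b f"
    have "multiplier_transform B ?T = \<sigma>"
      by (rule multiplier_transform_eq) (use \<sigma> f in \<open>auto simp: BSE_functions_def character_mult\<close>)
    then show "\<sigma> \<in> multiplier_transform B ` multipliers B"
      using mult_multiplier[OF f(1)] by blast
  qed
qed

end

section \<open>Commutative unital Banach algebras\<close>

lemma type_algebra_simps [simp]:
  "alg_carrier (type_algebra TYPE('a::complex_normed_algebra)) = UNIV"
  "alg_zero (type_algebra TYPE('a)) = 0"
  "alg_add (type_algebra TYPE('a)) = (+)"
  "alg_scale (type_algebra TYPE('a)) = scaleC"
  "alg_mult (type_algebra TYPE('a)) = (*)"
  "alg_norm (type_algebra TYPE('a)) = norm"
  by (simp_all add: type_algebra_def)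

text \<open>From \<open>\<phi> b = \<phi> b * \<phi> 1\<close> a multiplicative functional is
  nonzero exactly if it maps 1 to 1; this makes being a character a set of equations.\<close>

lemma type_characters_iff:
  fixes \<phi> :: "'a::{complex_normed_algebra,comm_ring_1} \<Rightarrow> complex"
  shows "\<phi> \<in> \<Delta> (type_algebra TYPE('a)) \<longleftrightarrow> (\<forall>a b. \<phi> (a + b) = \<phi> a + \<phi> b) \<and>
    (\<forall>c a. \<phi> (scaleC c a) = c * \<phi> a) \<and> (\<forall>a b. \<phi> (a * b) = \<phi> a * \<phi> b) \<and> \<phi> 1 = 1"
proof
  assume \<phi>: "\<phi> \<in> \<Delta> (type_algebra TYPE('a))"
  obtain b where "\<phi> b \<noteq> 0" using \<phi> by (auto simp: characters_def)
  moreover have "\<phi> (b * 1) = \<phi> b * \<phi> 1" using character_mult[OF \<phi>, of b 1] by simp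
  ultimately have "\<phi> 1 = 1" by simp
  then show "(\<forall>a b. \<phi> (a + b) = \<phi> a + \<phi> b) \<and>
    (\<forall>c a. \<phi> (scaleC c a) = c * \<phi> a) \<and> (\<forall>a b. \<phi> (a * b) = \<phi> a * \<phi> b) \<and> \<phi> 1 = 1"
    using \<phi> by (auto simp: characters_def linear_functionals_def)
next
  assume *: "(\<forall>a b. \<phi> (a + b) = \<phi> a + \<phi> b) \<and>
    (\<forall>c a. \<phi> (scaleC c a) = c * \<phi> a) \<and> (\<forall>a b. \<phi> (a * b) = \<phi> a * \<phi> b) \<and> \<phi> 1 = 1"
  then have "\<exists>b. \<phi> b \<noteq> 0" by (metis zero_neq_one)
  then show "\<phi> \<in> \<Delta> (type_algebra TYPE('a))"
    using * by (auto simp: characters_def linear_functionals_def)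
qed

text \<open>If \<open>\<phi> a = 1\<close> and \<open>norm a < 1\<close>, then \<open>b = a + a\<^sup>2 + \<dots>\<close> satisfies \<open>b = a + a b\<close>, which \<open>\<phi>\<close> maps to
  \<open>\<phi> b = 1 + \<phi> b\<close>.\<close>

lemma type_character_norm_le:
  fixes \<phi> :: "'a::{complex_normed_algebra,comm_ring_1,banach} \<Rightarrow> complex"
  assumes \<phi>: "\<phi> \<in> \<Delta> (type_algebra TYPE('a))"
  shows "cmod (\<phi> x) \<le> norm x"
proof (rule ccontr)
  assume "\<not> cmod (\<phi> x) \<le> norm x"
  then have less: "norm x < cmod (\<phi> x)" by simp
  then have pos: "cmod (\<phi> x) > 0" using norm_ge_zero[of x] by linarith
  define a where "a = scaleC (1 / \<phi> x) x"
  have \<phi>a: "\<phi> a = 1" using \<phi> pos by (auto simp: a_def type_characters_iff)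
  have na: "norm a < 1" using less pos by (simp add: a_def norm_scaleC norm_divide)
  have np: "norm (a ^ Suc n) \<le> norm a ^ Suc n" for n
  proof (induction n)
    case (Suc n)
    have "norm (a ^ Suc (Suc n)) \<le> norm a * norm (a ^ Suc n)"
      unfolding power_Suc[of a "Suc n"] by (rule norm_mult_ineq)
    also have "\<dots> \<le> norm a * norm a ^ Suc n" by (rule mult_left_mono[OF Suc]) simp
    finally show ?case by simp
  qed simp
  have sm: "summable (\<lambda>n. a ^ Suc n)"
  proof (rule summable_comparison_test)
    show "\<exists>N. \<forall>n\<ge>N. norm (a ^ Suc n) \<le> norm a ^ Suc n" using np by blast
    have "summable (\<lambda>n. norm a ^ n)" by (rule summable_geometric) (use na in auto)
    then show "summable (\<lambda>n. norm a ^ Suc n)" by (subst summable_Suc_iff)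
  qed
  define b where "b = (\<Sum>n. a ^ Suc n)"
  have "a * b = (\<Sum>n. a * a ^ Suc n)" unfolding b_def by (rule suminf_mult[OF sm, symmetric])
  also have "\<dots> = (\<Sum>n. a ^ Suc (Suc n))" by simp
  also have "\<dots> = b - a" unfolding b_def using suminf_split_head[OF sm] by simp
  finally have "b = a + a * b" by simp
  then have "\<phi> b = \<phi> a + \<phi> a * \<phi> b" using \<phi> unfolding type_characters_iff by metis
  then show False using \<phi>a by simp
qed

interpretation type_alg: unital_normed_alg
  "type_algebra TYPE('a::{complex_normed_algebra,comm_ring_1,banach})" 1 1
proof unfold_locales
  fix b :: 'a
  show "\<exists>L. \<forall>a\<in>alg_carrier (type_algebra TYPE('a)). alg_norm (type_algebra TYPE('a))
      (alg_mult (type_algebra TYPE('a)) a b) \<le> L * alg_norm (type_algebra TYPE('a)) a"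
    by (rule exI[of _ "norm b"]) (simp add: norm_mult_ineq mult.commute[of "norm b"])
qed (auto simp: distrib_right mult.assoc mult_scaleC_left norm_scaleC type_character_norm_le)

lemma type_character_bounded_linear:
  fixes \<phi> :: "'a::{complex_normed_algebra,comm_ring_1,banach} \<Rightarrow> complex"
  assumes \<phi>: "\<phi> \<in> \<Delta> (type_algebra TYPE('a))"
  shows "bounded_linear \<phi>"
proof (rule bounded_linear_intro[where K=1])
  show "\<phi> (x + y) = \<phi> x + \<phi> y" for x y using \<phi> by (simp add: type_characters_iff)
  show "\<phi> (r *\<^sub>R x) = r *\<^sub>R \<phi> x" for r x
    using \<phi> by (simp add: type_characters_iff scaleR_conv_of_real flip: scaleC_of_real)
  show "norm (\<phi> x) \<le> norm x * 1" for x using type_character_norm_le[OF \<phi>] by simp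
qed


section \<open>Haar measure and the Baire sigma-algebra of a compact group\<close>

text \<open>Borel sets of \<open>G \<times> G\<close> need not belong to the product of the Borel sigma-algebras, so that
  Fubini's theorem does not apply directly to \<open>f y * g (x - y)\<close>. The Baire sets do behave well under
  products, and regularity makes every Borel function almost everywhere equal to a Baire function.\<close>

lemma continuous_on_UNIV_comp:
  "continuous_on UNIV f \<Longrightarrow> continuous_on UNIV g \<Longrightarrow> continuous_on UNIV (\<lambda>x. f (g x))"
  by (rule continuous_on_compose2[of UNIV f UNIV g]) auto

lemma plus_image: "(+) x ` S = (+) (- x) -` S" for x :: "'a::group_add"
proof (intro set_eqI iffI)
  fix y assume "y \<in> (+) (- x) -` S"
  then have "- x + y \<in> S" "y = x + (- x + y)" by simp_all
  then show "y \<in> (+) x ` S" by blast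
qed auto

lemma uminus_image: "uminus ` S = uminus -` S" for S :: "'a::group_add set"
proof (intro set_eqI iffI)
  fix y assume "y \<in> uminus -` S"
  then have "- y \<in> S" "y = - (- y)" by simp_all
  then show "y \<in> uminus ` S" by blast
qed auto

lemma Hausdorff_space_t2: "Hausdorff_space (euclidean :: 'a::t2_space topology)"
  unfolding Hausdorff_space_def by (auto simp: disjnt_def) (meson hausdorff)

lemma compact_t2_urysohn:
  fixes S T :: "'a::t2_space set"
  assumes "compact (UNIV :: 'a set)" "closed S" "closed T" "S \<inter> T = {}"
  obtains f :: "'a \<Rightarrow> real" where "continuous_on UNIV f" "\<And>x. f x \<in> {0..1}"
    "\<And>x. x \<in> S \<Longrightarrow> f x = 0" "\<And>x. x \<in> T \<Longrightarrow> f x = 1"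
proof -
  have "normal_space (euclidean :: 'a topology)"
    by (rule compact_Hausdorff_or_regular_imp_normal_space)
      (use assms(1) Hausdorff_space_t2 in \<open>auto simp: compact_space_def\<close>)
  then obtain f where f: "continuous_map euclidean (top_of_set {0..1::real}) f" "f ` S \<subseteq> {0}" "f ` T \<subseteq> {1}"
    using Urysohn_lemma[of "euclidean :: 'a topology" S T 0 1] assms by (auto simp: disjnt_def)
  have "continuous_on UNIV f" "f x \<in> {0..1}" for x
    using f(1) by (auto simp: continuous_map_in_subtopology)
  then show ?thesis by (rule that[of f]) (use f(2,3) in \<open>auto simp: image_subset_iff\<close>)
qed

text \<open>It serves only as a sigma-algebra, since \<open>sigma\<close> carries the zero measure.
  Haar measure is pushed forward to it later. Real continuous functions suffice as generators;
  complex ones are treated by real and imaginary parts.\<close>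

definition baire :: "'a::topological_space measure" where
  "baire = sigma UNIV {f -` U | (f :: 'a \<Rightarrow> real) U. continuous_on UNIV f \<and> open U}"

lemma space_baire [simp]: "space baire = UNIV"
  by (simp add: baire_def)

lemma continuous_baire_real:
  fixes f :: "'a::topological_space \<Rightarrow> real"
  assumes "continuous_on UNIV f" shows "f \<in> borel_measurable baire"
proof (rule borel_measurableI)
  fix S :: "real set" assume "open S"
  then show "f -` S \<inter> space baire \<in> sets baire"
    unfolding baire_def using assms by auto
qed

lemma measurable_into_baire:
  assumes "\<And>f::'a::topological_space \<Rightarrow> real. continuous_on UNIV f \<Longrightarrow> (\<lambda>x. f (h x)) \<in> borel_measurable N"
  shows "h \<in> measurable N (baire :: 'a measure)"
  unfolding baire_def
proof (rule measurable_sigma_sets[OF sets_measure_of])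
  fix A assume "A \<in> {f -` U | (f :: 'a \<Rightarrow> real) U. continuous_on UNIV f \<and> open U}"
  then obtain f U where A: "A = f -` U" "continuous_on UNIV (f :: 'a \<Rightarrow> real)" "open U" by blast
  have "(\<lambda>x. f (h x)) -` U \<inter> space N \<in> sets N"
    using measurable_sets[OF assms[OF A(2)], of U] A(3) by auto
  then show "h -` A \<inter> space N \<in> sets N" using A(1) by (simp add: vimage_def)
qed auto

lemma borel_to_baire: "(\<lambda>x. x) \<in> measurable borel baire"
  by (rule measurable_into_baire) (rule borel_measurable_continuous_onI)

lemma borel_measurable_if_baire: "f \<in> measurable baire N \<Longrightarrow> f \<in> measurable borel N"
  by (rule measurable_compose[OF borel_to_baire])

lemma continuous_baire:
  fixes f :: "'a::topological_space \<Rightarrow> complex"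
  assumes "continuous_on UNIV f" shows "f \<in> borel_measurable baire"
  unfolding borel_measurable_complex_iff
  by (intro conjI continuous_baire_real continuous_intros assms)

text \<open>The continuous functions that are measurable for the product of the Baire sigma-algebras
  form a ring with constants. It separates points by Urysohn functions of one coordinate, so by
  Stone-Weierstrass it is uniformly dense in the continuous functions, and limits preserve
  measurability.\<close>

lemma continuous_pair_baire_real:
  fixes F :: "'a::t2_space \<times> 'b::t2_space \<Rightarrow> real"
  assumes c: "compact (UNIV :: 'a set)" "compact (UNIV :: 'b set)" and F: "continuous_on UNIV F"
  shows "F \<in> borel_measurable (baire \<Otimes>\<^sub>M baire)"
proof -
  define R where "R = {f :: 'a \<times> 'b \<Rightarrow> real. continuous_on UNIV f \<and> f \<in> borel_measurable (baire \<Otimes>\<^sub>M baire)}"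
  interpret function_ring_on R UNIV
  proof
    show "compact (UNIV :: ('a \<times> 'b) set)" using compact_Times[OF c] by simp
    fix x y :: "'a \<times> 'b" assume "x \<noteq> y"
    then consider "fst x \<noteq> fst y" | "snd x \<noteq> snd y" by (auto simp: prod_eq_iff)
    then show "\<exists>f\<in>R. f x \<noteq> f y"
    proof cases
      case 1
      obtain f :: "'a \<Rightarrow> real" where f: "continuous_on UNIV f" "f (fst x) = 0" "f (fst y) = 1"
        using compact_t2_urysohn[OF c(1), of "{fst x}" "{fst y}"] 1 by auto
      have "continuous_on UNIV (\<lambda>p::'a \<times> 'b. f (fst p))"
        by (rule continuous_on_compose2[OF f(1) continuous_on_fst[OF continuous_on_id]]) simp
      then have "(\<lambda>p. f (fst p)) \<in> R"
        unfolding R_def using measurable_compose[OF measurable_fst continuous_baire_real[OF f(1)]] by blast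
      then show ?thesis using f(2,3) by (intro bexI[of _ "\<lambda>p. f (fst p)"]) auto
    next
      case 2
      obtain f :: "'b \<Rightarrow> real" where f: "continuous_on UNIV f" "f (snd x) = 0" "f (snd y) = 1"
        using compact_t2_urysohn[OF c(2), of "{snd x}" "{snd y}"] 2 by auto
      have "continuous_on UNIV (\<lambda>p::'a \<times> 'b. f (snd p))"
        by (rule continuous_on_compose2[OF f(1) continuous_on_snd[OF continuous_on_id]]) simp
      then have "(\<lambda>p. f (snd p)) \<in> R"
        unfolding R_def using measurable_compose[OF measurable_snd continuous_baire_real[OF f(1)]] by blast
      then show ?thesis using f(2,3) by (intro bexI[of _ "\<lambda>p. f (snd p)"]) auto
    qed
  next
    show "continuous_on UNIV f" if "f \<in> R" for f using that by (simp add: R_def)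
    show "(\<lambda>x. f x + g x) \<in> R" "(\<lambda>x. f x * g x) \<in> R" if "f \<in> R" "g \<in> R" for f g
      using that by (auto simp: R_def continuous_on_add continuous_on_mult)
    show "(\<lambda>_. c) \<in> R" for c by (simp add: R_def)
  qed
  obtain H :: "nat \<Rightarrow> _" where H: "H \<in> UNIV \<rightarrow> R" "uniform_limit UNIV H F sequentially"
    using Stone_Weierstrass[OF F] by blast
  show ?thesis
  proof (rule borel_measurable_LIMSEQ_real)
    show "H n \<in> borel_measurable (baire \<Otimes>\<^sub>M baire)" for n using H(1) by (auto simp: R_def Pi_iff)
    show "(\<lambda>n. H n x) \<longlonglongrightarrow> F x" for x by (rule tendsto_uniform_limitI[OF H(2)]) simp
  qed
qed

lemma continuous_pair_baire:
  fixes F :: "'a::t2_space \<times> 'b::t2_space \<Rightarrow> complex"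
  assumes c: "compact (UNIV :: 'a set)" "compact (UNIV :: 'b set)" and F: "continuous_on UNIV F"
  shows "F \<in> borel_measurable (baire \<Otimes>\<^sub>M baire)"
  unfolding borel_measurable_complex_iff
  by (intro conjI continuous_pair_baire_real c continuous_intros F)

locale compact_haar =
  fixes \<mu> :: "'g::{topological_ab_group_add,t2_space} measure"
  assumes cpt: "compact (UNIV :: 'g set)" and haar: "haar_prob \<mu>"
begin

lemma sets_mu [simp, measurable_cong]: "sets \<mu> = sets borel"
  using haar by (simp add: haar_prob_def)

lemma space_mu [simp]: "space \<mu> = UNIV"
  using sets_eq_imp_space_eq[OF sets_mu] by simp

sublocale prob_space \<mu>
  by (rule prob_spaceI) (use haar in \<open>simp add: haar_prob_def\<close>)

lemma prob_UNIV [simp]: "measure \<mu> UNIV = 1"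
  using prob_space by simp

lemma measurable_mu [simp]: "measurable \<mu> N = measurable borel N"
  by (rule measurable_cong_sets) auto

lemma outer_regular: "E \<in> sets borel \<Longrightarrow> emeasure \<mu> E = (INF U\<in>{U. open U \<and> E \<subseteq> U}. emeasure \<mu> U)"
  and inner_regular: "open U \<Longrightarrow> emeasure \<mu> U = (SUP K\<in>{K. compact K \<and> K \<subseteq> U}. emeasure \<mu> K)"
  and translate: "E \<in> sets borel \<Longrightarrow> emeasure \<mu> ((+) x ` E) = emeasure \<mu> E"
  using haar by (auto simp: haar_prob_def)

lemma continuous_translate:
  "continuous_on UNIV f \<Longrightarrow> continuous_on UNIV (\<lambda>s::'g. f (x + s))"
  "continuous_on UNIV f \<Longrightarrow> continuous_on UNIV (\<lambda>s::'g. f (s + x))"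
  by (erule continuous_on_UNIV_comp, intro continuous_intros)+

lemma borel_translate [measurable]:
  "(\<lambda>s::'g. x + s) \<in> borel_measurable borel" "(\<lambda>s::'g. s + x) \<in> borel_measurable borel"
  "(\<lambda>s::'g. - s + x) \<in> borel_measurable borel" "(\<lambda>s::'g. x - s) \<in> borel_measurable borel"
  by (auto intro!: borel_measurable_continuous_onI continuous_intros)

lemma distr_translate: "distr \<mu> borel ((+) x) = \<mu>"
proof (rule measure_eqI)
  fix E assume "E \<in> sets (distr \<mu> borel ((+) x))"
  then have E: "E \<in> sets borel" by simp
  have "(+) x -` E = (+) (- x) ` E" using plus_image[of "- x" E] by (simp only: minus_minus)
  then show "emeasure (distr \<mu> borel ((+) x)) E = emeasure \<mu> E"
    using E translate[OF E, of "- x"] by (subst emeasure_distr) simp_all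
qed auto

lemma integral_translate:
  fixes f :: "'g \<Rightarrow> 'b::{banach,second_countable_topology}"
  assumes "f \<in> borel_measurable borel"
  shows "(\<integral> s. f (x + s) \<partial>\<mu>) = (\<integral> s. f s \<partial>\<mu>)"
proof -
  have "(\<integral> s. f s \<partial>\<mu>) = (\<integral> s. f s \<partial>distr \<mu> borel ((+) x))" by (simp add: distr_translate)
  also have "\<dots> = (\<integral> s. f (x + s) \<partial>\<mu>)" by (rule integral_distr) (use assms in auto)
  finally show ?thesis by simp
qed

lemma integrable_translate:
  fixes f :: "'g \<Rightarrow> 'b::{banach,second_countable_topology}"
  assumes "integrable \<mu> f"
  shows "integrable \<mu> (\<lambda>s. f (x + s))"
proof -
  have "integrable (distr \<mu> borel ((+) x)) f" using assms by (simp add: distr_translate)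
  then show ?thesis using assms by (subst (asm) integrable_distr_eq) auto
qed

lemma continuous_bounded:
  fixes f :: "'g \<Rightarrow> 'b::real_normed_vector"
  assumes "continuous_on UNIV f" obtains C where "C > 0" "\<And>x. norm (f x) \<le> C"
proof -
  have "bounded (range f)" using compact_continuous_image[OF assms cpt] compact_imp_bounded by blast
  then show ?thesis using that by (auto simp: bounded_pos)
qed

lemma integrable_continuous:
  fixes f :: "'g \<Rightarrow> 'b::{banach,second_countable_topology}"
  assumes f: "continuous_on UNIV f" shows "integrable \<mu> f"
proof -
  obtain C where "\<And>x. norm (f x) \<le> C" using continuous_bounded[OF f] by blast
  then show ?thesis
    by (intro integrable_const_bound[where B=C]) (auto intro: borel_measurable_continuous_onI f)
qed

text \<open>The tube lemma over the compact second factor makes the neighbourhood of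
  \<open>x0\<close> independent of \<open>s\<close>, without a uniform structure on the first
  factor.\<close>

lemma uniform_param:
  fixes F :: "'a::topological_space \<times> 'g \<Rightarrow> 'b::real_normed_vector"
  assumes F: "continuous_on UNIV F" and \<epsilon>: "\<epsilon> > 0"
  obtains U where "open U" "x0 \<in> U" "\<And>x s. x \<in> U \<Longrightarrow> norm (F (x, s) - F (x0, s)) < \<epsilon>"
proof -
  define W where "W = {p. norm (F p - F (x0, snd p)) < \<epsilon>}"
  have cW: "continuous_on UNIV (\<lambda>p. norm (F p - F (x0, snd p)))"
    by (intro continuous_intros F continuous_on_UNIV_comp[OF F])
  have "open W" unfolding W_def by (rule open_Collect_less[OF cW continuous_on_const])
  moreover have "{x0} \<times> UNIV \<subseteq> W" using \<epsilon> by (auto simp: W_def)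
  ultimately have "\<exists>X0. x0 \<in> X0 \<and> open X0 \<and> X0 \<times> UNIV \<subseteq> W"
    by (rule Elementary_Topology.tube_lemma[OF cpt])
  then obtain X0 where X0: "x0 \<in> X0" "open X0" "X0 \<times> UNIV \<subseteq> W" by blast
  have "norm (F (x, s) - F (x0, s)) < \<epsilon>" if "x \<in> X0" for x s
  proof -
    have "(x, s) \<in> W" using X0(3) that by blast
    then show ?thesis by (simp add: W_def)
  qed
  then show ?thesis by (rule that[OF X0(2,1)])
qed

lemma continuous_integral:
  fixes F :: "'g \<times> 'g \<Rightarrow> 'b::{banach,second_countable_topology}"
  assumes F: "continuous_on UNIV F"
  shows "continuous_on UNIV (\<lambda>x. \<integral> s. F (x, s) \<partial>\<mu>)"
proof -
  have int: "integrable \<mu> (\<lambda>s. F (x, s))" for x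
    by (rule integrable_continuous, rule continuous_on_UNIV_comp[OF F]) (intro continuous_intros)
  have "((\<lambda>x. \<integral> s. F (x, s) \<partial>\<mu>) \<longlongrightarrow> (\<integral> s. F (x0, s) \<partial>\<mu>)) (at x0)" for x0
  proof (rule tendstoI)
    fix \<epsilon> :: real assume \<epsilon>: "\<epsilon> > 0"
    then have "\<epsilon> / 2 > 0" by simp
    from uniform_param[OF F this, of x0] obtain U where
      U: "open U" "x0 \<in> U" "\<And>x s. x \<in> U \<Longrightarrow> norm (F (x, s) - F (x0, s)) < \<epsilon> / 2" by blast
    have "dist (\<integral> s. F (x, s) \<partial>\<mu>) (\<integral> s. F (x0, s) \<partial>\<mu>) < \<epsilon>" if "x \<in> U" for x
    proof -
      have "norm (\<integral> s. F (x, s) - F (x0, s) \<partial>\<mu>) \<le> (\<integral> s. norm (F (x, s) - F (x0, s)) \<partial>\<mu>)"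
        by (rule integral_norm_bound)
      also have "\<dots> \<le> \<epsilon> / 2"
        by (rule integral_le_const) (use int less_imp_le[OF U(3)[OF that]] in auto)
      finally show ?thesis using int \<epsilon> by (simp add: dist_norm)
    qed
    then show "\<forall>\<^sub>F x in at x0. dist (\<integral> s. F (x, s) \<partial>\<mu>) (\<integral> s. F (x0, s) \<partial>\<mu>) < \<epsilon>"
      using U by (auto simp: eventually_at_topological)
  qed
  then show ?thesis by (auto simp: continuous_on_def)
qed

section \<open>Haar measure on the Baire sets and Fubini's theorem\<close>

definition \<nu> :: "'g measure" where "\<nu> = distr \<mu> baire (\<lambda>x. x)"

lemma id_to_baire [measurable]: "(\<lambda>x. x) \<in> measurable \<mu> baire"
  using borel_to_baire by simp

lemma sets_nu [simp, measurable_cong]: "sets \<nu> = sets baire"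
  and space_nu [simp]: "space \<nu> = UNIV"
  by (simp_all add: \<nu>_def)

lemma measurable_nu [simp]: "measurable \<nu> N = measurable baire N"
  by (rule measurable_cong_sets) auto

sublocale nu: prob_space \<nu>
  unfolding \<nu>_def by (rule prob_space_distr) measurable

sublocale nu2: pair_sigma_finite \<nu> \<nu> ..

lemma integral_nu:
  fixes f :: "'g \<Rightarrow> 'b::{banach,second_countable_topology}"
  shows "f \<in> borel_measurable baire \<Longrightarrow> (\<integral>x. f x \<partial>\<nu>) = (\<integral>x. f x \<partial>\<mu>)"
  unfolding \<nu>_def by (subst integral_distr) auto

lemma integrable_nu:
  fixes f :: "'g \<Rightarrow> 'b::{banach,second_countable_topology}"
  shows "f \<in> borel_measurable baire \<Longrightarrow> integrable \<nu> f \<longleftrightarrow> integrable \<mu> f"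
  unfolding \<nu>_def by (subst integrable_distr_eq) auto

lemma AE_nu_imp: "(AE x in \<nu>. P x) \<Longrightarrow> AE x in \<mu>. P x"
  unfolding \<nu>_def using AE_distrD[OF id_to_baire] by auto

lemma add_baire [measurable]: "(\<lambda>p. fst p + snd p :: 'g) \<in> measurable (baire \<Otimes>\<^sub>M baire) baire"
  by (rule measurable_into_baire, rule continuous_pair_baire_real[OF cpt cpt],
      erule continuous_on_UNIV_comp, intro continuous_intros)

lemma uminus_baire [measurable]: "(\<lambda>x. - x :: 'g) \<in> measurable baire baire"
  by (rule measurable_into_baire, rule continuous_baire_real,
      erule continuous_on_UNIV_comp, intro continuous_intros)

text \<open>Integrability is required for \<open>\<nu>\<close>, whereas the iterated integrals are
  those of \<open>\<mu>\<close>. Sections of \<open>F\<close> and their partial integrals are Baire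
  measurable, and for such functions both measures give the same integral.\<close>

lemma fubini:
  fixes F :: "'g \<Rightarrow> 'g \<Rightarrow> 'b::{banach,second_countable_topology}"
  assumes F: "integrable (\<nu> \<Otimes>\<^sub>M \<nu>) (case_prod F)"
  shows "(\<integral>x. (\<integral>y. F x y \<partial>\<mu>) \<partial>\<mu>) = (\<integral>y. (\<integral>x. F x y \<partial>\<mu>) \<partial>\<mu>)"
proof -
  have m [measurable]: "case_prod F \<in> borel_measurable (baire \<Otimes>\<^sub>M baire)"
    using borel_measurable_integrable[OF F] by (simp cong: measurable_cong_sets)
  have [measurable]: "case_prod F \<in> borel_measurable (baire \<Otimes>\<^sub>M \<nu>)"
    "(\<lambda>(y, x). F x y) \<in> borel_measurable (baire \<Otimes>\<^sub>M \<nu>)"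
    by measurable
  have 1: "(\<integral>x. (\<integral>y. F x y \<partial>\<nu>) \<partial>\<nu>) = (\<integral>x. (\<integral>y. F x y \<partial>\<mu>) \<partial>\<mu>)"
  proof -
    have "(\<lambda>x. \<integral>y. F x y \<partial>\<nu>) \<in> borel_measurable baire" by measurable
    then have "(\<integral>x. (\<integral>y. F x y \<partial>\<nu>) \<partial>\<nu>) = (\<integral>x. (\<integral>y. F x y \<partial>\<nu>) \<partial>\<mu>)" by (rule integral_nu)
    also have "\<dots> = (\<integral>x. (\<integral>y. F x y \<partial>\<mu>) \<partial>\<mu>)"
      by (intro Bochner_Integration.integral_cong refl integral_nu) measurable
    finally show ?thesis .
  qed
  have 2: "(\<integral>y. (\<integral>x. F x y \<partial>\<nu>) \<partial>\<nu>) = (\<integral>y. (\<integral>x. F x y \<partial>\<mu>) \<partial>\<mu>)"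
  proof -
    have "(\<lambda>y. \<integral>x. F x y \<partial>\<nu>) \<in> borel_measurable baire" by measurable
    then have "(\<integral>y. (\<integral>x. F x y \<partial>\<nu>) \<partial>\<nu>) = (\<integral>y. (\<integral>x. F x y \<partial>\<nu>) \<partial>\<mu>)" by (rule integral_nu)
    also have "\<dots> = (\<integral>y. (\<integral>x. F x y \<partial>\<mu>) \<partial>\<mu>)"
      by (intro Bochner_Integration.integral_cong refl integral_nu) measurable
    finally show ?thesis .
  qed
  show ?thesis using nu2.Fubini_integral[OF F] 1 2 by simp
qed

lemma fubini_continuous:
  fixes F :: "'g \<Rightarrow> 'g \<Rightarrow> complex"
  assumes F: "continuous_on UNIV (case_prod F)"
  shows "(\<integral>x. (\<integral>y. F x y \<partial>\<mu>) \<partial>\<mu>) = (\<integral>y. (\<integral>x. F x y \<partial>\<mu>) \<partial>\<mu>)"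
proof (rule fubini)
  have "compact (UNIV :: ('g \<times> 'g) set)" using compact_Times[OF cpt cpt] by simp
  then have "bounded (range (case_prod F))"
    using compact_continuous_image[OF F] compact_imp_bounded by blast
  then obtain C where C: "\<And>p. norm (case_prod F p) \<le> C" by (auto simp: bounded_iff)
  interpret nn: pair_prob_space \<nu> \<nu> ..
  have "case_prod F \<in> borel_measurable (\<nu> \<Otimes>\<^sub>M \<nu>)"
    using continuous_pair_baire[OF cpt cpt F] by (simp cong: measurable_cong_sets)
  then show "integrable (\<nu> \<Otimes>\<^sub>M \<nu>) (case_prod F)"
    by (intro nn.P.integrable_const_bound[where B=C]) (use C in auto)
qed

text \<open>Invariance under reflection is not part of \<open>haar_prob\<close>. It follows by
  computing the double integral of \<open>f (- x + s)\<close> in both orders: by translation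
  invariance one order gives the integral of \<open>f\<close>, the other that of its
  reflection.\<close>

lemma integral_reflect_continuous:
  fixes f :: "'g \<Rightarrow> complex"
  assumes f: "continuous_on UNIV f"
  shows "(\<integral>s. f (- s) \<partial>\<mu>) = (\<integral>s. f s \<partial>\<mu>)"
proof -
  have m: "f \<in> borel_measurable borel" by (rule borel_measurable_continuous_onI[OF f])
  have m': "(\<lambda>s. f (- s)) \<in> borel_measurable borel"
    by (rule borel_measurable_continuous_onI, rule continuous_on_UNIV_comp[OF f]) (intro continuous_intros)
  have "(\<integral>x. (\<integral>s. f (- x + s) \<partial>\<mu>) \<partial>\<mu>) = (\<integral>s. (\<integral>x. f (- x + s) \<partial>\<mu>) \<partial>\<mu>)"
    by (rule fubini_continuous, unfold case_prod_beta, rule continuous_on_UNIV_comp[OF f])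
      (intro continuous_intros)
  moreover have "(\<integral>s. f (- x + s) \<partial>\<mu>) = (\<integral>s. f s \<partial>\<mu>)" for x
    using integral_translate[OF m] .
  moreover have "(\<integral>x. f (- x + s) \<partial>\<mu>) = (\<integral>s. f (- s) \<partial>\<mu>)" for s
    using integral_translate[OF m', of "- s"] by (simp add: add.commute)
  ultimately show ?thesis by simp
qed

lemma reflect_null:
  assumes "N \<in> null_sets \<mu>" shows "uminus ` N \<in> null_sets \<mu>"
proof -
  have um: "(uminus :: 'g \<Rightarrow> 'g) \<in> borel_measurable borel"
    by (auto intro!: borel_measurable_continuous_onI continuous_intros)
  have op: "open (uminus ` U)" if "open U" for U :: "'g set"
    unfolding uminus_image by (rule open_vimage[OF that]) (auto intro!: continuous_intros)
  have U: "emeasure \<mu> (uminus ` U) \<le> emeasure \<mu> U" if U: "open U" for U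
    unfolding inner_regular[OF op[OF U]]
  proof (rule SUP_least)
    fix K assume "K \<in> {K. compact K \<and> K \<subseteq> uminus ` U}"
    then have K: "compact K" "K \<subseteq> uminus ` U" by auto
    have cl: "closed (uminus ` K)"
      by (intro compact_imp_closed compact_continuous_image K) (auto intro!: continuous_intros)
    have sub: "uminus ` K \<subseteq> U" using K(2) by auto
    obtain f :: "'g \<Rightarrow> real" where f: "continuous_on UNIV f" "\<And>x. f x \<in> {0..1}"
      "\<And>x. x \<in> - U \<Longrightarrow> f x = 0" "\<And>x. x \<in> uminus ` K \<Longrightarrow> f x = 1"
      using compact_t2_urysohn[OF cpt, of "- U" "uminus ` K"] U cl sub by (auto simp: closed_Compl)
    have if1: "integrable \<mu> f" by (rule integrable_continuous[OF f(1)])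
    have if2: "integrable \<mu> (\<lambda>x. f (- x))"
      by (rule integrable_continuous, rule continuous_on_UNIV_comp[OF f(1)]) (intro continuous_intros)
    have eq: "(\<integral>x. f (- x) \<partial>\<mu>) = (\<integral>x. f x \<partial>\<mu>)"
      using integral_reflect_continuous[of "\<lambda>x. complex_of_real (f x)"] f(1)
      by (simp add: continuous_on_of_real del: of_real_eq_iff) (metis integral_complex_of_real of_real_eq_iff)
    have KB: "K \<in> sets borel" using K(1) by (simp add: compact_imp_closed)
    have "measure \<mu> K = (\<integral>x. indicator K x \<partial>\<mu>)" using KB by simp
    also have "\<dots> \<le> (\<integral>x. f (- x) \<partial>\<mu>)"
    proof (rule integral_mono)
      show "integrable \<mu> (indicat_real K)" using KB by (auto simp: integrable_indicator_iff less_top[symmetric])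
      show "indicat_real K x \<le> f (- x)" for x
        using f(2)[of "- x"] f(4)[of "- x"] by (auto simp: indicator_def)
    qed (rule if2)
    also have "\<dots> = (\<integral>x. f x \<partial>\<mu>)" by (rule eq)
    also have "\<dots> \<le> (\<integral>x. indicator U x \<partial>\<mu>)"
    proof (rule integral_mono)
      show "integrable \<mu> (indicat_real U)" using U by (auto simp: integrable_indicator_iff less_top[symmetric])
      show "f x \<le> indicat_real U x" for x
        using f(2)[of x] f(3)[of x] by (auto simp: indicator_def)
    qed (rule if1)
    also have "\<dots> = measure \<mu> U" using U by simp
    finally show "emeasure \<mu> K \<le> emeasure \<mu> U" by (simp add: emeasure_eq_measure)
  qed
  have N: "N \<in> sets borel" "emeasure \<mu> N = 0" using assms by auto
  have b: "uminus ` N \<in> sets borel"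
    unfolding uminus_image using measurable_sets[OF um N(1)] by simp
  have "emeasure \<mu> (uminus ` N) \<le> (INF U\<in>{U. open U \<and> N \<subseteq> U}. emeasure \<mu> U)"
  proof (rule INF_greatest)
    fix V assume "V \<in> {U. open U \<and> N \<subseteq> U}"
    then have V: "open V" "N \<subseteq> V" by auto
    have "emeasure \<mu> (uminus ` N) \<le> emeasure \<mu> (uminus ` V)"
      by (rule emeasure_mono) (use V op[OF V(1)] in auto)
    also have "\<dots> \<le> emeasure \<mu> V" by (rule U[OF V(1)])
    finally show "emeasure \<mu> (uminus ` N) \<le> emeasure \<mu> V" .
  qed
  then have "emeasure \<mu> (uminus ` N) = 0" using outer_regular[OF N(1)] N(2) by simp
  then show ?thesis using b by auto
qed

text \<open>This is what permits changing \<open>g\<close> on a null set inside the convolution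
  integrand, where it is evaluated at \<open>- y + x\<close>.\<close>

lemma AE_reflect_translate:
  assumes "AE s in \<mu>. P s" shows "AE s in \<mu>. P (- s + x)"
proof -
  obtain N where N: "N \<in> null_sets \<mu>" "{s. \<not> P s} \<subseteq> N" using assms by (auto simp: eventually_ae_filter)
  have 1: "(+) (- x) ` N \<in> sets borel"
  proof -
    have "(+) (- x) ` N = (+) x -` N" using plus_image[of "- x" N] by (simp only: minus_minus)
    moreover have "(+) x -` N \<inter> space borel \<in> sets borel" by (rule measurable_sets[of _ _ borel]) (use N in auto)
    ultimately show ?thesis by simp
  qed
  moreover have "emeasure \<mu> ((+) (- x) ` N) = 0"
    using translate[of N "- x"] N(1) by (simp only: null_setsD1 null_setsD2 sets_mu[symmetric])
  ultimately have "(+) (- x) ` N \<in> null_sets \<mu>" by (intro null_setsI) (simp_all only: sets_mu)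
  then have "uminus ` (+) (- x) ` N \<in> null_sets \<mu>" by (rule reflect_null)
  moreover have "{s \<in> space \<mu>. \<not> P (- s + x)} \<subseteq> uminus ` (+) (- x) ` N"
  proof
    fix s assume "s \<in> {s \<in> space \<mu>. \<not> P (- s + x)}"
    then have "- s + x \<in> N" using N(2) by auto
    moreover have "s = - (- x + (- s + x))" by simp
    ultimately show "s \<in> uminus ` (+) (- x) ` N" by blast
  qed
  ultimately show ?thesis by (rule AE_I')
qed

text \<open>Induction over the Borel sets. For open \<open>U\<close>, inner regularity gives compact
  sets of almost full measure, and between each of them and \<open>U\<close> a Urysohn function
  places the Baire set where it is positive. The union of countably many such sets exhausts
  \<open>U\<close> up to measure zero.\<close>

lemma baire_set_ae_eq:
  assumes "E \<in> sets borel"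
  shows "\<exists>E'\<in>sets baire. AE x in \<mu>. x \<in> E \<longleftrightarrow> x \<in> E'"
proof -
  have "E \<in> sigma_sets UNIV {S :: 'g set. open S}" using assms by (simp add: borel_def)
  then show ?thesis
  proof (induction rule: sigma_sets.induct)
    case (Basic U)
    then have U: "open U" by simp
    define S where "S = {V \<in> sets baire. V \<subseteq> U}"
    have "\<exists>V\<in>S. emeasure \<mu> U - 1 / of_nat (Suc n) \<le> emeasure \<mu> V" for n
    proof (cases "emeasure \<mu> U = 0")
      case True
      then show ?thesis by (auto simp: S_def intro!: bexI[of _ "{}"])
    next
      case False
      have "emeasure \<mu> U - 1 / of_nat (Suc n) < emeasure \<mu> U"
        using False by (intro ennreal_between) (auto simp: ennreal_zero_less_divide of_nat_less_top zero_less_iff_neq_zero emeasure_eq_measure)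
      then obtain K where K: "compact K" "K \<subseteq> U" "emeasure \<mu> U - 1 / of_nat (Suc n) < emeasure \<mu> K"
        using inner_regular[OF U] by (auto simp: less_SUP_iff)
      have "closed (- U)" "closed K" "- U \<inter> K = {}" using U K by (auto simp: closed_Compl compact_imp_closed)
      then obtain f :: "'g \<Rightarrow> real" where f: "continuous_on UNIV f"
        "\<And>x. x \<in> - U \<Longrightarrow> f x = 0" "\<And>x. x \<in> K \<Longrightarrow> f x = 1"
        by (rule compact_t2_urysohn[OF cpt]) blast
      have "f -` {0<..} \<in> sets baire" using measurable_sets[OF continuous_baire_real[OF f(1)], of "{0<..}"] by simp
      moreover have "f -` {0<..} \<subseteq> U" using f(2) by force
      moreover have "emeasure \<mu> K \<le> emeasure \<mu> (f -` {0<..})"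
      proof (rule emeasure_mono)
        show "K \<subseteq> f -` {0<..}" using f(3) by force
        show "f -` {0<..} \<in> sets \<mu>"
          using measurable_sets[OF borel_measurable_continuous_onI[OF f(1)], of "{0<..}"] by simp
      qed
      ultimately show ?thesis using K(3) by (auto simp: S_def intro!: bexI[of _ "f -` {0<..}"])
    qed
    then obtain V where V: "\<And>n. V n \<in> S" "\<And>n. emeasure \<mu> U - 1 / of_nat (Suc n) \<le> emeasure \<mu> (V n)"
      by metis
    define W where "W = (\<Union>n. V n)"
    have Wb: "W \<in> sets baire" using V(1) by (auto simp: W_def S_def)
    have WU: "W \<subseteq> U" using V(1) by (auto simp: W_def S_def)
    have Vs: "V n \<in> sets borel" for n
      using V(1) measurable_sets[OF borel_to_baire, of "V n"] by (auto simp: S_def)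
    then have Wm: "W \<in> sets borel" by (auto simp: W_def)
    have "emeasure \<mu> U \<le> emeasure \<mu> W"
    proof -
      have le: "measure \<mu> U - 1 / real (Suc n) \<le> measure \<mu> W" for n
      proof -
        have "emeasure \<mu> U - 1 / of_nat (Suc n) \<le> emeasure \<mu> W"
          using V(2)[of n] emeasure_mono[of "V n" W \<mu>] Wm by (force simp: W_def intro: order_trans)
        moreover have "(1::ennreal) / of_nat (Suc n) = ennreal (1 / real (Suc n))"
          by (simp add: divide_ennreal[symmetric] ennreal_of_nat_eq_real_of_nat)
        ultimately have "ennreal (measure \<mu> U - 1 / real (Suc n)) \<le> ennreal (measure \<mu> W)"
          by (simp add: emeasure_eq_measure ennreal_minus)
        then show ?thesis by (simp add: ennreal_le_iff)
      qed
      have "(\<lambda>n. measure \<mu> U - 1 / real (Suc n)) \<longlonglongrightarrow> measure \<mu> U - 0"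
        by (intro tendsto_diff tendsto_const LIMSEQ_inverse_real_of_nat[unfolded inverse_eq_divide])
      then have lim: "(\<lambda>n. measure \<mu> U - 1 / real (Suc n)) \<longlonglongrightarrow> measure \<mu> U" by simp
      have "measure \<mu> U \<le> measure \<mu> W" by (rule LIMSEQ_le_const2[OF lim]) (use le in blast)
      then show ?thesis by (simp add: emeasure_eq_measure)
    qed
    then have "measure \<mu> (U - W) = 0"
      using finite_measure_Diff[of U W] WU Wm U measure_mono_fmeasurable[OF WU]
      by (simp add: emeasure_eq_measure) (smt (verit) finite_measure_mono WU Wm U sets_mu borel_open)
    then have "U - W \<in> null_sets \<mu>" using U Wm by (auto simp: emeasure_eq_measure)
    then have "AE x in \<mu>. x \<notin> U - W" by (rule AE_not_in)
    then have "AE x in \<mu>. x \<in> U \<longleftrightarrow> x \<in> W" by eventually_elim (use WU in auto)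
    then show ?case using Wb by blast
  next
    case Empty
    then show ?case by (auto intro!: bexI[of _ "{}"])
  next
    case (Compl E)
    then obtain E' where "E' \<in> sets baire" "AE x in \<mu>. x \<in> E \<longleftrightarrow> x \<in> E'" by blast
    moreover have "- E' \<in> sets baire" using sets.compl_sets[OF \<open>E' \<in> sets baire\<close>] by (simp add: Compl_eq_Diff_UNIV)
    ultimately show ?case by (intro bexI[of _ "- E'"]) auto
  next
    case (Union E)
    then obtain E' where E': "\<And>i. E' i \<in> sets baire" "\<And>i. AE x in \<mu>. x \<in> E i \<longleftrightarrow> x \<in> E' i" by metis
    have "AE x in \<mu>. \<forall>i::nat. x \<in> E i \<longleftrightarrow> x \<in> E' i" using E'(2) by (simp add: AE_all_countable)
    then have "AE x in \<mu>. x \<in> (\<Union>i. E i) \<longleftrightarrow> x \<in> (\<Union>i. E' i)" by eventually_elim auto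
    then show ?case using E'(1) by (intro bexI[of _ "\<Union>i. E' i"]) auto
  qed
qed

lemma baire_function_ae_eq:
  fixes f :: "'g \<Rightarrow> 'b::{banach,second_countable_topology}"
  assumes f: "f \<in> borel_measurable borel"
  obtains f' where "f' \<in> borel_measurable baire" "AE x in \<mu>. f x = f' x"
proof -
  have simple: "\<exists>s'. s' \<in> borel_measurable baire \<and> (AE x in \<mu>. s x = s' x)"
    if s: "simple_function borel s" for s :: "'g \<Rightarrow> 'b"
  proof -
    have fin: "finite (range s)" using s by (simp add: simple_function_def)
    have "\<exists>E'. E' \<in> sets baire \<and> (AE x in \<mu>. x \<in> s -` {v} \<longleftrightarrow> x \<in> E')" for v
    proof -
      have "s -` {v} \<in> sets borel"
        using measurable_sets[OF borel_measurable_simple_function[OF s], of "{v}"] by simp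
      then show ?thesis using baire_set_ae_eq by blast
    qed
    then obtain E' where E': "\<And>v. E' v \<in> sets baire" "\<And>v. AE x in \<mu>. x \<in> s -` {v} \<longleftrightarrow> x \<in> E' v"
      by metis
    define s' where "s' x = (\<Sum>v\<in>range s. indicator (E' v) x *\<^sub>R v)" for x
    have "s' \<in> borel_measurable baire" unfolding s'_def using E'(1) by measurable
    moreover have "AE x in \<mu>. \<forall>v\<in>range s. x \<in> s -` {v} \<longleftrightarrow> x \<in> E' v"
      unfolding AE_finite_all[OF fin] using E'(2) by blast
    then have "AE x in \<mu>. s x = s' x"
    proof eventually_elim
      case (elim x)
      have "s' x = (\<Sum>v\<in>range s. if v = s x then v else 0)"
        unfolding s'_def
      proof (rule sum.cong)
        fix v assume "v \<in> range s"
        then have "s x = v \<longleftrightarrow> x \<in> E' v" using elim by auto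
        then show "indicator (E' v) x *\<^sub>R v = (if v = s x then v else 0)"
          by (auto simp: indicator_def)
      qed simp
      also have "\<dots> = s x" using fin by simp
      finally show ?case by simp
    qed
    ultimately show ?thesis by blast
  qed
  from borel_measurable_implies_sequence_metric[OF f, of 0] obtain s where
    s: "\<And>i. simple_function borel (s i)" "\<And>x. (\<lambda>i. s i x) \<longlonglongrightarrow> f x" by auto
  obtain s' where s': "\<And>i. s' i \<in> borel_measurable baire" "\<And>i. AE x in \<mu>. s i x = s' i x"
    using simple[OF s(1)] by metis
  \<comment> \<open>Where the approximants diverge, \<open>lim\<close> is one fixed unspecified
    value, so \<open>f'\<close> is measurable on the whole group.\<close>
  define f' where "f' x = lim (\<lambda>i. s' i x)" for x
  have "f' \<in> borel_measurable baire" unfolding f'_def using s'(1) by measurable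
  moreover have "AE x in \<mu>. \<forall>i::nat. s i x = s' i x" using s'(2) by (simp add: AE_all_countable)
  then have "AE x in \<mu>. f x = f' x"
  proof eventually_elim
    case (elim x)
    then show ?case using s(2)[of x] by (simp add: f'_def limI)
  qed
  ultimately show ?thesis using that by blast
qed

text \<open>Finitely many translates of a nonempty open set cover the compact group, and all have
  the same measure.\<close>

lemma open_measure_pos:
  assumes U: "open U" "U \<noteq> {}" shows "measure \<mu> U > 0"
proof (rule ccontr)
  assume "\<not> measure \<mu> U > 0"
  then have 0: "measure \<mu> U = 0" using measure_nonneg[of \<mu> U] by linarith
  obtain u where u: "u \<in> U" using U by blast
  have op: "open ((+) x ` U)" for x
  proof -
    show ?thesis unfolding plus_image by (rule open_vimage[OF U(1)]) (intro continuous_intros)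
  qed
  have cover: "UNIV \<subseteq> (\<Union>x\<in>UNIV. (+) x ` U)"
  proof
    fix y :: 'g
    have "y = (y - u) + u" by simp
    then show "y \<in> (\<Union>x. (+) x ` U)" using u by blast
  qed
  obtain D where D: "finite D" "UNIV \<subseteq> (\<Union>x\<in>D. (+) x ` U)"
    by (rule compactE_image[OF cpt _ cover]) (use op in auto)
  have "measure \<mu> UNIV \<le> measure \<mu> (\<Union>x\<in>D. (+) x ` U)"
    by (rule finite_measure_mono) (use D op in auto)
  also have "\<dots> \<le> (\<Sum>x\<in>D. measure \<mu> ((+) x ` U))"
    by (rule finite_measure_subadditive_finite) (use D op in auto)
  also have "\<dots> = 0" using translate[of U] U(1) 0 by (simp add: measure_def)
  finally show False by simp
qed

lemma continuous_integral_0: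
  fixes f :: "'g \<Rightarrow> real"
  assumes f: "continuous_on UNIV f" "\<And>x. f x \<ge> 0" and 0: "(\<integral>x. f x \<partial>\<mu>) \<le> 0"
  shows "f x = 0"
proof (rule ccontr)
  assume "f x \<noteq> 0"
  then have "f x > 0" using f(2)[of x] by simp
  have "(\<integral>x. f x \<partial>\<mu>) \<ge> 0" by (rule Bochner_Integration.integral_nonneg) (rule f(2))
  then have "(\<integral>x. f x \<partial>\<mu>) = 0" using 0 by simp
  then have "AE x in \<mu>. f x = 0"
    using integral_nonneg_eq_0_iff_AE[OF integrable_continuous[OF f(1)]] f(2) by simp
  moreover have "open (f -` {0<..})" using f(1) by (intro open_vimage) auto
  ultimately have "measure \<mu> (f -` {0<..}) = 0"
    by (intro measure_eq_0_null_sets, subst AE_iff_null_sets) (auto elim: eventually_mono)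
  moreover have "f -` {0<..} \<noteq> {}" using \<open>f x > 0\<close> by auto
  ultimately show False using open_measure_pos[OF \<open>open (f -` {0<..})\<close>] by simp
qed

end


section \<open>Continuous characters of a compact abelian group\<close>

definition group_chars :: "('g::topological_ab_group_add \<Rightarrow> complex) set" where
  "group_chars = {\<xi>. continuous_on UNIV \<xi> \<and> (\<forall>x y. \<xi> (x + y) = \<xi> x * \<xi> y) \<and> (\<forall>x. cmod (\<xi> x) = 1)}"

lemma group_charsD:
  assumes "\<xi> \<in> group_chars"
  shows "continuous_on UNIV \<xi>" "\<xi> (x + y) = \<xi> x * \<xi> y" "cmod (\<xi> x) = 1" "\<xi> 0 = 1"
    "\<xi> (- x) = cnj (\<xi> x)" "\<xi> x * cnj (\<xi> x) = 1"
proof -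
  show "continuous_on UNIV \<xi>" and m: "\<xi> (x + y) = \<xi> x * \<xi> y" and n: "cmod (\<xi> x) = 1" for x y
    using assms by (auto simp: group_chars_def)
  have "\<xi> 0 * \<xi> 0 = \<xi> 0" "\<xi> 0 \<noteq> 0" using m[of 0 0] n[of 0] by auto
  then show 0: "\<xi> 0 = 1" by simp
  show 1: "\<xi> x * cnj (\<xi> x) = 1" using n[of x] by (simp add: complex_norm_square[symmetric])
  have "\<xi> x * \<xi> (- x) = 1" using m[of x "- x"] 0 by simp
  then show "\<xi> (- x) = cnj (\<xi> x)" using 1 n[of x] by (metis mult_cancel_left norm_zero zero_neq_one)
qed

lemma cnj_group_chars: "\<xi> \<in> group_chars \<Longrightarrow> (\<lambda>x. cnj (\<xi> x)) \<in> group_chars"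
  by (auto simp: group_chars_def intro: continuous_intros)

text \<open>The powers of \<open>\<xi> y\<close> are again values of \<open>\<xi>\<close> and so
  stay bounded, which forces modulus at most 1 at \<open>y\<close> and likewise at
  \<open>- y\<close>. The iterate of \<open>(+) y\<close> at 0 stands for the multiple of
  \<open>y\<close>.\<close>

lemma bounded_hom_norm_eq_1:
  fixes \<xi> :: "'g::group_add \<Rightarrow> complex"
  assumes m: "\<And>x y. \<xi> (x + y) = \<xi> x * \<xi> y" and nz: "\<xi> 0 \<noteq> 0" and b: "\<And>x. cmod (\<xi> x) \<le> C"
  shows "cmod (\<xi> x) = 1"
proof -
  have "\<xi> 0 * \<xi> 0 = \<xi> 0" using m[of 0 0] by simp
  then have 0: "\<xi> 0 = 1" using nz by simp
  have pow: "\<xi> (((+) y ^^ n) 0) = \<xi> y ^ n" for y n by (induction n) (simp_all add: 0 m)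
  have le: "cmod (\<xi> y) \<le> 1" for y
  proof (rule ccontr)
    assume "\<not> cmod (\<xi> y) \<le> 1"
    then obtain n where "C < cmod (\<xi> y) ^ n" using real_arch_pow[of "cmod (\<xi> y)" C] by auto
    then show False using b[of "((+) y ^^ n) 0"] by (simp add: pow norm_power)
  qed
  have "cmod (\<xi> x) * cmod (\<xi> (- x)) = 1" using m[of x "- x"] 0 by (simp flip: norm_mult)
  then have "1 \<le> cmod (\<xi> x)" using le[of "- x"] mult_left_le[of "cmod (\<xi> (- x))" "cmod (\<xi> x)"] by simp
  then show ?thesis using le[of x] by simp
qed

text \<open>Read \<open>A\<close> and \<open>B\<close> as squared norms of vectors \<open>a\<close>
  and \<open>W\<close>, and \<open>C\<close> as the real part of their inner product. The premises
  bound the squared norms of \<open>W + a\<close> and \<open>W - a\<close>, \<open>A\<close> is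
  within \<open>\<epsilon>\<close> of the supremum \<open>M\<close>, and the conclusion says that
  the squared distance from \<open>W\<close> to \<open>r a\<close> is at most
  \<open>\<epsilon>\<close>.\<close>

lemma near_maximum_estimate:
  fixes A B C M r \<epsilon> :: real
  assumes p: "A + 2 * C + B \<le> M * (1 + r)\<^sup>2" and m: "A - 2 * C + B \<le> M * (1 - r)\<^sup>2"
    and A: "M - \<epsilon> \<le> A" and \<epsilon>: "\<epsilon> \<ge> 0" and r: "\<bar>r\<bar> \<le> 1"
  shows "B - 2 * r * C + r\<^sup>2 * A \<le> \<epsilon>"
proof -
  have main: "B - 2 * r * C + r\<^sup>2 * A \<le> \<epsilon>"
    if p: "A + 2 * C + B \<le> M * (1 + r)\<^sup>2" and m: "A - 2 * C + B \<le> M * (1 - r)\<^sup>2" and r: "0 \<le> r" "r \<le> 1"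
    for C r :: real
  proof -
    have AB: "A + B \<le> M * (1 + r\<^sup>2)" using p m by (simp add: power2_eq_square algebra_simps)
    have "(1 + r) * (M - \<epsilon>) \<le> (1 + r) * A" using A r by (intro mult_left_mono) auto
    then have 1: "B - r * A \<le> M * (r\<^sup>2 - r) + (1 + r) * \<epsilon>" using AB by (simp add: power2_eq_square algebra_simps)
    \<comment> \<open>A convex combination with weights \<open>r\<close> and \<open>1 - r\<close>:
      the first term is the hypothesis \<open>m\<close>, and the second no longer contains
      \<open>C\<close>. Negative \<open>r\<close> is reduced to this case by flipping the signs of
      \<open>r\<close> and \<open>C\<close>.\<close>
    have "B - 2 * r * C + r\<^sup>2 * A = r * (A - 2 * C + B) + (1 - r) * (B - r * A)"
      by (simp add: power2_eq_square algebra_simps)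
    also have "\<dots> \<le> r * (M * (1 - r)\<^sup>2) + (1 - r) * (M * (r\<^sup>2 - r) + (1 + r) * \<epsilon>)"
      using m 1 r by (intro add_mono mult_left_mono) auto
    also have "\<dots> = \<epsilon> - r\<^sup>2 * \<epsilon>" by (simp add: power2_eq_square algebra_simps)
    also have "\<dots> \<le> \<epsilon>" using \<epsilon> by simp
    finally show ?thesis .
  qed
  show ?thesis
  proof (cases "r \<ge> 0")
    case True
    then show ?thesis using main[OF p m] r by simp
  next
    case False
    then show ?thesis using main[of "- C" "- r"] p m r by simp
  qed
qed

context compact_haar
begin

text \<open>Translating by a point where \<open>\<theta>\<close> is not 1 multiplies the integral by
  that value and also leaves it unchanged.\<close>

lemma integral_char:
  assumes \<theta>: "\<theta> \<in> group_chars" and ne: "\<theta> \<noteq> (\<lambda>_. 1)"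
  shows "(\<integral>x. \<theta> x \<partial>\<mu>) = 0"
proof -
  obtain y where y: "\<theta> y \<noteq> 1" using ne by auto
  have "(\<integral>x. \<theta> (y + x) \<partial>\<mu>) = (\<integral>x. \<theta> x \<partial>\<mu>)"
    by (rule integral_translate[OF borel_measurable_continuous_onI]) (rule group_charsD(1)[OF \<theta>])
  then have "\<theta> y * (\<integral>x. \<theta> x \<partial>\<mu>) = (\<integral>x. \<theta> x \<partial>\<mu>)" by (simp add: group_charsD(2)[OF \<theta>])
  then show ?thesis using y by simp
qed

lemma char_orthogonal:
  assumes \<xi>: "\<xi> \<in> group_chars" and \<psi>: "\<psi> \<in> group_chars"
  shows "(\<integral>x. \<xi> x * cnj (\<psi> x) \<partial>\<mu>) = (if \<xi> = \<psi> then 1 else 0)"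
proof (cases "\<xi> = \<psi>")
  case True
  then show ?thesis by (simp add: group_charsD(6)[OF \<psi>])
next
  case False
  have "(\<lambda>x. \<xi> x * cnj (\<psi> x)) \<in> group_chars"
    using \<xi> \<psi> unfolding group_chars_def by (auto simp: norm_mult intro: continuous_intros)
  moreover have "(\<lambda>x. \<xi> x * cnj (\<psi> x)) \<noteq> (\<lambda>_. 1)"
  proof
    assume eq: "(\<lambda>x. \<xi> x * cnj (\<psi> x)) = (\<lambda>_. 1)"
    have "\<xi> x = \<psi> x" for x
    proof -
      have "\<xi> x * cnj (\<psi> x) = \<psi> x * cnj (\<psi> x)" using fun_cong[OF eq, of x] by (simp add: group_charsD(6)[OF \<psi>])
      moreover have "cnj (\<psi> x) \<noteq> 0" using group_charsD(3)[OF \<psi>, of x] by auto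
      ultimately show ?thesis by simp
    qed
    then show False using False by auto
  qed
  ultimately show ?thesis using integral_char False by simp
qed

section \<open>Autocorrelations and the correlation operator\<close>

definition autocorr :: "('g \<Rightarrow> complex) \<Rightarrow> 'g \<Rightarrow> complex" where
  "autocorr f x = (\<integral>s. f (x + s) * cnj (f s) \<partial>\<mu>)"

text \<open>For fixed \<open>h\<close> this is an integral operator in \<open>u\<close> with the
  continuous kernel \<open>h (x + s)\<close>, hence a compact one. That is why a limit can be
  extracted after applying it, though not before.\<close>

definition corr :: "('g \<Rightarrow> complex) \<Rightarrow> ('g \<Rightarrow> complex) \<Rightarrow> 'g \<Rightarrow> complex" where
  "corr h u x = (\<integral>s. h (x + s) * u s \<partial>\<mu>)"

definition sqn :: "('g \<Rightarrow> complex) \<Rightarrow> real" where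
  "sqn f = (\<integral>s. (cmod (f s))\<^sup>2 \<partial>\<mu>)"

lemma continuous_corr:
  assumes h: "continuous_on UNIV h" and u: "continuous_on UNIV u"
  shows "continuous_on UNIV (corr h u)"
proof -
  have "continuous_on UNIV (\<lambda>p. h (fst p + snd p) * u (snd p))"
    by (intro continuous_intros continuous_on_UNIV_comp[OF h] continuous_on_UNIV_comp[OF u])
  from continuous_integral[OF this] show ?thesis by (simp add: corr_def[abs_def])
qed

lemma autocorr_eq_corr: "autocorr f = corr f (\<lambda>s. cnj (f s))"
  by (simp add: autocorr_def[abs_def] corr_def[abs_def])

lemma continuous_autocorr: "continuous_on UNIV f \<Longrightarrow> continuous_on UNIV (autocorr f)"
  unfolding autocorr_eq_corr by (intro continuous_corr continuous_intros)

lemma sqn_nonneg: "0 \<le> sqn f" by (simp add: sqn_def)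

lemma autocorr_0: "autocorr f 0 = complex_of_real (sqn f)"
proof -
  have "(\<lambda>s. f s * cnj (f s)) = (\<lambda>s. complex_of_real ((cmod (f s))\<^sup>2))"
    by (simp only: complex_norm_square)
  then show ?thesis unfolding autocorr_def sqn_def by (simp only: add_0 integral_complex_of_real)
qed

lemma sqn_translate: "continuous_on UNIV f \<Longrightarrow> sqn (\<lambda>s. f (x + s)) = sqn f"
  unfolding sqn_def
  by (rule integral_translate[OF borel_measurable_continuous_onI]) (intro continuous_intros)

text \<open>The arithmetic-geometric mean inequality takes the place of Cauchy-Schwarz: by
  translation invariance both squares integrate to \<open>sqn f\<close>.\<close>

lemma norm_autocorr_le:
  assumes f: "continuous_on UNIV f" shows "cmod (autocorr f x) \<le> sqn f"
proof -
  have fx: "continuous_on UNIV (\<lambda>s. f (x + s))" by (rule continuous_translate(1)[OF f])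
  have "cmod (autocorr f x) \<le> (\<integral>s. cmod (f (x + s) * cnj (f s)) \<partial>\<mu>)"
    unfolding autocorr_def by (rule integral_norm_bound)
  also have "\<dots> \<le> (\<integral>s. ((cmod (f (x + s)))\<^sup>2 + (cmod (f s))\<^sup>2) / 2 \<partial>\<mu>)"
  proof (rule integral_mono)
    fix s
    have "0 \<le> (cmod (f (x + s)) - cmod (f s))\<^sup>2" by simp
    then show "cmod (f (x + s) * cnj (f s)) \<le> ((cmod (f (x + s)))\<^sup>2 + (cmod (f s))\<^sup>2) / 2"
      by (simp add: norm_mult power2_eq_square algebra_simps)
  qed (intro integrable_continuous continuous_intros fx f; simp)+
  also have "\<dots> = (sqn (\<lambda>s. f (x + s)) + sqn f) / 2"
    unfolding sqn_def by (subst Bochner_Integration.integral_divide_zero, subst Bochner_Integration.integral_add)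
      (intro integrable_continuous continuous_intros fx f | simp)+
  finally show ?thesis using sqn_translate[OF f] by simp
qed

lemma autocorr_minus:
  assumes f: "continuous_on UNIV f" shows "autocorr f (- x) = cnj (autocorr f x)"
proof -
  have "(\<lambda>s. f (- x + s) * cnj (f s)) \<in> borel_measurable borel"
    by (intro borel_measurable_continuous_onI continuous_intros continuous_translate(1) f)
  from integral_translate[OF this, of x]
  have "autocorr f (- x) = (\<integral>s. f s * cnj (f (x + s)) \<partial>\<mu>)"
    unfolding autocorr_def by simp
  also have "\<dots> = (\<integral>s. cnj (f (x + s) * cnj (f s)) \<partial>\<mu>)" by (simp add: mult.commute)
  also have "\<dots> = cnj (autocorr f x)" unfolding autocorr_def by (rule Bochner_Integration.integral_cnj)
  finally show ?thesis .
qed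

text \<open>Sesquilinear expansion. The two diagonal terms are both \<open>autocorr f x\<close>,
  because \<open>c\<close> is unimodular and Haar measure is invariant; the mixed terms are
  translates in opposite directions.\<close>

lemma autocorr_perturb:
  assumes f: "continuous_on UNIV f" and c: "cmod c = 1"
  shows "autocorr (\<lambda>s. f s + c * f (y + s)) x
    = 2 * autocorr f x + c * autocorr f (y + x) + cnj c * autocorr f (- y + x)"
proof -
  have cc: "c * cnj c = 1" using c by (simp add: complex_norm_square[symmetric])
  have ft: "continuous_on UNIV (\<lambda>s. f (x + s))" for x by (rule continuous_translate(1)[OF f])
  have int: "integrable \<mu> (\<lambda>s. k * (f (x + s) * cnj (f (z + s))))" for k x z
    by (intro integrable_continuous continuous_intros ft)
  have shift: "(\<integral>s. f (x + s) * cnj (f (z + s)) \<partial>\<mu>) = autocorr f (- z + x)" for x z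
  proof -
    have "(\<integral>s. f ((- z + x) + (z + s)) * cnj (f (z + s)) \<partial>\<mu>) = autocorr f (- z + x)"
      unfolding autocorr_def
      by (rule integral_translate) (intro borel_measurable_continuous_onI continuous_intros ft f)
    then show ?thesis by (simp add: algebra_simps)
  qed
  have "autocorr (\<lambda>s. f s + c * f (y + s)) x =
     (\<integral>s. 1 * (f (x + s) * cnj (f (0 + s))) + (c * cnj c) * (f ((y + x) + s) * cnj (f (y + s)))
       + c * (f ((y + x) + s) * cnj (f (0 + s))) + cnj c * (f (x + s) * cnj (f (y + s))) \<partial>\<mu>)"
    unfolding autocorr_def by (rule Bochner_Integration.integral_cong) (simp_all add: algebra_simps)
  also have "\<dots> = 1 * autocorr f (- 0 + x) + (c * cnj c) * autocorr f (- y + (y + x))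
       + c * autocorr f (- 0 + (y + x)) + cnj c * autocorr f (- y + x)"
    by (simp only: Bochner_Integration.integral_add int Bochner_Integration.integrable_add
        integral_mult_right_zero shift)
  also have "\<dots> = 2 * autocorr f x + c * autocorr f (y + x) + cnj c * autocorr f (- y + x)"
    by (simp add: cc)
  finally show ?thesis .
qed

lemma corr_translate:
  assumes h: "continuous_on UNIV h" and u: "continuous_on UNIV u"
  shows "corr h (\<lambda>s. u (y + s)) x = corr h u (- y + x)"
proof -
  have "(\<integral>s. h ((- y + x) + (y + s)) * u (y + s) \<partial>\<mu>) = corr h u (- y + x)"
    unfolding corr_def
    by (rule integral_translate) (intro borel_measurable_continuous_onI continuous_intros continuous_translate h u)
  then show ?thesis by (simp add: corr_def algebra_simps)
qed

lemma norm_corr_le: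
  assumes h: "continuous_on UNIV h" "\<And>x. cmod (h x) \<le> H" and u: "continuous_on UNIV u" "\<And>x. cmod (u x) \<le> 1"
  shows "cmod (corr h u x) \<le> H"
proof -
  have "cmod (corr h u x) \<le> (\<integral>s. cmod (h (x + s) * u s) \<partial>\<mu>)"
    unfolding corr_def by (rule integral_norm_bound)
  also have "\<dots> \<le> H"
  proof (rule integral_le_const)
    show "integrable \<mu> (\<lambda>s. cmod (h (x + s) * u s))"
      by (intro integrable_continuous continuous_intros continuous_translate h u)
    have "cmod (h (x + s) * u s) \<le> H * 1" for s
      unfolding norm_mult by (intro mult_mono h u) (auto intro: order_trans[OF norm_ge_zero h(2)])
    then show "AE s in \<mu>. cmod (h (x + s) * u s) \<le> H" by simp
  qed
  finally show ?thesis .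
qed

lemma corr_linear:
  assumes h: "continuous_on UNIV h" and u: "continuous_on UNIV u" "continuous_on UNIV v" "continuous_on UNIV w"
  shows "corr h (\<lambda>s. a * u s + b * v s + c * w s) x = a * corr h u x + b * corr h v x + c * corr h w x"
proof -
  have int: "integrable \<mu> (\<lambda>s. k * (h (x + s) * u s))" if "continuous_on UNIV u" for k u
    by (intro integrable_continuous continuous_intros continuous_translate h that)
  have "corr h (\<lambda>s. a * u s + b * v s + c * w s) x =
      (\<integral>s. a * (h (x + s) * u s) + b * (h (x + s) * v s) + c * (h (x + s) * w s) \<partial>\<mu>)"
    unfolding corr_def by (rule Bochner_Integration.integral_cong) (simp_all add: algebra_simps)
  also have "\<dots> = a * corr h u x + b * corr h v x + c * corr h w x"
    unfolding corr_def by (simp only: Bochner_Integration.integral_add int u Bochner_Integration.integrable_add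
        integral_mult_right_zero)
  finally show ?thesis .
qed

lemma sqn_expand:
  assumes a: "continuous_on UNIV a" and b: "continuous_on UNIV b"
  shows "sqn (\<lambda>x. b x + of_real t * a x) = sqn b + 2 * t * (\<integral>x. Re (a x * cnj (b x)) \<partial>\<mu>) + t\<^sup>2 * sqn a"
proof -
  have eq: "(cmod (b x + of_real t * a x))\<^sup>2 = (cmod (b x))\<^sup>2 + 2 * t * Re (a x * cnj (b x)) + t\<^sup>2 * (cmod (a x))\<^sup>2" for x
    unfolding cmod_power2 by (simp add: power2_eq_square algebra_simps)
  have "integrable \<mu> (\<lambda>x. (cmod (b x))\<^sup>2)" "integrable \<mu> (\<lambda>x. 2 * t * Re (a x * cnj (b x)))"
    "integrable \<mu> (\<lambda>x. t\<^sup>2 * (cmod (a x))\<^sup>2)"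
    by (intro integrable_continuous continuous_intros a b)+
  then show ?thesis
    unfolding sqn_def eq by simp
qed

lemma sqn_add_le:
  assumes a: "continuous_on UNIV a" and b: "continuous_on UNIV b"
  shows "sqn (\<lambda>x. a x + b x) \<le> 2 * sqn a + 2 * sqn b"
proof -
  have "sqn (\<lambda>x. a x + b x) \<le> (\<integral>x. 2 * (cmod (a x))\<^sup>2 + 2 * (cmod (b x))\<^sup>2 \<partial>\<mu>)"
    unfolding sqn_def
  proof (rule integral_mono)
    fix x
    have "(cmod (a x + b x))\<^sup>2 \<le> (cmod (a x) + cmod (b x))\<^sup>2" by (intro power_mono norm_triangle_ineq) simp
    also have "\<dots> \<le> 2 * (cmod (a x))\<^sup>2 + 2 * (cmod (b x))\<^sup>2"
      using zero_le_power2[of "cmod (a x) - cmod (b x)"] by (simp add: power2_eq_square algebra_simps)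
    finally show "(cmod (a x + b x))\<^sup>2 \<le> 2 * (cmod (a x))\<^sup>2 + 2 * (cmod (b x))\<^sup>2" .
  qed (intro integrable_continuous continuous_intros a b)+
  also have "\<dots> = 2 * sqn a + 2 * sqn b"
    unfolding sqn_def by (subst Bochner_Integration.integral_add)
      (intro integrable_continuous continuous_intros a b | simp)+
  finally show ?thesis .
qed

lemma sqn_scale: "sqn (\<lambda>x. c * f x) = (cmod c)\<^sup>2 * sqn f"
  by (simp add: sqn_def norm_mult power_mult_distrib)

lemma sqn_eq_0:
  assumes "continuous_on UNIV f" "sqn f \<le> 0" shows "f x = 0"
proof -
  have "continuous_on UNIV (\<lambda>x. (cmod (f x))\<^sup>2)" by (intro continuous_intros assms)
  from continuous_integral_0[OF this, of x] show ?thesis using assms(2) by (simp add: sqn_def)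
qed

text \<open>A maximiser of \<open>f \<mapsto> sqn (corr h (autocorr f))\<close> on the unit sphere has a multiplicative
  autocorrelation: comparing with the competitors \<open>f \<plusminus> c \<cdot> f (y + \<cdot>)\<close>, whose autocorrelations are
  \<open>2 u \<plusminus> (c \<cdot> u (y + \<cdot>) + cnj c \<cdot> u (- y + \<cdot>))\<close>, is Raikov's argument that extreme positive definite
  functions are characters. The next lemma is its quantitative form for almost maximisers.\<close>

lemma autocorr_almost_multiplicative:
  assumes h: "continuous_on UNIV h" and f: "continuous_on UNIV f" "sqn f = 1"
    and M: "\<And>F. continuous_on UNIV F \<Longrightarrow> sqn (corr h (autocorr F)) \<le> M * (sqn F)\<^sup>2"
    and \<epsilon>: "\<epsilon> \<ge> 0" "M - \<epsilon> \<le> sqn (corr h (autocorr f))"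
  shows "sqn (\<lambda>x. corr h (autocorr f) (y + x) - cnj (autocorr f y) * corr h (autocorr f) x) \<le> 4 * \<epsilon>"
proof -
  define u where "u = autocorr f"
  define a where "a = corr h u"
  have cu: "continuous_on UNIV u" unfolding u_def by (rule continuous_autocorr[OF f(1)])
  have ca: "continuous_on UNIV a" unfolding a_def by (rule continuous_corr[OF h cu])
  have cat: "continuous_on UNIV (\<lambda>x. a (z + x))" for z by (rule continuous_translate(1)[OF ca])
  \<comment> \<open>Half the change in \<open>corr h\<close> of the autocorrelation when
    \<open>f\<close> is replaced by the competitor. The direction of translation is reversed
    relative to \<open>u\<close>, as in \<open>corr_translate\<close>. At an exact maximum
    \<open>W c\<close> would equal \<open>r c\<close> times \<open>a\<close>.\<close>
  define W where "W c x = (c * a (- y + x) + cnj c * a (y + x)) / 2" for c x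
  define r where "r c = Re (c * u y)" for c
  have cW: "continuous_on UNIV (W c)" for c
    unfolding W_def[abs_def] by (intro continuous_intros cat) simp
  have pert: "sqn (\<lambda>x. W c x + 1 * a x) \<le> M * (1 + r c)\<^sup>2" if c: "cmod c = 1" for c
  proof -
    define F where "F s = f s + c * f (y + s)" for s
    have cF: "continuous_on UNIV F"
      unfolding F_def[abs_def] by (intro continuous_intros f(1) continuous_translate)
    have acF: "autocorr F x = 2 * u x + c * u (y + x) + cnj c * u (- y + x)" for x
      unfolding F_def[abs_def] u_def by (rule autocorr_perturb[OF f(1) c])
    have "complex_of_real (sqn F) = 2 * u 0 + c * u y + cnj c * u (- y)"
      using acF[of 0] by (simp add: autocorr_0)
    also have "\<dots> = complex_of_real (2 * (1 + r c))"
      using f(2) by (simp add: u_def autocorr_0 autocorr_minus[OF f(1)] r_def complex_eq_iff)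
    finally have sF: "sqn F = 2 * (1 + r c)" using of_real_eq_iff by blast
    have "corr h (autocorr F) x = 2 * (W c x + 1 * a x)" for x
    proof -
      have "corr h (autocorr F) x = 2 * corr h u x + c * corr h (\<lambda>s. u (y + s)) x + cnj c * corr h (\<lambda>s. u (- y + s)) x"
        unfolding acF[abs_def] ext[OF acF]
        by (rule corr_linear[OF h cu continuous_translate(1)[OF cu] continuous_translate(1)[OF cu]])
      also have "\<dots> = 2 * (W c x + 1 * a x)"
        unfolding corr_translate[OF h cu] W_def a_def[symmetric] by (simp add: field_simps)
      finally show ?thesis .
    qed
    then have "corr h (autocorr F) = (\<lambda>x. 2 * (W c x + 1 * a x))" by (rule ext)
    then have "sqn (corr h (autocorr F)) = (cmod 2)\<^sup>2 * sqn (\<lambda>x. W c x + 1 * a x)" by (simp only: sqn_scale)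
    then have "4 * sqn (\<lambda>x. W c x + 1 * a x) \<le> M * (2 * (1 + r c))\<^sup>2" using M[OF cF] sF by simp
    then show ?thesis by (simp only: power_mult_distrib) simp
  qed
  have est: "sqn (\<lambda>x. W c x + of_real (- r c) * a x) \<le> \<epsilon>" if c: "cmod c = 1" for c
  proof -
    define C where "C = (\<integral>x. Re (a x * cnj (W c x)) \<partial>\<mu>)"
    have p: "sqn (W c) + 2 * C + sqn a \<le> M * (1 + r c)\<^sup>2"
      using pert[OF c] sqn_expand[OF ca cW, of c 1] unfolding C_def by simp
    \<comment> \<open>The competitor for \<open>- c\<close> changes the sign of both
      \<open>W c\<close> and \<open>r c\<close>, which supplies the second premise of the
      estimate.\<close>
    have rneg: "r (- c) = - r c" by (simp add: r_def)
    have neg: "W (- c) x + 1 * a x = - 1 * (W c x + of_real (- 1) * a x)" for x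
      by (simp add: W_def field_simps)
    have "sqn (\<lambda>x. W (- c) x + 1 * a x) = sqn (\<lambda>x. W c x + of_real (- 1) * a x)"
      unfolding neg sqn_scale by simp
    then have m: "sqn (W c) - 2 * C + sqn a \<le> M * (1 - r c)\<^sup>2"
      using pert[of "- c"] c sqn_expand[OF ca cW, of c "- 1"] unfolding C_def rneg by simp
    have "\<bar>r c\<bar> \<le> cmod (c * u y)" unfolding r_def by (rule abs_Re_le_cmod)
    also have "\<dots> \<le> 1" using norm_autocorr_le[OF f(1), of y] c f(2) by (simp add: norm_mult u_def)
    finally have "\<bar>r c\<bar> \<le> 1" .
    then have "sqn (W c) - 2 * r c * C + (r c)\<^sup>2 * sqn a \<le> \<epsilon>"
      using near_maximum_estimate[of "sqn a" C "sqn (W c)" M "r c" \<epsilon>] p m \<epsilon> by (simp add: a_def u_def)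
    then show ?thesis
      using sqn_expand[OF ca cW, of c "- r c"] unfolding C_def by simp
  qed
  \<comment> \<open>\<open>W 1\<close> is the even combination of the two translates of
    \<open>a\<close>, and \<open>\<i>\<close> times \<open>W \<i>\<close> the odd one; their sum
    isolates \<open>a (y + x)\<close>. The subtracted multiples combine to
    \<open>cnj (u y)\<close>.\<close>
  have split: "a (y + x) - cnj (u y) * a x
     = (W 1 x + of_real (- r 1) * a x) + \<i> * (W \<i> x + of_real (- r \<i>) * a x)" for x
    by (simp add: W_def r_def complex_eq_iff field_simps)
  have "sqn (\<lambda>x. a (y + x) - cnj (u y) * a x)
     \<le> 2 * sqn (\<lambda>x. W 1 x + of_real (- r 1) * a x) + 2 * sqn (\<lambda>x. \<i> * (W \<i> x + of_real (- r \<i>) * a x))"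
    unfolding split by (intro sqn_add_le continuous_intros cW ca)
  also have "\<dots> \<le> 2 * \<epsilon> + 2 * \<epsilon>"
    unfolding sqn_scale using est[of 1] est[of \<i>] by simp
  finally show ?thesis unfolding a_def u_def by simp
qed

section \<open>Passage to the limit\<close>

text \<open>The group need not be separable, so a dense sequence is not at hand. Equicontinuity and
  compactness yield for each \<open>j\<close> a finite net that controls all \<open>a n\<close> up
  to \<open>1 / Suc j\<close>; a diagonal subsequence on the countable union of the nets is
  uniformly Cauchy.\<close>

lemma arzela_ascoli_sequence:
  fixes a :: "nat \<Rightarrow> 'g \<Rightarrow> complex"
  assumes bd: "\<And>n x. cmod (a n x) \<le> C"
    and eq: "\<And>x \<epsilon>. \<epsilon> > 0 \<Longrightarrow> \<exists>U. open U \<and> x \<in> U \<and> (\<forall>n. \<forall>z\<in>U. cmod (a n z - a n x) < \<epsilon>)"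
  obtains k l where "strict_mono (k :: nat \<Rightarrow> nat)" "uniform_limit UNIV (\<lambda>n. a (k n)) l sequentially"
proof -
  have net: "\<exists>D. finite D \<and> (\<forall>x. \<exists>d\<in>D. \<forall>n. cmod (a n x - a n d) < \<epsilon>)" if \<epsilon>: "\<epsilon> > 0" for \<epsilon>
  proof -
    obtain U where U: "\<And>x. open (U x)" "\<And>x. x \<in> U x" "\<And>x n z. z \<in> U x \<Longrightarrow> cmod (a n z - a n x) < \<epsilon>"
      using eq[OF \<epsilon>] by metis
    have cover: "UNIV \<subseteq> (\<Union>x\<in>UNIV. U x)" using U(2) by blast
    obtain D where D: "finite D" "UNIV \<subseteq> (\<Union>x\<in>D. U x)"
      by (rule compactE_image[OF cpt _ cover]) (use U(1) in auto)
    show ?thesis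
    proof (intro exI conjI allI)
      show "finite D" by (rule D(1))
      fix x
      obtain d where "d \<in> D" "x \<in> U d" using D(2) by blast
      then show "\<exists>d\<in>D. \<forall>n. cmod (a n x - a n d) < \<epsilon>" using U(3)[of x d] by blast
    qed
  qed
  have "\<exists>D. \<forall>j::nat. finite (D j) \<and> (\<forall>x. \<exists>d\<in>D j. \<forall>n. cmod (a n x - a n d) < 1 / real (Suc j))"
    by (rule choice, rule allI, rule net) simp
  then obtain D where D: "\<And>j::nat. finite (D j)" "\<And>j x. \<exists>d\<in>D j. \<forall>n. cmod (a n x - a n d) < 1 / real (Suc j)"
    by blast
  have "countable (\<Union>j. D j)" using D(1) by (intro countable_UN) (auto intro: countable_finite)
  then obtain k where k: "strict_mono (k :: nat \<Rightarrow> nat)" "\<And>x. x \<in> (\<Union>j. D j) \<Longrightarrow> \<exists>l. (\<lambda>n. a (k n) x) \<longlonglongrightarrow> l"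
    by (rule function_convergent_subsequence[of _ a C]) (use bd in auto)
  have "uniformly_Cauchy_on UNIV (\<lambda>n. a (k n))"
    unfolding uniformly_Cauchy_on_def
  proof (intro allI impI)
    fix \<epsilon> :: real assume \<epsilon>: "\<epsilon> > 0"
    then obtain j where j: "1 / real (Suc j) < \<epsilon> / 3" using nat_approx_posE[of "\<epsilon> / 3"] by auto
    have "\<forall>d\<in>D j. \<exists>N. \<forall>m\<ge>N. \<forall>n\<ge>N. cmod (a (k m) d - a (k n) d) < \<epsilon> / 3"
    proof
      fix d assume "d \<in> D j"
      then have "Cauchy (\<lambda>n. a (k n) d)" using k(2)[of d] by (auto intro: LIMSEQ_imp_Cauchy)
      then show "\<exists>N. \<forall>m\<ge>N. \<forall>n\<ge>N. cmod (a (k m) d - a (k n) d) < \<epsilon> / 3"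
        using \<epsilon> unfolding Cauchy_iff by (meson divide_pos_pos zero_less_numeral)
    qed
    then obtain N where N: "\<And>d m n. d \<in> D j \<Longrightarrow> m \<ge> N d \<Longrightarrow> n \<ge> N d \<Longrightarrow> cmod (a (k m) d - a (k n) d) < \<epsilon> / 3"
      by metis
    show "\<exists>M. \<forall>x\<in>UNIV. \<forall>m\<ge>M. \<forall>n\<ge>M. dist (a (k m) x) (a (k n) x) < \<epsilon>"
    \<comment> \<open>The sum over the finite net dominates each \<open>N d\<close>.\<close>
    proof (intro exI[of _ "\<Sum>d\<in>D j. N d"] ballI allI impI)
      fix x m n assume mn: "(\<Sum>d\<in>D j. N d) \<le> m" "(\<Sum>d\<in>D j. N d) \<le> n"
      obtain d where d: "d \<in> D j" "\<And>n. cmod (a n x - a n d) < 1 / real (Suc j)" using D(2) by blast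
      have "N d \<le> (\<Sum>d\<in>D j. N d)" by (rule member_le_sum[OF d(1)]) (use D(1) in auto)
      then have 1: "cmod (a (k m) d - a (k n) d) < \<epsilon> / 3" using N[OF d(1)] mn by simp
      have 2: "cmod (a (k m) x - a (k m) d) < \<epsilon> / 3" "cmod (a (k n) d - a (k n) x) < \<epsilon> / 3"
        using d(2)[of "k m"] d(2)[of "k n"] j by (auto simp: norm_minus_commute)
      have "a (k m) x - a (k n) x = (a (k m) x - a (k m) d) + (a (k m) d - a (k n) d) + (a (k n) d - a (k n) x)"
        by simp
      then have "cmod (a (k m) x - a (k n) x) \<le> cmod (a (k m) x - a (k m) d) + cmod (a (k m) d - a (k n) d) + cmod (a (k n) d - a (k n) x)"
        by (metis norm_triangle_ineq norm_triangle_le add_right_mono)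
      then show "dist (a (k m) x) (a (k n) x) < \<epsilon>" using 1 2 by (simp add: dist_norm)
    qed
  qed
  then obtain l where "uniform_limit UNIV (\<lambda>n. a (k n)) l sequentially"
    using uniformly_convergent_eq_Cauchy[of UNIV "\<lambda>n. a (k n)"]
    by (auto dest: Cauchy_uniformly_convergent simp: uniformly_convergent_on_def)
  then show ?thesis by (rule that[OF k(1)])
qed

lemma LIMSEQ_integral_continuous:
  fixes f :: "nat \<Rightarrow> 'g \<Rightarrow> 'b::{banach,second_countable_topology}"
  assumes "\<And>n. f n \<in> borel_measurable borel" "\<And>x. (\<lambda>n. f n x) \<longlonglongrightarrow> l x" "\<And>n x. norm (f n x) \<le> C"
  shows "(\<lambda>n. \<integral>x. f n x \<partial>\<mu>) \<longlonglongrightarrow> (\<integral>x. l x \<partial>\<mu>)"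
proof (rule integral_dominated_convergence[where w="\<lambda>_. C"])
  show "l \<in> borel_measurable \<mu>" using borel_measurable_LIMSEQ_metric[of f borel l] assms by simp
qed (use assms in auto)

text \<open>Pythagoras: \<open>b - z a\<close> splits into \<open>b - w a\<close>, orthogonal to
  \<open>a\<close>, and \<open>(w - z) a\<close>, where \<open>w\<close> is the coefficient of the
  orthogonal projection of \<open>b\<close> onto \<open>a\<close>. If \<open>b\<close> is nearly
  \<open>z a\<close>, the scalar \<open>z\<close> can thus be recovered from \<open>a\<close> and
  \<open>b\<close>.\<close>

lemma projection_estimate:
  assumes a: "continuous_on UNIV a" and b: "continuous_on UNIV b" and pos: "sqn a > 0"
  shows "sqn a * (cmod (z - (\<integral>x. b x * cnj (a x) \<partial>\<mu>) / of_real (sqn a)))\<^sup>2 \<le> sqn (\<lambda>x. b x - z * a x)"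
proof -
  define w where "w = (\<integral>x. b x * cnj (a x) \<partial>\<mu>) / of_real (sqn a)"
  define g where "g x = b x - w * a x" for x
  have cg: "continuous_on UNIV g" unfolding g_def[abs_def] by (intro continuous_intros a b)
  have 0: "(\<integral>x. g x * cnj (a x) \<partial>\<mu>) = 0"
  proof -
    have i1: "integrable \<mu> (\<lambda>x. b x * cnj (a x))" and i2: "integrable \<mu> (\<lambda>x. w * (a x * cnj (a x)))"
      by (intro integrable_continuous continuous_intros a b)+
    have "(\<integral>x. g x * cnj (a x) \<partial>\<mu>) = (\<integral>x. b x * cnj (a x) - w * (a x * cnj (a x)) \<partial>\<mu>)"
      by (simp add: g_def algebra_simps)
    also have "\<dots> = (\<integral>x. b x * cnj (a x) \<partial>\<mu>) - w * (\<integral>x. a x * cnj (a x) \<partial>\<mu>)"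
      using i1 i2 by (simp only: Bochner_Integration.integral_diff integral_mult_right_zero)
    also have "(\<integral>x. a x * cnj (a x) \<partial>\<mu>) = of_real (sqn a)" using autocorr_0[of a] by (simp add: autocorr_def)
    finally show ?thesis using pos by (simp add: w_def)
  qed
  define c where "c = w - z"
  have eq: "(cmod (b x - z * a x))\<^sup>2 = (cmod (g x))\<^sup>2 + 2 * Re (cnj c * (g x * cnj (a x))) + (cmod c)\<^sup>2 * (cmod (a x))\<^sup>2" for x
  proof -
    have "b x - z * a x = g x + c * a x" by (simp add: g_def c_def algebra_simps)
    moreover have "(cmod (g + c * a))\<^sup>2 = (cmod g)\<^sup>2 + 2 * Re (cnj c * (g * cnj a)) + (cmod c)\<^sup>2 * (cmod a)\<^sup>2" for g a
      unfolding cmod_power2 by (simp add: power2_eq_square algebra_simps)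
    ultimately show ?thesis by simp
  qed
  have i: "integrable \<mu> (\<lambda>x. (cmod (g x))\<^sup>2)" "integrable \<mu> (\<lambda>x. cnj c * (g x * cnj (a x)))"
    "integrable \<mu> (\<lambda>x. (cmod c)\<^sup>2 * (cmod (a x))\<^sup>2)"
    by (intro integrable_continuous continuous_intros a cg)+
  have "(\<integral>x. Re (cnj c * (g x * cnj (a x))) \<partial>\<mu>) = Re (\<integral>x. cnj c * (g x * cnj (a x)) \<partial>\<mu>)"
    by (rule integral_Re[OF i(2)])
  also have "\<dots> = 0" using 0 by simp
  finally have R: "(\<integral>x. Re (cnj c * (g x * cnj (a x))) \<partial>\<mu>) = 0" .
  have "sqn (\<lambda>x. b x - z * a x) = sqn g + 2 * (\<integral>x. Re (cnj c * (g x * cnj (a x))) \<partial>\<mu>) + (cmod c)\<^sup>2 * sqn a"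
    unfolding sqn_def eq
    using i(1) integrable_mult_right[OF integrable_Re[OF i(2)], of 2] i(3)
    by (simp only: Bochner_Integration.integral_add Bochner_Integration.integrable_add
        integral_mult_right_zero)
  then have "(cmod c)\<^sup>2 * sqn a \<le> sqn (\<lambda>x. b x - z * a x)" using R sqn_nonneg[of g] by simp
  then show ?thesis by (simp add: c_def w_def norm_minus_commute mult.commute)
qed

text \<open>\<open>M\<close> is the supremum over the unit sphere, finite since autocorrelations of
  unit vectors are bounded by 1. The functional is quadratic in the autocorrelation, which is
  quadratic in \<open>F\<close>; this homogeneity of degree four produces
  \<open>(sqn F)\<^sup>2\<close>.\<close>

lemma corr_autocorr_bound:
  assumes h: "continuous_on UNIV h" obtains M where
    "\<And>F. continuous_on UNIV F \<Longrightarrow> sqn (corr h (autocorr F)) \<le> M * (sqn F)\<^sup>2"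
    "\<And>\<epsilon>. \<epsilon> > 0 \<Longrightarrow> \<exists>f. continuous_on UNIV f \<and> sqn f = 1 \<and> M - \<epsilon> \<le> sqn (corr h (autocorr f))"
proof -
  obtain H where H: "H > 0" "\<And>x. cmod (h x) \<le> H" using continuous_bounded[OF h] by blast
  define J where "J f = sqn (corr h (autocorr f))" for f
  define S where "S = {f. continuous_on UNIV f \<and> sqn f = 1}"
  have ne: "(\<lambda>_. 1) \<in> S" by (simp add: S_def sqn_def)
  have "J f \<le> H\<^sup>2" if "f \<in> S" for f
  proof -
    have f: "continuous_on UNIV f" "sqn f = 1" using that by (auto simp: S_def)
    have u: "continuous_on UNIV (autocorr f)" "\<And>x. cmod (autocorr f x) \<le> 1"
      using continuous_autocorr[OF f(1)] norm_autocorr_le[OF f(1)] f(2) by auto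
    have "cmod (corr h (autocorr f) x) \<le> H" for x by (rule norm_corr_le[OF h H(2) u])
    then have "AE x in \<mu>. (cmod (corr h (autocorr f) x))\<^sup>2 \<le> H\<^sup>2" by (simp add: power_mono)
    moreover have "integrable \<mu> (\<lambda>x. (cmod (corr h (autocorr f) x))\<^sup>2)"
      by (intro integrable_continuous continuous_intros continuous_corr[OF h u(1)])
    ultimately show ?thesis unfolding J_def sqn_def by (intro integral_le_const)
  qed
  then have bdd: "bdd_above (J ` S)" by (auto simp: bdd_above_def)
  define M where "M = Sup (J ` S)"
  have "J F \<le> M * (sqn F)\<^sup>2" if F: "continuous_on UNIV F" for F
  proof (cases "sqn F = 0")
    case True
    then have "autocorr F x = 0" for x using norm_autocorr_le[OF F, of x] by simp
    then show ?thesis using True by (simp add: J_def sqn_def corr_def)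
  next
    case False
    then have N: "sqn F > 0" using sqn_nonneg[of F] by simp
    define c where "c = complex_of_real (1 / sqrt (sqn F))"
    have c2: "(cmod c)\<^sup>2 = 1 / sqn F" using N by (simp add: c_def norm_divide power_divide)
    have "(\<lambda>s. c * F s) \<in> S"
      using N F by (auto simp: S_def sqn_scale c2 intro: continuous_intros)
    then have "J (\<lambda>s. c * F s) \<le> M" unfolding M_def by (intro cSUP_upper bdd)
    moreover have "J (\<lambda>s. c * F s) = (1 / sqn F)\<^sup>2 * J F"
    proof -
      have ac: "autocorr (\<lambda>s. c * F s) = (\<lambda>x. (c * cnj c) * autocorr F x)"
      proof
        fix x
        have "autocorr (\<lambda>s. c * F s) x = (\<integral>s. (c * cnj c) * (F (x + s) * cnj (F s)) \<partial>\<mu>)"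
          unfolding autocorr_def by (rule Bochner_Integration.integral_cong) (simp_all add: algebra_simps)
        then show "autocorr (\<lambda>s. c * F s) x = (c * cnj c) * autocorr F x"
          by (simp only: autocorr_def integral_mult_right_zero)
      qed
      have cr: "corr h (\<lambda>s. k * u s) x = k * corr h u x" for k u x
      proof -
        have "corr h (\<lambda>s. k * u s) x = (\<integral>s. k * (h (x + s) * u s) \<partial>\<mu>)"
          unfolding corr_def by (rule Bochner_Integration.integral_cong) (simp_all add: algebra_simps)
        then show ?thesis by (simp only: corr_def integral_mult_right_zero)
      qed
      have "corr h (autocorr (\<lambda>s. c * F s)) = (\<lambda>x. (c * cnj c) * corr h (autocorr F) x)"
        unfolding ac by (rule ext) (rule cr)
      then have "J (\<lambda>s. c * F s) = (cmod (c * cnj c))\<^sup>2 * J F" unfolding J_def by (simp only: sqn_scale)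
      moreover have "cmod (c * cnj c) = 1 / sqn F" using c2 by (simp add: norm_mult power2_eq_square)
      ultimately show ?thesis by simp
    qed
    ultimately show ?thesis using N by (simp add: power_divide field_simps)
  qed
  moreover have "\<exists>f. continuous_on UNIV f \<and> sqn f = 1 \<and> M - \<epsilon> \<le> J f" if \<epsilon>: "\<epsilon> > 0" for \<epsilon>
  proof -
    have "\<exists>y\<in>J ` S. M - \<epsilon> < y"
      by (rule less_cSupE[of "M - \<epsilon>" "J ` S"]) (use ne \<epsilon> in \<open>auto simp: M_def\<close>)
    then show ?thesis by (auto simp: S_def intro: less_imp_le)
  qed
  ultimately show ?thesis using that unfolding J_def by blast
qed

text \<open>Almost maximisers have almost multiplicative \<open>corr h (autocorr f)\<close>. A
  uniform limit \<open>a\<close> of these satisfies \<open>a (y + x) = w y * a x\<close> with a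
  character \<open>w\<close>, and the integral of \<open>h\<close> against the conjugate of
  \<open>w\<close> is \<open>a 0\<close>, which is nonzero.\<close>

theorem group_chars_separate:
  assumes h: "continuous_on UNIV h" and h0: "h x0 \<noteq> 0"
  shows "\<exists>\<xi>\<in>group_chars. (\<integral>s. h s * \<xi> s \<partial>\<mu>) \<noteq> 0"
proof -
  obtain M where M: "\<And>F. continuous_on UNIV F \<Longrightarrow> sqn (corr h (autocorr F)) \<le> M * (sqn F)\<^sup>2"
    "\<And>\<epsilon>. \<epsilon> > 0 \<Longrightarrow> \<exists>f. continuous_on UNIV f \<and> sqn f = 1 \<and> M - \<epsilon> \<le> sqn (corr h (autocorr f))"
    using corr_autocorr_bound[OF h] by blast
  obtain H where H: "H > 0" "\<And>x. cmod (h x) \<le> H" using continuous_bounded[OF h] by blast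
  have Mpos: "M > 0"
  proof (rule ccontr)
    assume "\<not> M > 0"
    \<comment> \<open>The test function for positivity of \<open>M\<close>. If
      \<open>corr h (autocorr g)\<close> vanished, integrating it against \<open>cnj h\<close> would
      show by Fubini that the autocorrelation of \<open>h\<close> has norm 0, and its value at 0 is
      \<open>sqn h\<close>.\<close>
    define g where "g s = cnj (h s)" for s
    have cg: "continuous_on UNIV g" unfolding g_def[abs_def] by (intro continuous_intros h)
    have u: "continuous_on UNIV (autocorr h)" by (rule continuous_autocorr[OF h])
    have ug: "autocorr g x = cnj (autocorr h x)" for x
    proof -
      have "autocorr g x = (\<integral>s. cnj (h (x + s) * cnj (h s)) \<partial>\<mu>)" by (simp add: autocorr_def g_def)
      also have "\<dots> = cnj (autocorr h x)" unfolding autocorr_def by (rule Bochner_Integration.integral_cnj)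
      finally show ?thesis .
    qed
    have "M * (sqn g)\<^sup>2 \<le> 0" using \<open>\<not> M > 0\<close> by (simp add: mult_nonpos_nonneg)
    then have le: "sqn (corr h (autocorr g)) \<le> 0" using M(1)[OF cg] by linarith
    have corr0: "corr h (autocorr g) x = 0" for x
      by (rule sqn_eq_0[OF continuous_corr[OF h continuous_autocorr[OF cg]] le])
    have "(\<integral>x. (\<integral>s. h (x + s) * cnj (autocorr h s) * cnj (h x) \<partial>\<mu>) \<partial>\<mu>)
        = (\<integral>s. (\<integral>x. h (x + s) * cnj (autocorr h s) * cnj (h x) \<partial>\<mu>) \<partial>\<mu>)"
    proof (rule fubini_continuous)
      have "continuous_on UNIV (\<lambda>p. h (fst p + snd p) * cnj (autocorr h (snd p)) * cnj (h (fst p)))"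
        by (intro continuous_intros continuous_on_UNIV_comp[OF h] continuous_on_UNIV_comp[OF u])
      then show "continuous_on UNIV (\<lambda>(x, s). h (x + s) * cnj (autocorr h s) * cnj (h x))"
        by (simp add: case_prod_beta)
    qed
    moreover have "(\<integral>s. h (x + s) * cnj (autocorr h s) * cnj (h x) \<partial>\<mu>) = 0" for x
      using corr0[of x] by (simp add: corr_def ug)
    moreover have "(\<integral>x. h (x + s) * cnj (autocorr h s) * cnj (h x) \<partial>\<mu>) = autocorr h s * cnj (autocorr h s)" for s
    proof -
      have "(\<integral>x. h (x + s) * cnj (autocorr h s) * cnj (h x) \<partial>\<mu>)
          = (\<integral>x. cnj (autocorr h s) * (h (s + x) * cnj (h x)) \<partial>\<mu>)"
        by (simp add: algebra_simps)
      also have "\<dots> = cnj (autocorr h s) * autocorr h s"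
        by (simp only: autocorr_def integral_mult_right_zero)
      finally show ?thesis by simp
    qed
    ultimately have "(\<integral>s. autocorr h s * cnj (autocorr h s) \<partial>\<mu>) = 0"
      by (simp only: Bochner_Integration.integral_zero)
    then have "sqn (autocorr h) = 0" using autocorr_0[of "autocorr h"] by (simp add: autocorr_def[of "autocorr h"])
    then have "autocorr h 0 = 0" using sqn_eq_0[OF u] by simp
    then have "sqn h = 0" by (simp add: autocorr_0)
    then show False using sqn_eq_0[OF h] h0 by simp
  qed
  have "\<exists>f. \<forall>n::nat. continuous_on UNIV (f n) \<and> sqn (f n) = 1 \<and> M - 1 / real (Suc n) \<le> sqn (corr h (autocorr (f n)))"
    by (rule choice, rule allI, rule M(2)) simp
  then obtain f where f: "\<And>n::nat. continuous_on UNIV (f n)" "\<And>n. sqn (f n) = 1"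
    "\<And>n. M - 1 / real (Suc n) \<le> sqn (corr h (autocorr (f n)))" by blast
  define u0 where "u0 n = autocorr (f n)" for n
  define a0 where "a0 n = corr h (u0 n)" for n
  have u0: "continuous_on UNIV (u0 n)" "cmod (u0 n x) \<le> 1" for n x
    using continuous_autocorr[OF f(1)] norm_autocorr_le[OF f(1), of n x] f(2)[of n] by (auto simp: u0_def)
  have a0: "continuous_on UNIV (a0 n)" "cmod (a0 n x) \<le> H" for n x
    unfolding a0_def by (rule continuous_corr[OF h u0(1)], rule norm_corr_le[OF h H(2) u0])
  obtain k a where k: "strict_mono k" "uniform_limit UNIV (\<lambda>n. a0 (k n)) a sequentially"
  proof (rule arzela_ascoli_sequence[OF a0(2)])
    fix x :: 'g and \<epsilon> :: real assume \<epsilon>: "\<epsilon> > 0"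
    \<comment> \<open>Equicontinuity is inherited from \<open>h\<close> alone, since all
      \<open>u0 n\<close> are bounded by 1.\<close>
    have ch: "continuous_on UNIV (\<lambda>p :: 'g \<times> 'g. h (fst p + snd p))"
      by (intro continuous_intros continuous_on_UNIV_comp[OF h])
    have \<epsilon>2: "\<epsilon> / 2 > 0" using \<epsilon> by simp
    obtain U where "open U" "x \<in> U"
      and U_norm: "\<And>z s. z \<in> U \<Longrightarrow> norm (h (fst (z, s) + snd (z, s)) - h (fst (x, s) + snd (x, s))) < \<epsilon> / 2"
      by (rule uniform_param[OF ch \<epsilon>2, of x]) blast
    then have U: "open U" "x \<in> U" "\<And>z s. z \<in> U \<Longrightarrow> cmod (h (z + s) - h (x + s)) < \<epsilon> / 2" by simp_all
    have "cmod (a0 n z - a0 n x) < \<epsilon>" if z: "z \<in> U" for n z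
    proof -
      have i: "integrable \<mu> (\<lambda>s. h (y + s) * u0 n s)" for y
        by (intro integrable_continuous continuous_intros continuous_translate h u0)
      have "a0 n z - a0 n x = (\<integral>s. h (z + s) * u0 n s - h (x + s) * u0 n s \<partial>\<mu>)"
        unfolding a0_def corr_def using i by simp
      also have "cmod \<dots> \<le> (\<integral>s. cmod (h (z + s) * u0 n s - h (x + s) * u0 n s) \<partial>\<mu>)"
        by (rule integral_norm_bound)
      also have "\<dots> \<le> \<epsilon> / 2"
      proof (rule integral_le_const)
        show "integrable \<mu> (\<lambda>s. cmod (h (z + s) * u0 n s - h (x + s) * u0 n s))"
          using i by (intro integrable_norm Bochner_Integration.integrable_diff)
        have "cmod (h (z + s) * u0 n s - h (x + s) * u0 n s) \<le> \<epsilon> / 2 * 1" for s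
          unfolding left_diff_distrib[symmetric] norm_mult
          by (intro mult_mono u0 less_imp_le[OF U(3)[OF z]]) (use \<epsilon> in auto)
        then show "AE s in \<mu>. cmod (h (z + s) * u0 n s - h (x + s) * u0 n s) \<le> \<epsilon> / 2" by simp
      qed
      finally show ?thesis using \<epsilon> by simp
    qed
    then show "\<exists>U. open U \<and> x \<in> U \<and> (\<forall>n. \<forall>z\<in>U. cmod (a0 n z - a0 n x) < \<epsilon>)" using U(1,2) by blast
  qed blast
  define un where "un n = u0 (k n)" for n
  define an where "an n = a0 (k n)" for n
  have un: "continuous_on UNIV (un n)" "cmod (un n x) \<le> 1" for n x using u0 by (auto simp: un_def)
  have an: "continuous_on UNIV (an n)" "cmod (an n x) \<le> H" for n x using a0 by (auto simp: an_def)
  have lim_a: "(\<lambda>n. an n x) \<longlonglongrightarrow> a x" for x unfolding an_def by (rule tendsto_uniform_limitI[OF k(2)]) simp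
  have ca: "continuous_on UNIV a"
    by (rule uniform_limit_theorem[OF _ k(2)]) (use a0(1) in auto)
  have k0: "(\<lambda>n. 1 / real (Suc (k n))) \<longlonglongrightarrow> 0"
    using LIMSEQ_subseq_LIMSEQ[OF LIMSEQ_inverse_real_of_nat k(1)] by (simp add: o_def inverse_eq_divide)
  have meas: "continuous_on UNIV g \<Longrightarrow> g \<in> borel_measurable borel" for g :: "'g \<Rightarrow> 'b::topological_space"
    by (rule borel_measurable_continuous_onI)
  have lim_sqn: "(\<lambda>n. sqn (an n)) \<longlonglongrightarrow> sqn a"
    unfolding sqn_def
  proof (rule LIMSEQ_integral_continuous[where C="H\<^sup>2"])
    show "(\<lambda>x. (cmod (an n x))\<^sup>2) \<in> borel_measurable borel" for n
      by (intro meas continuous_intros an)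
    show "(\<lambda>n. (cmod (an n x))\<^sup>2) \<longlonglongrightarrow> (cmod (a x))\<^sup>2" for x by (intro tendsto_intros lim_a)
    show "norm ((cmod (an n x))\<^sup>2) \<le> H\<^sup>2" for n x using an(2) by (simp add: power_mono)
  qed
  \<comment> \<open>Here positivity of \<open>M\<close> ensures that the limit is not the zero
    function.\<close>
  have "M - 0 \<le> sqn a"
  proof (rule LIMSEQ_le[OF _ lim_sqn])
    show "(\<lambda>n. M - 1 / real (Suc (k n))) \<longlonglongrightarrow> M - 0" by (intro tendsto_diff tendsto_const k0)
    show "\<exists>N. \<forall>n\<ge>N. M - 1 / real (Suc (k n)) \<le> sqn (an n)"
      using f(3) by (auto simp: an_def a0_def u0_def)
  qed
  then have sa: "sqn a > 0" using Mpos by simp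
  define w where "w y = (\<integral>x. a (y + x) * cnj (a x) \<partial>\<mu>) / of_real (sqn a)" for y
  have cat: "continuous_on UNIV (\<lambda>x. a (y + x))" "continuous_on UNIV (\<lambda>x. an n (y + x))" for y n
    using ca an(1) by (auto intro: continuous_translate)
  have near: "sqn (\<lambda>x. an n (y + x) - cnj (un n y) * an n x) \<le> 4 * (1 / real (Suc (k n)))" for n y
    unfolding an_def un_def a0_def u0_def
    by (rule autocorr_almost_multiplicative[OF h f(1,2) M(1) _ f(3)]) simp_all
  \<comment> \<open>Convergence of \<open>un\<close> is not known in advance. Since the translate of
    \<open>an n\<close> is nearly \<open>cnj (un n y)\<close> times \<open>an n\<close>, that scalar
    is close to the projection coefficient \<open>Q n / sqn (an n)\<close>, which converges together
    with \<open>an\<close>.\<close>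
  have lim_u: "(\<lambda>n. cnj (un n y)) \<longlonglongrightarrow> w y" for y
  proof -
    define Q where "Q n = (\<integral>x. an n (y + x) * cnj (an n x) \<partial>\<mu>)" for n
    have "Q \<longlonglongrightarrow> (\<integral>x. a (y + x) * cnj (a x) \<partial>\<mu>)"
      unfolding Q_def
    proof (rule LIMSEQ_integral_continuous[where C="H * H"])
      show "(\<lambda>x. an n (y + x) * cnj (an n x)) \<in> borel_measurable borel" for n
        by (intro meas continuous_intros an cat)
      show "(\<lambda>n. an n (y + x) * cnj (an n x)) \<longlonglongrightarrow> a (y + x) * cnj (a x)" for x
        by (intro tendsto_intros lim_a)
      show "norm (an n (y + x) * cnj (an n x)) \<le> H * H" for n x
        using an(2) H(1) by (simp add: norm_mult mult_mono)
    qed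
    then have limQ: "(\<lambda>n. Q n / of_real (sqn (an n))) \<longlonglongrightarrow> w y"
      unfolding w_def using sa by (intro tendsto_divide tendsto_of_real lim_sqn) auto
    have ev: "\<forall>\<^sub>F n in sequentially. sqn a / 2 < sqn (an n)"
      using order_tendstoD(1)[OF lim_sqn, of "sqn a / 2"] sa by simp
    have "(\<lambda>n. (cmod (cnj (un n y) - Q n / of_real (sqn (an n))))\<^sup>2) \<longlonglongrightarrow> 0"
    proof (rule tendsto_sandwich[OF _ _ tendsto_const])
      show "\<forall>\<^sub>F n in sequentially. 0 \<le> (cmod (cnj (un n y) - Q n / of_real (sqn (an n))))\<^sup>2" by simp
      \<comment> \<open>The factor 8 is the 4 of the almost multiplicativity estimate divided by the
        lower bound \<open>sqn a / 2\<close> for \<open>sqn (an n)\<close>.\<close>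
      show "\<forall>\<^sub>F n in sequentially. (cmod (cnj (un n y) - Q n / of_real (sqn (an n))))\<^sup>2
          \<le> 8 / sqn a * (1 / real (Suc (k n)))"
        using ev
      proof eventually_elim
        case (elim n)
        then have pos: "sqn (an n) > 0" using sa by simp
        let ?d = "(cmod (cnj (un n y) - Q n / of_real (sqn (an n))))\<^sup>2"
        have "sqn a / 2 * ?d \<le> sqn (an n) * ?d" using elim by (intro mult_right_mono) auto
        also have "\<dots> \<le> sqn (\<lambda>x. an n (y + x) - cnj (un n y) * an n x)"
          unfolding Q_def by (rule projection_estimate[OF an(1) cat(2) pos])
        also have "\<dots> \<le> 4 * (1 / real (Suc (k n)))" by (rule near)
        finally have "?d \<le> 4 * (1 / real (Suc (k n))) / (sqn a / 2)"
          using sa by (subst pos_le_divide_eq) (simp_all add: mult.commute)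
        also have "\<dots> = 8 / sqn a * (1 / real (Suc (k n)))" by simp
        finally show ?case .
      qed
      show "(\<lambda>n. 8 / sqn a * (1 / real (Suc (k n)))) \<longlonglongrightarrow> 0"
        by (rule tendsto_mult_right_zero[OF k0])
    qed
    from tendsto_real_sqrt[OF this]
    have "(\<lambda>n. cmod (cnj (un n y) - Q n / of_real (sqn (an n)))) \<longlonglongrightarrow> 0" by simp
    then have "(\<lambda>n. (cnj (un n y) - Q n / of_real (sqn (an n))) + Q n / of_real (sqn (an n))) \<longlonglongrightarrow> 0 + w y"
      by (intro tendsto_add limQ) (rule tendsto_norm_zero_cancel)
    then show ?thesis by simp
  qed
  \<comment> \<open>The almost multiplicativity error tends to 0 in norm; for continuous functions a
    limit of norm 0 gives equality at every point.\<close>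
  have aw: "a (y + x) = w y * a x" for x y
  proof -
    have "(\<lambda>n. sqn (\<lambda>x. an n (y + x) - cnj (un n y) * an n x)) \<longlonglongrightarrow> sqn (\<lambda>x. a (y + x) - w y * a x)"
      unfolding sqn_def
    proof (rule LIMSEQ_integral_continuous[where C="(H + 1 * H)\<^sup>2"])
      show "(\<lambda>x. (cmod (an n (y + x) - cnj (un n y) * an n x))\<^sup>2) \<in> borel_measurable borel" for n
        by (intro meas continuous_intros an cat)
      show "(\<lambda>n. (cmod (an n (y + x) - cnj (un n y) * an n x))\<^sup>2) \<longlonglongrightarrow> (cmod (a (y + x) - w y * a x))\<^sup>2" for x
        by (intro tendsto_intros lim_a lim_u)
      fix n x
      have "cmod (an n (y + x) - cnj (un n y) * an n x) \<le> cmod (an n (y + x)) + cmod (cnj (un n y) * an n x)"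
        by (rule norm_triangle_ineq4)
      also have "\<dots> \<le> H + 1 * H"
        unfolding norm_mult by (intro add_mono mult_mono an) (use un in auto)
      finally have "(cmod (an n (y + x) - cnj (un n y) * an n x))\<^sup>2 \<le> (H + 1 * H)\<^sup>2"
        by (rule power_mono) simp
      then show "norm ((cmod (an n (y + x) - cnj (un n y) * an n x))\<^sup>2) \<le> (H + 1 * H)\<^sup>2"
        by (simp only: real_norm_def abs_power2)
    qed
    then have "sqn (\<lambda>x. a (y + x) - w y * a x) \<le> 0"
    proof (rule LIMSEQ_le)
      show "(\<lambda>n. 4 * (1 / real (Suc (k n)))) \<longlonglongrightarrow> 0"
        by (rule tendsto_mult_right_zero[OF k0])
      show "\<exists>N. \<forall>n\<ge>N. sqn (\<lambda>x. an n (y + x) - cnj (un n y) * an n x) \<le> 4 * (1 / real (Suc (k n)))"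
        using near by blast
    qed
    then have "a (y + x) - w y * a x = 0"
      by (rule sqn_eq_0[rotated]) (intro continuous_intros cat ca)
    then show ?thesis by simp
  qed
  \<comment> \<open>A zero at 0 would spread to all of \<open>a\<close> through
    \<open>aw\<close>.\<close>
  have a0': "a 0 \<noteq> 0"
  proof
    assume "a 0 = 0"
    then have "a y = 0" for y using aw[of y 0] by simp
    then show False using sa by (simp add: sqn_def)
  qed
  have wa: "w y = a y / a 0" for y using aw[of y 0] a0' by simp
  have wch: "w \<in> group_chars"
    unfolding group_chars_def
  proof (intro CollectI conjI allI)
    show "continuous_on UNIV w" unfolding wa[abs_def] using a0' by (intro continuous_intros ca) simp
    show m: "w (x + y) = w x * w y" for x y unfolding wa aw[of x y] using aw[of x 0] a0' by (simp add: wa)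
    show "cmod (w x) = 1" for x
    proof (rule bounded_hom_norm_eq_1[OF m])
      show "w 0 \<noteq> 0" using a0' by (simp add: wa)
      have "(\<lambda>n. cmod (cnj (un n y))) \<longlonglongrightarrow> cmod (w y)" for y by (intro tendsto_norm lim_u)
      then show "cmod (w y) \<le> 1" for y by (rule LIMSEQ_le_const2) (use un(2) in auto)
    qed
  qed
  \<comment> \<open>Evaluated at 0, the correlation is exactly the integral against
    \<open>h\<close>, so \<open>a 0\<close> is the pairing of \<open>h\<close> with the limit of the
    \<open>un\<close>.\<close>
  have "(\<lambda>n. \<integral>s. h s * un n s \<partial>\<mu>) \<longlonglongrightarrow> (\<integral>s. h s * cnj (w s) \<partial>\<mu>)"
  proof (rule LIMSEQ_integral_continuous[where C="H * 1"])
    show "(\<lambda>x. h x * un n x) \<in> borel_measurable borel" for n by (intro meas continuous_intros h un)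
    have "(\<lambda>n. cnj (cnj (un n x))) \<longlonglongrightarrow> cnj (w x)" for x by (intro tendsto_cnj lim_u)
    then show "(\<lambda>n. h x * un n x) \<longlonglongrightarrow> h x * cnj (w x)" for x by (intro tendsto_mult tendsto_const) simp
    show "norm (h x * un n x) \<le> H * 1" for n x
      unfolding norm_mult by (intro mult_mono H un) (use H in auto)
  qed
  moreover have "(\<integral>s. h s * un n s \<partial>\<mu>) = an n 0" for n
    by (simp add: an_def a0_def un_def corr_def)
  ultimately have "(\<integral>s. h s * cnj (w s) \<partial>\<mu>) = a 0" using lim_a[of 0] LIMSEQ_unique by auto
  then show ?thesis using a0' cnj_group_chars[OF wch] by metis
qed

theorem finite_if_finite_group_chars:
  assumes fin: "finite (group_chars :: ('g \<Rightarrow> complex) set)"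
  shows "finite (UNIV :: 'g set)"
proof -
  let ?X = "group_chars :: ('g \<Rightarrow> complex) set"
  \<comment> \<open>The added 1 makes \<open>N\<close> positive without having to exhibit a
    character.\<close>
  define N where "N = real (card ?X) + 1"
  have le: "cmod (f 0) \<le> N * (\<integral>x. cmod (f x) \<partial>\<mu>)" if f: "continuous_on UNIV f" for f :: "'g \<Rightarrow> complex"
  proof -
    define c where "c \<xi> = (\<integral>x. f x * cnj (\<xi> x) \<partial>\<mu>)" for \<xi>
    define g where "g x = f x - (\<Sum>\<xi>\<in>?X. c \<xi> * \<xi> x)" for x
    have cX: "continuous_on UNIV \<xi>" if "\<xi> \<in> ?X" for \<xi> by (rule group_charsD(1)[OF that])
    have cg: "continuous_on UNIV g" unfolding g_def[abs_def] by (intro continuous_intros f cX)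
    have g0: "(\<integral>x. g x * cnj (\<psi> x) \<partial>\<mu>) = 0" if \<psi>: "\<psi> \<in> ?X" for \<psi>
    proof -
      have i1: "integrable \<mu> (\<lambda>x. f x * cnj (\<psi> x))"
        by (intro integrable_continuous continuous_intros f cX \<psi>)
      have i2: "integrable \<mu> (\<lambda>x. c \<xi> * (\<xi> x * cnj (\<psi> x)))" if "\<xi> \<in> ?X" for \<xi>
        by (intro integrable_continuous continuous_intros f cX \<psi> that)
      have "(\<integral>x. g x * cnj (\<psi> x) \<partial>\<mu>) = (\<integral>x. f x * cnj (\<psi> x) - (\<Sum>\<xi>\<in>?X. c \<xi> * (\<xi> x * cnj (\<psi> x))) \<partial>\<mu>)"
        by (simp add: g_def left_diff_distrib sum_distrib_right mult.assoc)
      also have "\<dots> = c \<psi> - (\<Sum>\<xi>\<in>?X. c \<xi> * (\<integral>x. \<xi> x * cnj (\<psi> x) \<partial>\<mu>))"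
        using i1 i2 by (simp add: c_def[of \<psi>] Bochner_Integration.integral_sum)
      also have "(\<Sum>\<xi>\<in>?X. c \<xi> * (\<integral>x. \<xi> x * cnj (\<psi> x) \<partial>\<mu>)) = (\<Sum>\<xi>\<in>?X. if \<xi> = \<psi> then c \<xi> else 0)"
        by (rule sum.cong) (use char_orthogonal[OF _ \<psi>] in auto)
      also have "\<dots> = c \<psi>" using fin \<psi> by simp
      finally show ?thesis by simp
    qed
    have "g 0 = 0"
    proof (rule ccontr)
      assume "g 0 \<noteq> 0"
      then obtain \<xi> where \<xi>: "\<xi> \<in> ?X" "(\<integral>s. g s * \<xi> s \<partial>\<mu>) \<noteq> 0" using group_chars_separate[OF cg] by blast
      then show False using g0[OF cnj_group_chars[OF \<xi>(1)]] by simp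
    qed
    then have "f 0 = (\<Sum>\<xi>\<in>?X. c \<xi>)" by (simp add: g_def group_charsD(4))
    also have "cmod \<dots> \<le> (\<Sum>\<xi>\<in>?X. \<integral>x. cmod (f x) \<partial>\<mu>)"
    proof (rule sum_norm_le)
      fix \<xi> assume "\<xi> \<in> ?X"
      then have "cmod (f x * cnj (\<xi> x)) = cmod (f x)" for x by (simp add: norm_mult group_charsD(3))
      then show "cmod (c \<xi>) \<le> (\<integral>x. cmod (f x) \<partial>\<mu>)"
        unfolding c_def using integral_norm_bound[of \<mu> "\<lambda>x. f x * cnj (\<xi> x)"] by simp
    qed
    also have "\<dots> \<le> N * (\<integral>x. cmod (f x) \<partial>\<mu>)"
      by (simp add: N_def distrib_right Bochner_Integration.integral_nonneg)
    finally show ?thesis .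
  qed
  have N: "N > 0" by (simp add: N_def add_pos_nonneg)
  have U: "1 / N \<le> measure \<mu> U" if U: "open U" "0 \<in> U" for U
  proof -
    have "closed (- U)" "closed {0 :: 'g}" "- U \<inter> {0} = {}" using U by auto
    then obtain f :: "'g \<Rightarrow> real" where f: "continuous_on UNIV f" "\<And>x. f x \<in> {0..1}"
      "\<And>x. x \<in> - U \<Longrightarrow> f x = 0" "\<And>x. x \<in> {0} \<Longrightarrow> f x = 1"
      by (rule compact_t2_urysohn[OF cpt]) blast
    have "1 \<le> N * (\<integral>x. \<bar>f x\<bar> \<partial>\<mu>)"
      using le[of "\<lambda>x. complex_of_real (f x)"] f(1) f(4)[of 0] by (simp add: continuous_intros)
    also have "(\<integral>x. \<bar>f x\<bar> \<partial>\<mu>) \<le> (\<integral>x. indicator U x \<partial>\<mu>)"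
    proof (rule integral_mono)
      show "integrable \<mu> (indicat_real U)" using U by (auto simp: integrable_indicator_iff less_top[symmetric])
      show "integrable \<mu> (\<lambda>x. \<bar>f x\<bar>)" by (intro integrable_continuous continuous_intros f)
      show "\<bar>f x\<bar> \<le> indicat_real U x" for x
        using f(2)[of x] f(3)[of x] by (auto simp: indicator_def)
    qed
    also have "(\<integral>x. indicator U x \<partial>\<mu>) = measure \<mu> U" using U by simp
    finally show ?thesis using N by (simp add: field_simps)
  qed
  \<comment> \<open>Outer regularity turns the lower bound for all open neighbourhoods of 0 into an
    atom there; every point then has mass at least \<open>1 / N\<close>, so there are at most
    \<open>N\<close> of them.\<close>
  have "ennreal (1 / N) \<le> emeasure \<mu> {0}"
    by (subst outer_regular) (auto intro!: INF_greatest simp: emeasure_eq_measure U)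
  then have p0: "1 / N \<le> measure \<mu> {0}" by (simp add: emeasure_eq_measure)
  have p: "1 / N \<le> measure \<mu> {x}" for x
    using translate[of "{0}" x] p0 by (simp add: measure_def)
  have "card F \<le> nat \<lceil>N\<rceil>" if F: "finite F" for F :: "'g set"
  proof -
    have "real (card F) * (1 / N) \<le> (\<Sum>x\<in>F. measure \<mu> {x})"
      using sum_bounded_below[of F "1 / N"] p by simp
    also have "\<dots> = measure \<mu> F" using F by (subst finite_measure_eq_sum_singleton) auto
    also have "\<dots> \<le> 1" by simp
    finally have "real (card F) \<le> N" using N by (simp add: field_simps)
    then show ?thesis by linarith
  qed
  then show ?thesis using finite_if_finite_subsets_card_bdd[of "UNIV :: 'g set" "nat \<lceil>N\<rceil>"] by auto
qed

end


section \<open>The convolution algebra of p-integrable functions\<close>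

text \<open>The left side is the tangent line of \<open>t powr p\<close> at \<open>m\<close>, so
  this is convexity; Young's inequality with conjugate exponent \<open>q\<close> also covers
  \<open>m = 0\<close>.\<close>

lemma powr_tangent:
  fixes t m p :: real
  assumes p: "1 < p" and "0 \<le> t" "0 \<le> m"
  shows "p * t * m powr (p - 1) - (p - 1) * m powr p \<le> t powr p"
proof -
  define q where "q = p / (p - 1)"
  have q: "q > 1" "1 / p + 1 / q = 1" using p by (simp_all add: q_def field_simps)
  have "t * m powr (p - 1) \<le> t powr p / p + (m powr (p - 1)) powr q / q"
    by (rule Youngs_inequality) (use p q assms in auto)
  moreover have "(m powr (p - 1)) powr q = m powr p" using p by (simp add: powr_powr q_def)
  moreover have "x / q = (p - 1) * x / p" for x using p by (simp add: q_def)
  ultimately have "t * m powr (p - 1) \<le> t powr p / p + (p - 1) * m powr p / p" by simp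
  then have "p * (t * m powr (p - 1)) \<le> p * (t powr p / p + (p - 1) * m powr p / p)"
    using p by (intro mult_left_mono) auto
  then show ?thesis using p by (simp add: distrib_left mult.assoc)
qed

text \<open>Jensen's inequality, by integrating the tangent line at the mean
  \<open>m\<close>.\<close>

lemma (in prob_space) powr_integral_le:
  fixes h :: "'a \<Rightarrow> real"
  assumes p: "1 < p" and h: "integrable M h" "\<And>x. 0 \<le> h x" and hp: "integrable M (\<lambda>x. h x powr p)"
  shows "(\<integral>x. h x \<partial>M) powr p \<le> (\<integral>x. h x powr p \<partial>M)"
proof -
  define m where "m = (\<integral>x. h x \<partial>M)"
  have m: "0 \<le> m" unfolding m_def by (rule Bochner_Integration.integral_nonneg) (rule h(2))
  have mm: "m * m powr (p - 1) = m powr p"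
    using m p by (cases "m = 0") (simp_all add: powr_mult_base)
  have "m powr p = p * (m * m powr (p - 1)) - (p - 1) * m powr p" by (simp add: mm algebra_simps)
  also have "\<dots> = (\<integral>x. p * h x * m powr (p - 1) - (p - 1) * m powr p \<partial>M)"
    using h(1) by (simp add: m_def prob_space)
  also have "\<dots> \<le> (\<integral>x. h x powr p \<partial>M)"
    using h hp by (intro integral_mono powr_tangent p m) auto
  finally show ?thesis by (simp add: m_def)
qed

lemma norm_integral_le:
  fixes f :: "'a \<Rightarrow> 'b::{banach,second_countable_topology}"
  assumes "integrable M g" "\<And>x. norm (f x) \<le> g x"
  shows "norm (\<integral>x. f x \<partial>M) \<le> (\<integral>x. g x \<partial>M)"
proof -
  have "norm (\<integral>x. f x \<partial>M) \<le> (\<integral>x. norm (f x) \<partial>M)" by (rule integral_norm_bound)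
  also have "\<dots> \<le> (\<integral>x. g x \<partial>M)"
    by (rule integral_mono'[OF assms(1)]) (use assms(2) order_trans[OF norm_ge_zero] in auto)
  finally show ?thesis .
qed

text \<open>A crude bound that yields integrability of p-integrable functions on a probability
  space.\<close>

lemma le_1_plus_powr: "(t::real) \<le> 1 + t powr p" if "1 < p" "0 \<le> t"
proof (cases "t \<le> 1")
  case False
  then have "t powr 1 \<le> t powr p" using that by (intro powr_mono) auto
  then show ?thesis using False by simp
qed (simp add: add_increasing2)

lemma ae_class_cong: "AE x in \<mu>. f x = g x \<Longrightarrow> ae_class \<mu> f = ae_class \<mu> g"
  unfolding ae_class_def by (auto elim: eventually_elim2)

lemma class_rep_mem:
  assumes "f \<in> borel_measurable \<mu>" shows "class_rep (ae_class \<mu> f) \<in> ae_class \<mu> f"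
proof -
  have "f \<in> ae_class \<mu> f" using assms by (auto simp: ae_class_def)
  then show ?thesis unfolding class_rep_def by (rule someI[where P="\<lambda>h. h \<in> ae_class \<mu> f"])
qed

lemma class_rep_AE:
  assumes "f \<in> borel_measurable \<mu>"
  shows "class_rep (ae_class \<mu> f) \<in> borel_measurable \<mu>" "AE x in \<mu>. class_rep (ae_class \<mu> f) x = f x"
  using class_rep_mem[OF assms] by (auto simp: ae_class_def)

lemma Lp_functions_iff:
  "f \<in> Lp_functions \<mu> p \<longleftrightarrow> f \<in> borel_measurable \<mu> \<and> integrable \<mu> (\<lambda>x. norm (f x) powr p)"
  by (auto simp: Lp_functions_def integrable_iff_bounded)

lemma Lp_functions_measurable: "f \<in> Lp_functions \<mu> p \<Longrightarrow> f \<in> borel_measurable \<mu>"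
  by (simp add: Lp_functions_def)

lemma Lp_functions_AE:
  assumes f: "f \<in> Lp_functions \<mu> p" and g: "g \<in> borel_measurable \<mu>" and eq: "AE x in \<mu>. f x = g x"
  shows "g \<in> Lp_functions \<mu> p"
proof -
  have [measurable]: "f \<in> borel_measurable \<mu>" "g \<in> borel_measurable \<mu>"
    using Lp_functions_measurable[OF f] g by auto
  have "integrable \<mu> (\<lambda>x. norm (g x) powr p)"
    using f unfolding Lp_functions_iff
    by (subst integrable_cong_AE[where g="\<lambda>x. norm (f x) powr p"]) (use eq in auto)
  then show ?thesis using g by (simp add: Lp_functions_iff)
qed

lemma Lp_carrierE:
  assumes "X \<in> alg_carrier (Lp_algebra \<mu> p)"
  shows "class_rep X \<in> Lp_functions \<mu> p" "ae_class \<mu> (class_rep X) = X"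
proof -
  obtain f where f: "f \<in> Lp_functions \<mu> p" "X = ae_class \<mu> f" using assms by (auto simp: Lp_algebra_def)
  note r = class_rep_AE[OF Lp_functions_measurable[OF f(1)]]
  show "class_rep X \<in> Lp_functions \<mu> p"
    unfolding f(2) by (rule Lp_functions_AE[OF f(1) r(1)]) (use r(2) in auto)
  show "ae_class \<mu> (class_rep X) = X"
    unfolding f(2) by (rule ae_class_cong[OF r(2)])
qed

lemma Lp_carrierI: "f \<in> Lp_functions \<mu> p \<Longrightarrow> ae_class \<mu> f \<in> alg_carrier (Lp_algebra \<mu> p)"
  by (auto simp: Lp_algebra_def)

lemma Lp_algebra_simps:
  "alg_add (Lp_algebra \<mu> p) X Y = ae_class \<mu> (\<lambda>x. class_rep X x + class_rep Y x)"
  "alg_scale (Lp_algebra \<mu> p) c X = ae_class \<mu> (\<lambda>x. scaleC c (class_rep X x))"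
  "alg_mult (Lp_algebra \<mu> p) X Y = ae_class \<mu> (convolution \<mu> (class_rep X) (class_rep Y))"
  "alg_norm (Lp_algebra \<mu> p) X = Lp_norm \<mu> p (class_rep X)"
  by (simp_all add: Lp_algebra_def)

lemma bounded_linear_scaleC: "bounded_linear (scaleC c :: 'a \<Rightarrow> 'a::complex_normed_algebra)"
proof (rule bounded_linear_intro[where K="cmod c"])
  show "scaleC c (r *\<^sub>R x) = r *\<^sub>R scaleC c x" for r and x :: 'a
    by (simp add: scaleC_scaleC mult.commute flip: scaleC_of_real)
qed (simp_all add: scaleC_add_right norm_scaleC mult.commute)

lemma measurable_scaleC [measurable (raw)]:
  fixes f :: "'b \<Rightarrow> 'a::{complex_normed_algebra,banach,second_countable_topology}"
  assumes "f \<in> borel_measurable M" shows "(\<lambda>x. scaleC c (f x)) \<in> borel_measurable M"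
  by (rule measurable_compose[OF assms borel_measurable_continuous_onI])
    (rule linear_continuous_on[OF bounded_linear_scaleC])

lemma Lp_functions_add:
  assumes p: "1 < p" and f: "f \<in> Lp_functions \<mu> p" and g: "g \<in> Lp_functions \<mu> p"
  shows "(\<lambda>x. f x + g x) \<in> Lp_functions \<mu> p"
proof -
  have [measurable]: "f \<in> borel_measurable \<mu>" "g \<in> borel_measurable \<mu>"
    using f g by (auto simp: Lp_functions_def)
  have "integrable \<mu> (\<lambda>x. norm (f x + g x) powr p)"
  proof (rule Bochner_Integration.integrable_bound)
    show "integrable \<mu> (\<lambda>x. 2 powr p * (norm (f x) powr p + norm (g x) powr p))"
      using f g by (simp add: Lp_functions_iff)
    show "AE x in \<mu>. norm (norm (f x + g x) powr p) \<le> norm (2 powr p * (norm (f x) powr p + norm (g x) powr p))"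
    proof (rule AE_I2)
      fix x
      let ?m = "max (norm (f x)) (norm (g x))"
      have "norm (f x + g x) \<le> 2 * ?m" using norm_triangle_ineq[of "f x" "g x"] by linarith
      then have "norm (f x + g x) powr p \<le> (2 * ?m) powr p" using p by (intro powr_mono2) auto
      also have "\<dots> = 2 powr p * ?m powr p" by (subst powr_mult) auto
      also have "\<dots> \<le> 2 powr p * (norm (f x) powr p + norm (g x) powr p)"
        by (intro mult_left_mono) (auto simp: max_def)
      finally show "norm (norm (f x + g x) powr p) \<le> norm (2 powr p * (norm (f x) powr p + norm (g x) powr p))"
        by simp
    qed
  qed measurable
  then show ?thesis by (simp add: Lp_functions_iff)
qed

lemma Lp_functions_scaleC:
  fixes f :: "'g \<Rightarrow> 'a::{complex_normed_algebra,banach,second_countable_topology}"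
  assumes f: "f \<in> Lp_functions \<mu> p"
  shows "(\<lambda>x. scaleC c (f x)) \<in> Lp_functions \<mu> p"
  using f by (auto simp: Lp_functions_iff norm_scaleC powr_mult)

context compact_haar
begin

lemma Lp_integrable:
  assumes p: "1 < p" and f: "f \<in> Lp_functions \<mu> p" shows "integrable \<mu> f"
proof (rule Bochner_Integration.integrable_bound)
  show "integrable \<mu> (\<lambda>x. 1 + norm (f x) powr p)" using f by (simp add: Lp_functions_iff)
  show "AE x in \<mu>. norm (f x) \<le> norm (1 + norm (f x) powr p)"
    using le_1_plus_powr[OF p norm_ge_zero] by (intro AE_I2) (simp add: abs_of_nonneg)
qed (use f in \<open>simp add: Lp_functions_iff\<close>)

section \<open>Convolution on classes of functions\<close>

text \<open>The two convolutions agree at every point, not just almost everywhere: for each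
  \<open>x\<close> the map sending \<open>y\<close> to \<open>- y + x\<close> pulls null sets back
  to null sets. Representatives may therefore be exchanged for Baire ones before any measurability
  question arises.\<close>

lemma convolution_cong:
  fixes f g :: "'g \<Rightarrow> 'a::{real_normed_algebra,banach,second_countable_topology}"
  assumes [measurable]: "f \<in> borel_measurable borel" "g \<in> borel_measurable borel"
      "f' \<in> borel_measurable borel" "g' \<in> borel_measurable borel"
    and f: "AE x in \<mu>. f x = f' x" and g: "AE x in \<mu>. g x = g' x"
  shows "convolution \<mu> f g = convolution \<mu> f' g'"
proof
  fix x
  have "AE y in \<mu>. f y * g (- y + x) = f' y * g' (- y + x)"
    using f AE_reflect_translate[OF g, of x] by eventually_elim simp
  then show "convolution \<mu> f g x = convolution \<mu> f' g' x"
    unfolding convolution_def by (intro integral_cong_AE) simp_all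
qed

lemma convolution_integrand_measurable [measurable]:
  fixes F G :: "'g \<Rightarrow> 'b::{real_normed_algebra,banach,second_countable_topology}"
  assumes [measurable]: "F \<in> borel_measurable baire" "G \<in> borel_measurable baire"
  shows "(\<lambda>(y, x). F y * G (- y + x)) \<in> borel_measurable (baire \<Otimes>\<^sub>M baire)"
    "(\<lambda>(x, y). F y * G (- y + x)) \<in> borel_measurable (baire \<Otimes>\<^sub>M baire)"
    "(\<lambda>y. G (- y + x)) \<in> borel_measurable baire"
    "(\<lambda>x. G (- y + x)) \<in> borel_measurable baire"
proof -
  have d: "(\<lambda>p. - fst p + snd p :: 'g) \<in> measurable (baire \<Otimes>\<^sub>M baire) baire"
    using measurable_compose[OF measurable_Pair[OF measurable_compose[OF measurable_fst uminus_baire] measurable_snd] add_baire]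
    by simp
  have 1: "(\<lambda>p. F (fst p) * G (- fst p + snd p)) \<in> borel_measurable (baire \<Otimes>\<^sub>M baire)"
    by (intro borel_measurable_times measurable_compose[OF d] measurable_compose[OF measurable_fst] assms)
  then show "(\<lambda>(y, x). F y * G (- y + x)) \<in> borel_measurable (baire \<Otimes>\<^sub>M baire)"
    by (simp add: case_prod_beta)
  have "(\<lambda>p. F (snd p) * G (- snd p + fst p)) \<in> borel_measurable (baire \<Otimes>\<^sub>M baire)"
    using measurable_compose[OF measurable_Pair[OF measurable_snd measurable_fst] 1] by simp
  then show "(\<lambda>(x, y). F y * G (- y + x)) \<in> borel_measurable (baire \<Otimes>\<^sub>M baire)"
    by (simp add: case_prod_beta)
  have c: "(\<lambda>_. z) \<in> measurable baire baire" for z :: 'g by simp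
  have i: "(\<lambda>z. z) \<in> measurable baire (baire :: 'g measure)" by simp
  show "(\<lambda>y. G (- y + x)) \<in> borel_measurable baire"
    using measurable_compose[OF measurable_compose[OF measurable_Pair[OF i c] d] assms(2)] by simp
  show "(\<lambda>x. G (- y + x)) \<in> borel_measurable baire"
    using measurable_compose[OF measurable_compose[OF measurable_Pair[OF c i] d] assms(2)] by simp
qed

text \<open>For fixed \<open>y\<close> the inner integral of the norm is at most
  \<open>norm (F y)\<close> times the integral of \<open>norm G\<close>, by translation invariance,
  and this bound is integrable in \<open>y\<close>.\<close>

lemma convolution_integrand_integrable:
  fixes F G :: "'g \<Rightarrow> 'b::{real_normed_algebra,banach,second_countable_topology}"
  assumes F: "F \<in> borel_measurable baire" "integrable \<mu> F" and G: "G \<in> borel_measurable baire" "integrable \<mu> G"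
  shows "integrable (\<nu> \<Otimes>\<^sub>M \<nu>) (\<lambda>(y, x). F y * G (- y + x))"
proof (rule nu2.Fubini_integrable)
  note [measurable] = F(1) G(1)
  have m: "(\<lambda>(y, x). F y * G (- y + x)) \<in> borel_measurable (\<nu> \<Otimes>\<^sub>M \<nu>)"
    using convolution_integrand_measurable(1)[OF F(1) G(1)] by (simp cong: measurable_cong_sets)
  then show "(\<lambda>(y, x). F y * G (- y + x)) \<in> borel_measurable (\<nu> \<Otimes>\<^sub>M \<nu>)" .
  have Gb: "G \<in> borel_measurable borel" by (rule borel_measurable_if_baire[OF G(1)])
  have Gt: "integrable \<nu> (\<lambda>x. G (- y + x))" for y
    by (subst integrable_nu[OF convolution_integrand_measurable(4)[OF F(1) G(1)]]) (rule integrable_translate[OF G(2)])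
  have in1: "integrable \<nu> (\<lambda>x. F y * G (- y + x))" for y using Gt by (rule integrable_mult_right)
  then show "AE y in \<nu>. integrable \<nu> (\<lambda>x. case (y, x) of (y, x) \<Rightarrow> F y * G (- y + x))" by simp
  have le: "(\<integral>x. norm (F y * G (- y + x)) \<partial>\<nu>) \<le> norm (F y) * (\<integral>x. norm (G x) \<partial>\<mu>)" for y
  proof -
    have "(\<integral>x. norm (F y * G (- y + x)) \<partial>\<nu>) \<le> (\<integral>x. norm (F y) * norm (G (- y + x)) \<partial>\<nu>)"
      by (intro integral_mono integrable_norm in1 integrable_mult_right Gt norm_mult_ineq)
    also have "\<dots> = norm (F y) * (\<integral>x. norm (G (- y + x)) \<partial>\<mu>)"
      using convolution_integrand_measurable(4)[OF F(1) G(1), of y] by (simp add: integral_nu)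
    also have "(\<integral>x. norm (G (- y + x)) \<partial>\<mu>) = (\<integral>x. norm (G x) \<partial>\<mu>)"
      by (rule integral_translate) (use Gb in simp)
    finally show ?thesis .
  qed
  show "integrable \<nu> (\<lambda>y. \<integral>x. norm (case (y, x) of (y, x) \<Rightarrow> F y * G (- y + x)) \<partial>\<nu>)"
  proof (rule Bochner_Integration.integrable_bound)
    show "integrable \<nu> (\<lambda>y. norm (F y) * (\<integral>x. norm (G x) \<partial>\<mu>))"
      using F by (intro integrable_mult_left integrable_norm) (simp add: integrable_nu)
    show "(\<lambda>y. \<integral>x. norm (case (y, x) of (y, x) \<Rightarrow> F y * G (- y + x)) \<partial>\<nu>) \<in> borel_measurable \<nu>"
      using m by (intro nu.borel_measurable_lebesgue_integral) (simp add: case_prod_beta)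
    show "AE y in \<nu>. norm (\<integral>x. norm (case (y, x) of (y, x) \<Rightarrow> F y * G (- y + x)) \<partial>\<nu>)
        \<le> norm (norm (F y) * (\<integral>x. norm (G x) \<partial>\<mu>))"
      using le by (intro AE_I2) (simp add: abs_of_nonneg Bochner_Integration.integral_nonneg)
  qed
qed

lemma Lp_baire_rep:
  fixes f :: "'g \<Rightarrow> 'b::{banach,second_countable_topology}"
  assumes f: "f \<in> Lp_functions \<mu> p"
  obtains f' where "f' \<in> borel_measurable baire" "f' \<in> Lp_functions \<mu> p" "AE x in \<mu>. f x = f' x"
proof -
  have "f \<in> borel_measurable borel" using f by (simp add: Lp_functions_def)
  then obtain f' where f': "f' \<in> borel_measurable baire" "AE x in \<mu>. f x = f' x" by (rule baire_function_ae_eq)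
  have "f' \<in> Lp_functions \<mu> p"
    by (rule Lp_functions_AE[OF f _ f'(2)]) (use borel_measurable_if_baire[OF f'(1)] in simp)
  then show ?thesis using that f' by blast
qed

lemma convolution_baire_measurable:
  fixes f g :: "'g \<Rightarrow> 'a::{real_normed_algebra,banach,second_countable_topology}"
  assumes f: "f \<in> borel_measurable baire" and g: "g \<in> borel_measurable baire"
  shows "convolution \<mu> f g \<in> borel_measurable baire"
proof -
  have [measurable]: "(\<lambda>y. f y * g (- y + x)) \<in> borel_measurable baire" for x
    using f convolution_integrand_measurable(3)[OF f g, of x] by simp
  have "(\<lambda>(x, y). f y * g (- y + x)) \<in> borel_measurable (baire \<Otimes>\<^sub>M \<nu>)"
    using convolution_integrand_measurable(2)[OF f g] by (simp cong: measurable_cong_sets)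
  then have "(\<lambda>x. \<integral>y. f y * g (- y + x) \<partial>\<nu>) \<in> borel_measurable baire"
    by (rule nu.borel_measurable_lebesgue_integral)
  moreover have "(\<integral>y. f y * g (- y + x) \<partial>\<nu>) = convolution \<mu> f g x" for x
    unfolding convolution_def by (rule integral_nu) measurable
  ultimately show ?thesis by simp
qed

text \<open>Since \<open>\<mu>\<close> is a probability measure, Jensen's inequality bounds \<open>norm ((f * g) x) powr p\<close> by the
  convolution of \<open>norm f powr p\<close> and \<open>norm g powr p\<close>, so that Hoelder's inequality is not needed.\<close>

lemma Lp_functions_convolution_baire:
  fixes f g :: "'g \<Rightarrow> 'a::{real_normed_algebra,banach,second_countable_topology}"
  assumes p: "1 < p" and f: "f \<in> Lp_functions \<mu> p" "f \<in> borel_measurable baire"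
    and g: "g \<in> Lp_functions \<mu> p" "g \<in> borel_measurable baire"
  shows "convolution \<mu> f g \<in> Lp_functions \<mu> p"
proof -
  let ?F = "\<lambda>x. norm (f x) powr p" and ?G = "\<lambda>x. norm (g x) powr p"
  have F: "?F \<in> borel_measurable baire" "integrable \<mu> ?F" and G: "?G \<in> borel_measurable baire" "integrable \<mu> ?G"
    using f g by (auto simp: Lp_functions_iff)
  note int = convolution_integrand_integrable[OF F G]
  have cm: "convolution \<mu> f g \<in> borel_measurable baire"
    by (rule convolution_baire_measurable[OF f(2) g(2)])
  have bound: "norm (convolution \<mu> f g x) powr p \<le> (\<integral>y. ?F y * ?G (- y + x) \<partial>\<nu>)"
    if i: "integrable \<nu> (\<lambda>y. ?F y * ?G (- y + x))" for x
  proof -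
    define h where "h y = norm (f y) * norm (g (- y + x))" for y
    have hb: "h \<in> borel_measurable baire"
      unfolding h_def[abs_def]
      using f(2) convolution_integrand_measurable(3)[OF f(2) g(2), of x] by simp
    have hp: "h y powr p = ?F y * ?G (- y + x)" for y by (simp add: h_def powr_mult)
    have h0: "0 \<le> h y" for y by (simp add: h_def)
    have ihp: "integrable \<nu> (\<lambda>y. h y powr p)" unfolding hp by (rule i)
    have ih: "integrable \<nu> h"
    proof (rule Bochner_Integration.integrable_bound)
      show "integrable \<nu> (\<lambda>y. 1 + h y powr p)" using ihp by simp
      show "AE y in \<nu>. norm (h y) \<le> norm (1 + h y powr p)"
        using le_1_plus_powr[OF p h0] h0 by (intro AE_I2) (simp add: abs_of_nonneg)
    qed (use hb in simp)
    have "norm (convolution \<mu> f g x) = norm (\<integral>y. f y * g (- y + x) \<partial>\<nu>)"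
      unfolding convolution_def
      using f(2) convolution_integrand_measurable(3)[OF f(2) g(2), of x] by (simp add: integral_nu)
    also have "\<dots> \<le> (\<integral>y. h y \<partial>\<nu>)"
      by (rule norm_integral_le[OF ih]) (simp add: h_def norm_mult_ineq)
    finally have "norm (convolution \<mu> f g x) powr p \<le> (\<integral>y. h y \<partial>\<nu>) powr p"
      using p by (intro powr_mono2) auto
    also have "\<dots> \<le> (\<integral>y. h y powr p \<partial>\<nu>)" by (rule nu.powr_integral_le[OF p ih h0 ihp])
    finally show ?thesis by (simp only: hp)
  qed
  have "integrable \<nu> (\<lambda>x. norm (convolution \<mu> f g x) powr p)"
  proof (rule Bochner_Integration.integrable_bound)
    show "integrable \<nu> (\<lambda>x. \<integral>y. ?F y * ?G (- y + x) \<partial>\<nu>)" by (rule nu2.integrable_snd[OF int])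
    show "AE x in \<nu>. norm (norm (convolution \<mu> f g x) powr p) \<le> norm (\<integral>y. ?F y * ?G (- y + x) \<partial>\<nu>)"
      using nu2.AE_integrable_snd[OF int]
    proof eventually_elim
      case (elim x)
      then show ?case using bound[OF elim] by (simp add: abs_of_nonneg Bochner_Integration.integral_nonneg)
    qed
  qed (use cm in simp)
  then have "integrable \<mu> (\<lambda>x. norm (convolution \<mu> f g x) powr p)"
    using cm by (subst (asm) integrable_nu) simp_all
  then show ?thesis using borel_measurable_if_baire[OF cm] by (simp add: Lp_functions_iff)
qed

text \<open>Convolution of arbitrary elements is reduced to Baire representatives here, the only
  setting in which the Fubini argument applies.\<close>

lemma convolution_rep:
  fixes f g :: "'g \<Rightarrow> 'a::{real_normed_algebra,banach,second_countable_topology}"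
  assumes p: "1 < p" and f: "f \<in> Lp_functions \<mu> p" and g: "g \<in> Lp_functions \<mu> p"
  obtains f' g' where "f' \<in> Lp_functions \<mu> p" "f' \<in> borel_measurable baire" "AE x in \<mu>. f x = f' x"
    "g' \<in> Lp_functions \<mu> p" "g' \<in> borel_measurable baire" "AE x in \<mu>. g x = g' x"
    "convolution \<mu> f g = convolution \<mu> f' g'"
proof -
  obtain f' where f': "f' \<in> borel_measurable baire" "f' \<in> Lp_functions \<mu> p" "AE x in \<mu>. f x = f' x"
    using Lp_baire_rep[OF f] .
  obtain g' where g': "g' \<in> borel_measurable baire" "g' \<in> Lp_functions \<mu> p" "AE x in \<mu>. g x = g' x"
    using Lp_baire_rep[OF g] .
  have "convolution \<mu> f g = convolution \<mu> f' g'"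
    by (rule convolution_cong[OF _ _ _ _ f'(3) g'(3)])
      (use f g f'(1) g'(1) borel_measurable_if_baire in \<open>auto simp: Lp_functions_def\<close>)
  then show ?thesis using that f' g' by blast
qed

lemma Lp_functions_convolution:
  fixes f g :: "'g \<Rightarrow> 'a::{real_normed_algebra,banach,second_countable_topology}"
  assumes p: "1 < p" and f: "f \<in> Lp_functions \<mu> p" and g: "g \<in> Lp_functions \<mu> p"
  shows "convolution \<mu> f g \<in> Lp_functions \<mu> p"
proof -
  obtain f' g' where "f' \<in> Lp_functions \<mu> p" "f' \<in> borel_measurable baire"
    "g' \<in> Lp_functions \<mu> p" "g' \<in> borel_measurable baire" "convolution \<mu> f g = convolution \<mu> f' g'"
    using convolution_rep[OF p f g] by metis
  then show ?thesis using Lp_functions_convolution_baire[OF p] by metis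
qed

lemma Lp_closed:
  fixes X Y :: "('g \<Rightarrow> 'a::{complex_normed_algebra,banach,second_countable_topology}) set"
  assumes p: "1 < p" and X: "X \<in> alg_carrier (Lp_algebra \<mu> p)" and Y: "Y \<in> alg_carrier (Lp_algebra \<mu> p)"
  shows "alg_add (Lp_algebra \<mu> p) X Y \<in> alg_carrier (Lp_algebra \<mu> p)"
    "alg_mult (Lp_algebra \<mu> p) X Y \<in> alg_carrier (Lp_algebra \<mu> p)"
  unfolding Lp_algebra_simps using Lp_carrierE(1)[OF X] Lp_carrierE(1)[OF Y]
  by (auto intro!: Lp_carrierI Lp_functions_add Lp_functions_convolution p)

lemma Lp_scale_closed:
  fixes X :: "('g \<Rightarrow> 'a::{complex_normed_algebra,banach,second_countable_topology}) set"
  assumes "X \<in> alg_carrier (Lp_algebra \<mu> p)"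
  shows "alg_scale (Lp_algebra \<mu> p) c X \<in> alg_carrier (Lp_algebra \<mu> p)"
  unfolding Lp_algebra_simps by (intro Lp_carrierI Lp_functions_scaleC Lp_carrierE(1)[OF assms])

section \<open>Characters of the convolution algebra coming from the group and the coefficient
  algebra\<close>

definition Lp_char :: "real \<Rightarrow> ('g \<Rightarrow> complex) \<Rightarrow>
    ('a::{complex_normed_algebra,banach,second_countable_topology} \<Rightarrow> complex) \<Rightarrow> ('g \<Rightarrow> 'a) set \<Rightarrow> complex" where
  "Lp_char p \<xi> \<phi> = (\<lambda>X\<in>alg_carrier (Lp_algebra \<mu> p). \<integral>x. \<xi> x * \<phi> (class_rep X x) \<partial>\<mu>)"

lemma integrable_char_times:
  assumes \<xi>: "\<xi> \<in> group_chars" and \<phi>: "bounded_linear \<phi>" and f: "integrable \<mu> f"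
  shows "integrable \<mu> (\<lambda>x. \<xi> x * \<phi> (f x))"
proof (rule Bochner_Integration.integrable_bound)
  have i: "integrable \<mu> (\<lambda>x. \<phi> (f x))" by (rule integrable_bounded_linear[OF \<phi> f])
  show "integrable \<mu> (\<lambda>x. norm (\<phi> (f x)))" using i by simp
  have "\<xi> \<in> borel_measurable borel" by (rule borel_measurable_continuous_onI[OF group_charsD(1)[OF \<xi>]])
  then show "(\<lambda>x. \<xi> x * \<phi> (f x)) \<in> borel_measurable \<mu>"
    using borel_measurable_integrable[OF i] by simp
  show "AE x in \<mu>. norm (\<xi> x * \<phi> (f x)) \<le> norm (norm (\<phi> (f x)))"
    by (simp add: norm_mult group_charsD(3)[OF \<xi>])
qed

lemma Lp_char_eq:
  fixes f :: "'g \<Rightarrow> 'a::{complex_normed_algebra,comm_ring_1,banach,second_countable_topology}"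
  assumes \<xi>: "\<xi> \<in> group_chars" and \<phi>: "\<phi> \<in> \<Delta> (type_algebra TYPE('a))"
    and f: "f \<in> Lp_functions \<mu> p"
  shows "Lp_char p \<xi> \<phi> (ae_class \<mu> f) = (\<integral>x. \<xi> x * \<phi> (f x) \<partial>\<mu>)"
proof -
  have [measurable]: "\<xi> \<in> borel_measurable borel" by (rule borel_measurable_continuous_onI[OF group_charsD(1)[OF \<xi>]])
  have [measurable]: "\<phi> \<in> borel_measurable borel"
    by (rule borel_measurable_continuous_onI[OF linear_continuous_on[OF type_character_bounded_linear[OF \<phi>]]])
  have [measurable]: "f \<in> borel_measurable borel" using f by (simp add: Lp_functions_def)
  note r = class_rep_AE[OF Lp_functions_measurable[OF f]]
  have [measurable]: "class_rep (ae_class \<mu> f) \<in> borel_measurable borel" using r(1) by simp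
  have "(\<integral>x. \<xi> x * \<phi> (class_rep (ae_class \<mu> f) x) \<partial>\<mu>) = (\<integral>x. \<xi> x * \<phi> (f x) \<partial>\<mu>)"
  proof (rule integral_cong_AE)
    show "AE x in \<mu>. \<xi> x * \<phi> (class_rep (ae_class \<mu> f) x) = \<xi> x * \<phi> (f x)"
      using r(2) by eventually_elim simp
  qed simp_all
  then show ?thesis using Lp_carrierI[OF f] by (simp add: Lp_char_def)
qed

text \<open>The splitting \<open>\<xi> x = \<xi> y * \<xi> (- y + x)\<close> turns the transformed
  integrand into a convolution integrand of the scalar functions \<open>F\<close> and
  \<open>G\<close>, whose total integral factorises by Fubini and translation.\<close>

lemma char_convolution:
  fixes f g :: "'g \<Rightarrow> 'a::{complex_normed_algebra,comm_ring_1,banach,second_countable_topology}"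
  assumes \<xi>: "\<xi> \<in> group_chars" and \<phi>: "\<phi> \<in> \<Delta> (type_algebra TYPE('a))"
    and f: "integrable \<mu> f" "f \<in> borel_measurable baire" and g: "integrable \<mu> g" "g \<in> borel_measurable baire"
  shows "(\<integral>x. \<xi> x * \<phi> (convolution \<mu> f g x) \<partial>\<mu>) = (\<integral>x. \<xi> x * \<phi> (f x) \<partial>\<mu>) * (\<integral>x. \<xi> x * \<phi> (g x) \<partial>\<mu>)"
proof -
  have bl: "bounded_linear \<phi>" by (rule type_character_bounded_linear[OF \<phi>])
  have \<xi>m [measurable]: "\<xi> \<in> borel_measurable baire" by (rule continuous_baire[OF group_charsD(1)[OF \<xi>]])
  have \<xi>b [measurable]: "\<xi> \<in> borel_measurable borel" by (rule borel_measurable_if_baire[OF \<xi>m])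
  have \<phi>m [measurable]: "\<phi> \<in> borel_measurable borel"
    by (rule borel_measurable_continuous_onI[OF linear_continuous_on[OF bl]])
  define F where "F x = \<xi> x * \<phi> (f x)" for x
  define G where "G x = \<xi> x * \<phi> (g x)" for x
  have F: "F \<in> borel_measurable baire" "integrable \<mu> F"
    unfolding F_def[abs_def] using f(2) integrable_char_times[OF \<xi> bl f(1)] by measurable
  have G: "G \<in> borel_measurable baire" "integrable \<mu> G"
    unfolding G_def[abs_def] using g(2) integrable_char_times[OF \<xi> bl g(1)] by measurable
  have intA: "integrable (\<nu> \<Otimes>\<^sub>M \<nu>) (\<lambda>(y, x). f y * g (- y + x))"
    by (rule convolution_integrand_integrable[OF f(2,1) g(2,1)])
  have intC: "integrable (\<nu> \<Otimes>\<^sub>M \<nu>) (\<lambda>(y, x). F y * G (- y + x))"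
    by (rule convolution_integrand_integrable[OF F G])
  \<comment> \<open>Moving \<open>\<phi>\<close> under the Bochner integral needs an integrable
    integrand, which holds only for almost every \<open>x\<close>.\<close>
  have "AE x in \<mu>. integrable \<nu> (\<lambda>y. f y * g (- y + x))"
    using nu2.AE_integrable_snd[OF intA] by (rule AE_nu_imp)
  then have pt: "AE x in \<mu>. \<xi> x * \<phi> (convolution \<mu> f g x) = (\<integral>y. F y * G (- y + x) \<partial>\<mu>)"
  proof eventually_elim
    case (elim x)
    have i: "integrable \<mu> (\<lambda>y. f y * g (- y + x))"
      using elim f(2) convolution_integrand_measurable(3)[OF f(2) g(2), of x]
      by (subst (asm) integrable_nu) simp_all
    have "\<phi> (convolution \<mu> f g x) = (\<integral>y. \<phi> (f y * g (- y + x)) \<partial>\<mu>)"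
      unfolding convolution_def by (rule integral_bounded_linear[OF bl i, symmetric])
    then have "\<xi> x * \<phi> (convolution \<mu> f g x) = (\<integral>y. \<xi> x * \<phi> (f y * g (- y + x)) \<partial>\<mu>)" by simp
    also have "\<dots> = (\<integral>y. F y * G (- y + x) \<partial>\<mu>)"
    proof (rule Bochner_Integration.integral_cong)
      fix y
      have "\<xi> x = \<xi> y * \<xi> (- y + x)" using group_charsD(2)[OF \<xi>, of y "- y + x"] by simp
      moreover have "\<phi> (f y * g (- y + x)) = \<phi> (f y) * \<phi> (g (- y + x))"
        using \<phi> by (simp add: type_characters_iff)
      ultimately show "\<xi> x * \<phi> (f y * g (- y + x)) = F y * G (- y + x)" by (simp add: F_def G_def)
    qed simp
    finally show ?case .
  qed
  have cm: "convolution \<mu> f g \<in> borel_measurable borel"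
    by (rule borel_measurable_if_baire[OF convolution_baire_measurable[OF f(2) g(2)]])
  have cm2: "convolution \<mu> F G \<in> borel_measurable borel"
    by (rule borel_measurable_if_baire[OF convolution_baire_measurable[OF F(1) G(1)]])
  have "(\<integral>x. \<xi> x * \<phi> (convolution \<mu> f g x) \<partial>\<mu>) = (\<integral>x. (\<integral>y. F y * G (- y + x) \<partial>\<mu>) \<partial>\<mu>)"
  proof (rule integral_cong_AE[OF _ _ pt])
    show "(\<lambda>x. \<xi> x * \<phi> (convolution \<mu> f g x)) \<in> borel_measurable \<mu>" using cm by simp
    show "(\<lambda>x. \<integral>y. F y * G (- y + x) \<partial>\<mu>) \<in> borel_measurable \<mu>"
      using cm2 by (simp add: convolution_def[abs_def])
  qed
  also have "\<dots> = (\<integral>y. (\<integral>x. F y * G (- y + x) \<partial>\<mu>) \<partial>\<mu>)" by (rule fubini[OF intC, symmetric])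
  also have "\<dots> = (\<integral>y. F y * (\<integral>x. G x \<partial>\<mu>) \<partial>\<mu>)"
    by (simp only: integral_mult_right_zero integral_translate[OF borel_measurable_if_baire[OF G(1)]])
  also have "\<dots> = (\<integral>y. F y \<partial>\<mu>) * (\<integral>x. G x \<partial>\<mu>)" by simp
  finally show ?thesis by (simp add: F_def G_def)
qed

text \<open>Applied to the conjugate character, it supplies an element on which
  \<open>Lp_char\<close> has value 1, so that this functional is nonzero.\<close>

lemma Lp_const_char:
  fixes \<xi> :: "'g \<Rightarrow> complex"
  assumes \<xi>: "\<xi> \<in> group_chars"
  shows "(\<lambda>x. scaleC (\<xi> x) (1 :: 'a::{complex_normed_algebra,comm_ring_1,banach,second_countable_topology}))
    \<in> Lp_functions \<mu> p"
proof -
  have "bounded_linear (\<lambda>c. scaleC c (1::'a))"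
  proof (rule bounded_linear_intro[where K="norm (1::'a)"])
    show "scaleC (r *\<^sub>R c) (1::'a) = r *\<^sub>R scaleC c 1" for r c
      by (simp add: scaleR_conv_of_real scaleC_scaleC flip: scaleC_of_real)
  qed (simp_all add: scaleC_add_left norm_scaleC)
  then have "continuous_on UNIV (\<lambda>x. scaleC (\<xi> x) (1::'a))"
    using continuous_on_UNIV_comp[OF linear_continuous_on group_charsD(1)[OF \<xi>]] by blast
  then show ?thesis
    unfolding Lp_functions_iff
    by (simp add: borel_measurable_continuous_onI norm_scaleC group_charsD(3)[OF \<xi>])
qed

lemma Lp_char_character:
  fixes \<phi> :: "'a::{complex_normed_algebra,comm_ring_1,banach,second_countable_topology} \<Rightarrow> complex"
  assumes p: "1 < p" and \<xi>: "\<xi> \<in> group_chars" and \<phi>: "\<phi> \<in> \<Delta> (type_algebra TYPE('a))"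
  shows "Lp_char p \<xi> \<phi> \<in> \<Delta> (Lp_algebra \<mu> p :: ('g \<Rightarrow> 'a) set normed_alg)"
proof -
  let ?B = "Lp_algebra \<mu> p :: ('g \<Rightarrow> 'a) set normed_alg"
  have bl: "bounded_linear \<phi>" by (rule type_character_bounded_linear[OF \<phi>])
  have \<phi>': "\<phi> (a + b) = \<phi> a + \<phi> b" "\<phi> (scaleC c a) = c * \<phi> a" "\<phi> 1 = 1" for a b c
    using \<phi> by (auto simp: type_characters_iff)
  have rep: "class_rep X \<in> Lp_functions \<mu> p" "integrable \<mu> (class_rep X)"
    "Lp_char p \<xi> \<phi> X = (\<integral>x. \<xi> x * \<phi> (class_rep X x) \<partial>\<mu>)" if "X \<in> alg_carrier ?B" for X
    using Lp_carrierE(1)[OF that] Lp_integrable[OF p] that by (auto simp: Lp_char_def)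
  show ?thesis
    unfolding characters_def linear_functionals_def
  proof (intro CollectI conjI ballI allI)
    show "Lp_char p \<xi> \<phi> \<in> extensional (alg_carrier ?B)" by (simp add: Lp_char_def)
    fix X Y :: "('g \<Rightarrow> 'a) set" assume X: "X \<in> alg_carrier ?B" and Y: "Y \<in> alg_carrier ?B"
    show "Lp_char p \<xi> \<phi> (alg_add ?B X Y) = Lp_char p \<xi> \<phi> X + Lp_char p \<xi> \<phi> Y"
      unfolding Lp_algebra_simps
      using Lp_char_eq[OF \<xi> \<phi> Lp_functions_add[OF p rep(1)[OF X] rep(1)[OF Y]]]
        integrable_char_times[OF \<xi> bl rep(2)[OF X]] integrable_char_times[OF \<xi> bl rep(2)[OF Y]]
      by (simp add: \<phi>' rep(3) X Y distrib_left)
    show "Lp_char p \<xi> \<phi> (alg_mult ?B X Y) = Lp_char p \<xi> \<phi> X * Lp_char p \<xi> \<phi> Y"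
    proof -
      obtain f' g' where f': "f' \<in> Lp_functions \<mu> p" "f' \<in> borel_measurable baire" "AE x in \<mu>. class_rep X x = f' x"
        and g': "g' \<in> Lp_functions \<mu> p" "g' \<in> borel_measurable baire" "AE x in \<mu>. class_rep Y x = g' x"
        and c: "convolution \<mu> (class_rep X) (class_rep Y) = convolution \<mu> f' g'"
        using convolution_rep[OF p rep(1)[OF X] rep(1)[OF Y]] .
      have eq: "X = ae_class \<mu> f'" "Y = ae_class \<mu> g'"
        using Lp_carrierE(2)[OF X] ae_class_cong[OF f'(3)] Lp_carrierE(2)[OF Y] ae_class_cong[OF g'(3)] by auto
      have "Lp_char p \<xi> \<phi> (alg_mult ?B X Y) = (\<integral>x. \<xi> x * \<phi> (convolution \<mu> f' g' x) \<partial>\<mu>)"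
        unfolding Lp_algebra_simps c by (rule Lp_char_eq[OF \<xi> \<phi> Lp_functions_convolution_baire[OF p f'(1,2) g'(1,2)]])
      also have "\<dots> = (\<integral>x. \<xi> x * \<phi> (f' x) \<partial>\<mu>) * (\<integral>x. \<xi> x * \<phi> (g' x) \<partial>\<mu>)"
        by (rule char_convolution[OF \<xi> \<phi> Lp_integrable[OF p f'(1)] f'(2) Lp_integrable[OF p g'(1)] g'(2)])
      also have "\<dots> = Lp_char p \<xi> \<phi> X * Lp_char p \<xi> \<phi> Y"
        unfolding eq using Lp_char_eq[OF \<xi> \<phi> f'(1)] Lp_char_eq[OF \<xi> \<phi> g'(1)] by simp
      finally show ?thesis .
    qed
  next
    fix c and X :: "('g \<Rightarrow> 'a) set" assume X: "X \<in> alg_carrier ?B"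
    have "(\<lambda>x. \<xi> x * \<phi> (scaleC c (class_rep X x))) = (\<lambda>x. c * (\<xi> x * \<phi> (class_rep X x)))"
      by (simp add: \<phi>' mult.left_commute)
    then show "Lp_char p \<xi> \<phi> (alg_scale ?B c X) = c * Lp_char p \<xi> \<phi> X"
      unfolding Lp_algebra_simps using Lp_char_eq[OF \<xi> \<phi> Lp_functions_scaleC[OF rep(1)[OF X]], of c]
      by (simp add: rep(3) X)
  next
    let ?g = "\<lambda>x. scaleC (cnj (\<xi> x)) (1::'a)"
    have g: "?g \<in> Lp_functions \<mu> p" by (rule Lp_const_char[OF cnj_group_chars[OF \<xi>]])
    have "Lp_char p \<xi> \<phi> (ae_class \<mu> ?g) = 1"
      using Lp_char_eq[OF \<xi> \<phi> g] by (simp add: \<phi>' group_charsD(6)[OF \<xi>])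
    then show "\<exists>X\<in>alg_carrier ?B. Lp_char p \<xi> \<phi> X \<noteq> 0"
      using Lp_carrierI[OF g] by (intro bexI[of _ "ae_class \<mu> ?g"]) auto
  qed
qed

lemma one_BSE_function:
  fixes B :: "('g \<Rightarrow> 'a::{complex_normed_algebra,banach,second_countable_topology}) set normed_alg"
  assumes p: "1 < p" and B: "B = Lp_algebra \<mu> p" and BSE: "BSE_algebra B"
  shows "(\<lambda>\<Phi>\<in>\<Delta> B. 1) \<in> BSE_functions B"
proof -
  let ?T = "\<lambda>X\<in>alg_carrier B. X"
  have "?T \<in> multipliers B"
    unfolding multipliers_def B by (auto simp: Lp_closed[OF p] Lp_scale_closed intro!: exI[of _ 1])
  moreover have "multiplier_transform B ?T = (\<lambda>\<Phi>\<in>\<Delta> B. 1)"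
  proof (rule multiplier_transform_eq)
    have sub: "topspace (character_topology B) \<subseteq> \<Delta> B" by (simp add: character_topology_def)
    have "continuous_map (character_topology B) euclidean (\<lambda>_. 1::complex)" by simp
    then have "continuous_map (character_topology B) euclidean (\<lambda>\<Phi>\<in>\<Delta> B. 1::complex)"
      by (rule continuous_map_eq) (use subsetD[OF sub] in simp)
    moreover have "bounded ((\<lambda>\<Phi>\<in>\<Delta> B. 1::complex) ` \<Delta> B)" by (auto simp: bounded_iff)
    ultimately show "(\<lambda>\<Phi>\<in>\<Delta> B. 1) \<in> Cb_characters B" by (simp add: Cb_characters_def)
  qed simp
  ultimately show ?thesis using BSE unfolding BSE_algebra_def by force
qed

text \<open>The constant \<open>1\<close> is tested against the mean \<open>P\<close> of \<open>N\<close> distinct group characters. By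
  orthogonality \<open>\<integral> cmod P \<le> 1 / sqrt N\<close>, and splitting at \<open>norm (f x) = R\<close> bounds the pairing of \<open>P\<close>
  with the unit ball of \<open>L\<^sup>p\<close> by \<open>R / sqrt N + R powr (1 - p)\<close>. For large \<open>R\<close> and \<open>N\<close> this is too small
  for the BSE inequality.\<close>

lemma char_mean_pairing_le:
  fixes \<phi> :: "'a::{complex_normed_algebra,comm_ring_1,banach,second_countable_topology} \<Rightarrow> complex"
  assumes p: "1 < p" and \<phi>: "\<phi> \<in> \<Delta> (type_algebra TYPE('a))"
    and \<xi>: "\<And>k. k \<in> {1..N} \<Longrightarrow> \<xi> k \<in> group_chars" and inj: "inj_on \<xi> {1..N}" and N: "N > 0" and R: "R > 0"
    and f: "f \<in> Lp_functions \<mu> p" "Lp_norm \<mu> p f \<le> 1"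
  shows "cmod (\<Sum>k=1..N. (1 / of_nat N) * (\<integral>x. \<xi> k x * \<phi> (f x) \<partial>\<mu>)) \<le> R / sqrt (real N) + R powr (1 - p)"
proof -
  have bl: "bounded_linear \<phi>" by (rule type_character_bounded_linear[OF \<phi>])
  have if1: "integrable \<mu> f" by (rule Lp_integrable[OF p f(1)])
  have ifp: "integrable \<mu> (\<lambda>x. norm (f x) powr p)" using f(1) by (simp add: Lp_functions_iff)
  define P where "P x = (\<Sum>k=1..N. (1 / of_nat N) * \<xi> k x)" for x
  have c\<xi>: "continuous_on UNIV (\<xi> k)" if "k \<in> {1..N}" for k by (rule group_charsD(1)[OF \<xi>[OF that]])
  have cP: "continuous_on UNIV P" unfolding P_def[abs_def] by (intro continuous_intros c\<xi>)
  have P1: "cmod (P x) \<le> 1" for x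
  proof -
    have "cmod (P x) \<le> (\<Sum>k=1..N. 1 / real N)"
      unfolding P_def by (rule sum_norm_le) (simp add: norm_mult norm_divide group_charsD(3)[OF \<xi>])
    then show ?thesis using N by simp
  qed
  have P2: "sqn P = 1 / real N"
  proof -
    have "complex_of_real (sqn P) = (\<integral>x. P x * cnj (P x) \<partial>\<mu>)" using autocorr_0[of P] by (simp add: autocorr_def)
    also have "\<dots> = (\<integral>x. (\<Sum>j=1..N. \<Sum>k=1..N. (1 / of_nat N)\<^sup>2 * (\<xi> j x * cnj (\<xi> k x))) \<partial>\<mu>)"
      by (simp add: P_def sum_product power2_eq_square algebra_simps)
    also have "\<dots> = (\<Sum>j=1..N. \<Sum>k=1..N. (1 / of_nat N)\<^sup>2 * (\<integral>x. \<xi> j x * cnj (\<xi> k x) \<partial>\<mu>))"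
    proof -
      have i: "integrable \<mu> (\<lambda>x. (1 / of_nat N)\<^sup>2 * (\<xi> j x * cnj (\<xi> k x)))" if "j \<in> {1..N}" "k \<in> {1..N}" for j k
        by (intro integrable_continuous continuous_intros c\<xi> that)
      then show ?thesis
        by (subst Bochner_Integration.integral_sum, intro Bochner_Integration.integrable_sum, simp)
          (intro sum.cong refl, subst Bochner_Integration.integral_sum, simp, simp only: integral_mult_right_zero)
    qed
    also have "\<dots> = (\<Sum>j=1..N. \<Sum>k=1..N. if j = k then (1 / of_nat N)\<^sup>2 else 0)"
    proof (intro sum.cong refl)
      fix j k assume jk: "j \<in> {1..N}" "k \<in> {1..N}"
      then have "\<xi> j = \<xi> k \<longleftrightarrow> j = k" using inj by (auto dest: inj_onD)
      then show "(1 / of_nat N)\<^sup>2 * (\<integral>x. \<xi> j x * cnj (\<xi> k x) \<partial>\<mu>) = (if j = k then (1 / of_nat N)\<^sup>2 else 0)"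
        using char_orthogonal[OF \<xi>[OF jk(1)] \<xi>[OF jk(2)]] by simp
    qed
    also have "\<dots> = complex_of_real (1 / real N)" using N by (simp add: power2_eq_square)
    finally show ?thesis using of_real_eq_iff by blast
  qed
  have P3: "(\<integral>x. cmod (P x) \<partial>\<mu>) \<le> 1 / sqrt (real N)"
  proof -
    let ?d = "1 / sqrt (real N)"
    have d: "?d > 0" using N by simp
    \<comment> \<open>Cauchy-Schwarz in the form \<open>t \<le> d / 2 + t\<^sup>2 / (2 * d)\<close>;
      with \<open>d = 1 / sqrt N\<close> both terms integrate to \<open>d / 2\<close>, because
      \<open>sqn P = 1 / N\<close>.\<close>
    have "(\<integral>x. cmod (P x) \<partial>\<mu>) \<le> (\<integral>x. ?d / 2 + (1 / (2 * ?d)) * (cmod (P x))\<^sup>2 \<partial>\<mu>)"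
    proof (rule integral_mono)
      fix x
      have "0 \<le> (cmod (P x) - ?d)\<^sup>2" by simp
      then have "2 * ?d * cmod (P x) \<le> ?d\<^sup>2 + (cmod (P x))\<^sup>2" by (simp add: power2_eq_square algebra_simps)
      then have "(2 * ?d * cmod (P x)) / (2 * ?d) \<le> (?d\<^sup>2 + (cmod (P x))\<^sup>2) / (2 * ?d)"
        using d by (intro divide_right_mono) auto
      also have "\<dots> = ?d / 2 + (1 / (2 * ?d)) * (cmod (P x))\<^sup>2"
        using d by (simp add: power2_eq_square field_simps)
      finally show "cmod (P x) \<le> ?d / 2 + (1 / (2 * ?d)) * (cmod (P x))\<^sup>2" using d by simp
    qed (intro integrable_continuous continuous_intros cP)+
    also have "\<dots> = ?d / 2 + (1 / (2 * ?d)) * sqn P"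
      unfolding sqn_def by (subst Bochner_Integration.integral_add)
        (intro integrable_continuous continuous_intros cP | simp)+
    also have "\<dots> = ?d" using N by (simp add: P2 field_simps real_sqrt_mult_self flip: real_sqrt_mult)
    finally show ?thesis .
  qed
  have Ip: "(\<integral>x. norm (f x) powr p \<partial>\<mu>) \<le> 1"
  proof (rule ccontr)
    assume "\<not> ?thesis"
    then have "1 < (\<integral>x. norm (f x) powr p \<partial>\<mu>) powr (1 / p)" using p by (simp add: gr_one_powr)
    then show False using f(2) by (simp add: Lp_norm_def)
  qed
  have i\<phi>: "integrable \<mu> (\<lambda>x. \<xi> k x * \<phi> (f x))" if "k \<in> {1..N}" for k
    by (rule integrable_char_times[OF \<xi>[OF that] bl if1])
  have sum_eq: "(\<Sum>k=1..N. (1 / of_nat N) * (\<integral>x. \<xi> k x * \<phi> (f x) \<partial>\<mu>)) = (\<integral>x. P x * \<phi> (f x) \<partial>\<mu>)"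
  proof -
    have "(\<Sum>k=1..N. (1 / of_nat N) * (\<integral>x. \<xi> k x * \<phi> (f x) \<partial>\<mu>)) =
        (\<Sum>k=1..N. \<integral>x. (1 / of_nat N) * (\<xi> k x * \<phi> (f x)) \<partial>\<mu>)" by simp
    also have "\<dots> = (\<integral>x. (\<Sum>k=1..N. (1 / of_nat N) * (\<xi> k x * \<phi> (f x))) \<partial>\<mu>)"
      by (rule Bochner_Integration.integral_sum[symmetric]) (intro integrable_mult_right i\<phi>)
    also have "\<dots> = (\<integral>x. P x * \<phi> (f x) \<partial>\<mu>)" by (simp add: P_def sum_distrib_right mult.assoc)
    finally show ?thesis .
  qed
  have "cmod (\<integral>x. P x * \<phi> (f x) \<partial>\<mu>) \<le> (\<integral>x. R * cmod (P x) + R powr (1 - p) * norm (f x) powr p \<partial>\<mu>)"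
  proof (rule norm_integral_le)
    show "integrable \<mu> (\<lambda>x. R * cmod (P x) + R powr (1 - p) * norm (f x) powr p)"
      using ifp by (intro Bochner_Integration.integrable_add integrable_mult_right)
        (intro integrable_continuous continuous_intros cP)
    show "norm (P x * \<phi> (f x)) \<le> R * cmod (P x) + R powr (1 - p) * norm (f x) powr p" for x
    proof -
      have le: "norm (P x * \<phi> (f x)) \<le> cmod (P x) * norm (f x)"
        using type_character_norm_le[OF \<phi>, of "f x"] by (simp add: norm_mult mult_left_mono)
      show ?thesis
      proof (cases "norm (f x) \<le> R")
        case True
        then have "cmod (P x) * norm (f x) \<le> cmod (P x) * R" by (intro mult_left_mono) auto
        then show ?thesis using le by (simp add: mult.commute add_increasing2)
      next
        case False
        \<comment> \<open>Beyond \<open>R\<close> the negative exponent \<open>1 - p\<close> makes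
          the first factor at most \<open>R powr (1 - p)\<close>, which trades
          \<open>norm (f x)\<close> for its p-th power.\<close>
        then have "norm (f x) = norm (f x) powr (1 - p) * norm (f x) powr p"
          using R by (simp flip: powr_add)
        also have "\<dots> \<le> R powr (1 - p) * norm (f x) powr p"
          using False R p by (intro mult_right_mono powr_mono2') auto
        finally have 1: "norm (f x) \<le> R powr (1 - p) * norm (f x) powr p" .
        have "cmod (P x) * norm (f x) \<le> 1 * norm (f x)" by (intro mult_right_mono P1) simp
        moreover have "0 \<le> R * cmod (P x)" using R by simp
        ultimately show ?thesis using le 1 by linarith
      qed
    qed
  qed
  also have "\<dots> = R * (\<integral>x. cmod (P x) \<partial>\<mu>) + R powr (1 - p) * (\<integral>x. norm (f x) powr p \<partial>\<mu>)"
    using ifp integrable_norm[OF integrable_continuous[OF cP]] by simp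
  also have "\<dots> \<le> R * (1 / sqrt (real N)) + R powr (1 - p) * 1"
    using R by (intro add_mono mult_left_mono P3 Ip) auto
  finally show ?thesis unfolding sum_eq by simp
qed

lemma BSE_imp_finite_group_chars:
  fixes B :: "('g \<Rightarrow> 'a::{complex_normed_algebra,comm_ring_1,banach,second_countable_topology}) set normed_alg"
  assumes p: "1 < p" and B: "B = Lp_algebra \<mu> p" and BSE: "BSE_algebra B"
    and \<phi>: "\<phi> \<in> \<Delta> (type_algebra TYPE('a))"
  shows "finite (group_chars :: ('g \<Rightarrow> complex) set)"
proof -
  obtain \<beta> where \<beta>: "\<beta> > 0" and le: "\<And>(n::nat) (\<alpha>::nat \<Rightarrow> complex) \<Phi>. (\<And>k. k \<in> {1..n} \<Longrightarrow> \<Phi> k \<in> \<Delta> B) \<Longrightarrow>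
       cmod (\<Sum>k=1..n. \<alpha> k * (\<lambda>\<Phi>\<in>\<Delta> B. 1) (\<Phi> k))
         \<le> \<beta> * dual_norm B (\<lambda>b\<in>alg_carrier B. \<Sum>k=1..n. \<alpha> k * \<Phi> k b)"
    using one_BSE_function[OF p B BSE] unfolding BSE_functions_def by blast
  \<comment> \<open>Chosen so that \<open>\<beta> * R powr (1 - p)\<close> is exactly
    \<open>1 / 4\<close>; the tail term then cannot account for the value 1.\<close>
  define R where "R = (4 * \<beta>) powr (1 / (p - 1))"
  have R: "R > 0" using \<beta> by (simp add: R_def)
  have "(1 - p) / (p - 1) = - 1" using p by (simp add: field_simps)
  then have "R powr (1 - p) = (4 * \<beta>) powr (- 1)" by (simp add: R_def powr_powr)
  then have Rp: "\<beta> * R powr (1 - p) = 1 / 4" using \<beta> by (simp add: powr_minus_divide)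
  have "card Y \<le> nat \<lceil>(2 * \<beta> * R)\<^sup>2\<rceil>" if Y: "finite Y" "Y \<subseteq> group_chars" for Y :: "('g \<Rightarrow> complex) set"
  proof (cases "card Y = 0")
    case False
    define N where "N = card Y"
    have N: "N > 0" using False by (simp add: N_def)
    obtain \<xi> where bij: "bij_betw \<xi> {1..N} Y"
      using ex_bij_betw_nat_finite_1[OF Y(1)] by (auto simp: N_def)
    have \<xi>: "\<And>k. k \<in> {1..N} \<Longrightarrow> \<xi> k \<in> group_chars" using bij Y(2) by (auto simp: bij_betw_def)
    have inj: "inj_on \<xi> {1..N}" using bij by (simp add: bij_betw_def)
    have \<Phi>: "Lp_char p (\<xi> k) \<phi> \<in> \<Delta> B" if "k \<in> {1..N}" for k
      unfolding B by (rule Lp_char_character[OF p \<xi>[OF that] \<phi>])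
    let ?D = "dual_norm B (\<lambda>b\<in>alg_carrier B. \<Sum>k=1..N. (1 / of_nat N) * Lp_char p (\<xi> k) \<phi> b)"
    have "(\<Sum>k=1..N. (1 / of_nat N) * (\<lambda>\<Phi>\<in>\<Delta> B. 1 :: complex) (Lp_char p (\<xi> k) \<phi>)) = (\<Sum>k=1..N. 1 / of_nat N)"
      by (rule sum.cong) (use \<Phi> in auto)
    also have "\<dots> = 1" using N by simp
    finally have 1: "1 \<le> \<beta> * ?D" using le[of N "\<lambda>k. Lp_char p (\<xi> k) \<phi>" "\<lambda>_. 1 / of_nat N"] \<Phi> by simp
    have "?D \<le> R / sqrt (real N) + R powr (1 - p)"
    proof (rule dual_norm_le)
      have z: "(\<lambda>_. 0) \<in> Lp_functions \<mu> p" by (simp add: Lp_functions_iff)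
      then show "ae_class \<mu> (\<lambda>_. 0) \<in> alg_carrier B" unfolding B by (rule Lp_carrierI)
      note r = class_rep_AE[OF Lp_functions_measurable[OF z]]
      have "(\<integral>x. norm (class_rep (ae_class \<mu> (\<lambda>_. 0::'a)) x) powr p \<partial>\<mu>) = (\<integral>x. 0 \<partial>\<mu>)"
      proof (rule integral_cong_AE)
        have [measurable]: "class_rep (ae_class \<mu> (\<lambda>_. 0::'a)) \<in> borel_measurable \<mu>" by (rule r(1))
        show "(\<lambda>x. norm (class_rep (ae_class \<mu> (\<lambda>_. 0::'a)) x) powr p) \<in> borel_measurable \<mu>" by measurable
        show "AE x in \<mu>. norm (class_rep (ae_class \<mu> (\<lambda>_. 0::'a)) x) powr p = 0"
          using r(2) by eventually_elim simp
      qed simp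
      then show "alg_norm B (ae_class \<mu> (\<lambda>_. 0)) \<le> 1"
        unfolding B Lp_algebra_simps Lp_norm_def by simp
      fix X assume X: "X \<in> alg_carrier B" "alg_norm B X \<le> 1"
      have r: "class_rep X \<in> Lp_functions \<mu> p" "Lp_norm \<mu> p (class_rep X) \<le> 1"
        using X unfolding B by (simp_all add: Lp_carrierE Lp_algebra_simps)
      show "cmod ((\<lambda>b\<in>alg_carrier B. \<Sum>k=1..N. (1 / of_nat N) * Lp_char p (\<xi> k) \<phi> b) X)
          \<le> R / sqrt (real N) + R powr (1 - p)"
        using char_mean_pairing_le[OF p \<phi> \<xi> inj N R r] X(1) by (simp add: Lp_char_def B)
    qed
    then have "1 \<le> \<beta> * (R / sqrt (real N)) + \<beta> * R powr (1 - p)"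
      using 1 \<beta> mult_left_mono[of ?D "R / sqrt (real N) + R powr (1 - p)" \<beta>] by (simp add: distrib_left)
    \<comment> \<open>At least \<open>3 / 4\<close> is left for this term; \<open>1 / 2\<close>
      gives the simpler bound \<open>(2 * \<beta> * R)\<^sup>2\<close> for \<open>N\<close>.\<close>
    then have "1 / 2 \<le> \<beta> * (R / sqrt (real N))" using Rp by simp
    then have "sqrt (real N) \<le> 2 * \<beta> * R" using N by (simp add: field_simps)
    then have "(sqrt (real N))\<^sup>2 \<le> (2 * \<beta> * R)\<^sup>2" by (intro power_mono) auto
    then show ?thesis unfolding N_def[symmetric] by simp linarith
  qed simp
  then show ?thesis using finite_if_finite_subsets_card_bdd[of group_chars "nat \<lceil>(2 * \<beta> * R)\<^sup>2\<rceil>"] by blast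
qed

end


section \<open>Finite groups\<close>

locale finite_haar = compact_haar \<mu> for \<mu> :: "'g::{topological_ab_group_add,t2_space} measure" +
  assumes fin: "finite (UNIV :: 'g set)"
begin

lemma open_any: "open (S :: 'g set)"
proof -
  have "closed (- S)" by (rule finite_imp_closed) (rule finite_subset[OF subset_UNIV fin])
  then show ?thesis by (simp add: closed_def)
qed

lemma sets_borel_any: "S \<in> sets (borel :: 'g measure)"
  using open_any[of S] by simp

lemma borel_any: "(f :: 'g \<Rightarrow> 'b::topological_space) \<in> borel_measurable borel"
  by (rule measurableI) (auto intro: sets_borel_any)

lemma continuous_any: "continuous_on (UNIV :: 'g set) (f :: 'g \<Rightarrow> 'b::topological_space)"
  by (simp add: continuous_on_open_vimage open_any)

definition n :: real where "n = real (card (UNIV :: 'g set))"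

lemma n_pos: "n > 0"
  unfolding n_def using fin by (simp add: card_gt_0_iff)

lemma measure_singleton: "measure \<mu> {x} = 1 / n"
proof -
  have eq: "measure \<mu> {x} = measure \<mu> {0}" for x
    using translate[of "{0}" x] by (simp add: measure_def)
  have "1 = (\<Sum>x\<in>UNIV. measure \<mu> {x})"
    using finite_measure_eq_sum_singleton[of UNIV] fin by simp
  also have "\<dots> = n * measure \<mu> {0}" unfolding n_def by (subst eq) simp
  finally show ?thesis using n_pos eq[of x] by (simp add: field_simps)
qed

lemma AE_all: "(AE x in \<mu>. P x) \<longleftrightarrow> (\<forall>x. P x)"
proof
  assume "AE x in \<mu>. P x"
  then obtain N where N: "N \<in> null_sets \<mu>" "{x \<in> space \<mu>. \<not> P x} \<subseteq> N" by (auto simp: eventually_ae_filter)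
  have "N = {}"
  proof (rule ccontr)
    assume "N \<noteq> {}"
    then obtain x where "x \<in> N" by blast
    then have "measure \<mu> {x} \<le> measure \<mu> N" by (intro finite_measure_mono) (auto simp: sets_borel_any)
    also have "\<dots> = 0" using N(1) by (auto simp: measure_def)
    finally show False using measure_singleton[of x] n_pos by (simp add: divide_le_0_iff)
  qed
  then show "\<forall>x. P x" using N(2) by auto
qed simp

lemma integral_eq:
  fixes f :: "'g \<Rightarrow> 'b::{banach,second_countable_topology}"
  shows "(\<integral>x. f x \<partial>\<mu>) = (1 / n) *\<^sub>R (\<Sum>x\<in>UNIV. f x)"
proof -
  have f: "f x = (\<Sum>z\<in>UNIV. indicator {z} x *\<^sub>R f z)" for x
  proof -
    have "(\<Sum>z\<in>UNIV. indicator {z} x *\<^sub>R f z) = (\<Sum>z\<in>UNIV. if z = x then f z else 0)"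
      by (rule sum.cong) (auto simp: indicator_def)
    then show ?thesis using fin by simp
  qed
  have i: "integrable \<mu> (indicat_real {z})" for z
    by (rule integrable_continuous) (rule continuous_any)
  have "(\<integral>x. f x \<partial>\<mu>) = (\<integral>x. (\<Sum>z\<in>UNIV. indicator {z} x *\<^sub>R f z) \<partial>\<mu>)"
    by (rule Bochner_Integration.integral_cong[OF refl f])
  also have "\<dots> = (\<Sum>z\<in>UNIV. (\<integral>x. indicator {z} x \<partial>\<mu>) *\<^sub>R f z)"
    using i by (subst Bochner_Integration.integral_sum) auto
  also have "\<dots> = (1 / n) *\<^sub>R (\<Sum>x\<in>UNIV. f x)"
    by (simp add: measure_singleton sets_borel_any scaleR_sum_right)
  finally show ?thesis .
qed

text \<open>Every point has mass \<open>1 / n\<close>, so only the empty set is null and every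
  function is measurable. From here on the elements of the algebra are just singletons of
  functions.\<close>

lemma ae_class_finite [simp]: "ae_class \<mu> f = {f}"
  by (auto simp: ae_class_def AE_all borel_any)

lemma class_rep_singleton [simp]: "class_rep {f} = f"
  by (simp add: class_rep_def)

lemma Lp_functions_finite [simp]:
  "Lp_functions \<mu> p = (UNIV :: ('g \<Rightarrow> 'b::{banach,second_countable_topology}) set)"
proof -
  have "integrable \<mu> (\<lambda>x. norm (f x) powr p)" for f :: "'g \<Rightarrow> 'b"
    by (rule integrable_continuous) (rule continuous_any)
  then show ?thesis by (auto simp: Lp_functions_iff borel_any)
qed

lemma Lp_carrier_finite: "alg_carrier (Lp_algebra \<mu> p) = range (\<lambda>f. {f})"
  by (simp add: Lp_algebra_def)

lemma convolution_eq: "convolution \<mu> f g x = (1 / n) *\<^sub>R (\<Sum>y\<in>UNIV. f y * g (- y + x))"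
  by (simp add: convolution_def integral_eq)

lemma sum_translate: "(\<Sum>y\<in>UNIV. h (a + y)) = (\<Sum>y\<in>UNIV. h (y :: 'g))"
  by (rule sum.reindex_bij_witness[of _ "\<lambda>y. - a + y" "\<lambda>y. a + y"]) auto

lemma convolution_assoc:
  fixes a b f :: "'g \<Rightarrow> 'a::{real_normed_algebra,banach,second_countable_topology}"
  shows "convolution \<mu> (convolution \<mu> a b) f = convolution \<mu> a (convolution \<mu> b f)"
proof
  fix x
  have "(\<Sum>y\<in>UNIV. b (- z + y) * f (- y + x)) = (\<Sum>y\<in>UNIV. b y * f (- y + (- z + x)))" for z
    using sum_translate[of "\<lambda>y. b (- z + y) * f (- y + x)" z] by (simp add: algebra_simps)
  then have *: "(\<Sum>y\<in>UNIV. a z * (b (- z + y) * f (- y + x))) = a z * (\<Sum>y\<in>UNIV. b y * f (- y + (- z + x)))" for z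
    by (simp flip: sum_distrib_left)
  have "convolution \<mu> (convolution \<mu> a b) f x
      = (1 / n) *\<^sub>R (1 / n) *\<^sub>R (\<Sum>y\<in>UNIV. \<Sum>z\<in>UNIV. a z * (b (- z + y) * f (- y + x)))"
    by (simp add: convolution_eq sum_distrib_right scaleR_sum_right mult.assoc)
  also have "\<dots> = (1 / n) *\<^sub>R (1 / n) *\<^sub>R (\<Sum>z\<in>UNIV. \<Sum>y\<in>UNIV. a z * (b (- z + y) * f (- y + x)))"
    by (subst sum.swap) simp
  also have "\<dots> = convolution \<mu> a (convolution \<mu> b f) x"
    unfolding * by (simp add: convolution_eq flip: scaleR_sum_right)
  finally show "convolution \<mu> (convolution \<mu> a b) f x = convolution \<mu> a (convolution \<mu> b f) x" .
qed

text \<open>The density of the \<open>a\<close>-valued point mass at \<open>x\<close> with respect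
  to normalised counting measure; the factor \<open>n\<close> makes convolution multiply masses
  without a constant.\<close>

definition point :: "'g \<Rightarrow> 'a::real_normed_algebra \<Rightarrow> 'g \<Rightarrow> 'a" where
  "point x a z = (if z = x then n *\<^sub>R a else 0)"

lemma convolution_point_left:
  fixes a :: "'a::{real_normed_algebra,banach,second_countable_topology}"
  shows "convolution \<mu> (point x a) f z = a * f (- x + z)"
proof -
  have "(\<Sum>y\<in>UNIV. point x a y * f (- y + z)) = (\<Sum>y\<in>UNIV. if y = x then n *\<^sub>R (a * f (- y + z)) else 0)"
    by (rule sum.cong) (auto simp: point_def)
  then show ?thesis using fin n_pos by (simp add: convolution_eq)
qed

lemma convolution_point_point:
  fixes a :: "'a::{real_normed_algebra,banach,second_countable_topology}"
  shows "convolution \<mu> (point x a) (point y b) = point (x + y) (a * b)"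
proof
  fix z
  have "- x + z = y \<longleftrightarrow> z = x + y" by (auto simp: algebra_simps)
  then show "convolution \<mu> (point x a) (point y b) z = point (x + y) (a * b) z"
    by (simp add: convolution_point_left point_def)
qed

lemma convolution_unit:
  fixes f :: "'g \<Rightarrow> 'a::{real_normed_algebra,comm_ring_1,banach,second_countable_topology}"
  shows "convolution \<mu> f (point 0 1) = f"
proof
  fix x :: 'g
  have "- y + x = 0 \<longleftrightarrow> y = x" for y by (auto simp: add_eq_0_iff)
  then have "(\<Sum>y\<in>UNIV. f y * point 0 1 (- y + x)) = (\<Sum>y\<in>UNIV. if y = x then n *\<^sub>R f y else 0)"
    by (intro sum.cong) (auto simp: point_def)
  then show "convolution \<mu> f (point 0 1) x = f x" using fin n_pos by (simp add: convolution_eq)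
qed

lemma function_eq_sum_points:
  fixes f :: "'g \<Rightarrow> 'a::real_normed_algebra"
  shows "f = (\<lambda>z. (1 / n) *\<^sub>R (\<Sum>x\<in>UNIV. point x (f x) z))"
proof
  fix z
  have "(\<Sum>x\<in>UNIV. point x (f x) z) = (\<Sum>x\<in>UNIV. if x = z then n *\<^sub>R f x else 0)"
    by (rule sum.cong) (auto simp: point_def)
  then show "f z = (1 / n) *\<^sub>R (\<Sum>x\<in>UNIV. point x (f x) z)" using fin n_pos by simp
qed

context
  fixes p :: real assumes p: "1 < p"
begin

lemma Lp_norm_scale:
  fixes f :: "'g \<Rightarrow> 'a::{complex_normed_algebra,banach,second_countable_topology}"
  shows "Lp_norm \<mu> p (\<lambda>x. scaleC c (f x)) = cmod c * Lp_norm \<mu> p f"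
proof -
  have "(\<integral>x. norm (scaleC c (f x)) powr p \<partial>\<mu>) = cmod c powr p * (\<integral>x. norm (f x) powr p \<partial>\<mu>)"
    by (simp add: norm_scaleC powr_mult)
  then show ?thesis
    unfolding Lp_norm_def using p
    by (simp add: powr_mult powr_powr Bochner_Integration.integral_nonneg)
qed

lemma Lp_norm_nonneg: "0 \<le> Lp_norm \<mu> p f" by (simp add: Lp_norm_def)

lemma norm_le_Lp_norm: "norm (f x) \<le> n powr (1 / p) * Lp_norm \<mu> p f"
proof -
  have "norm (f x) powr p \<le> (\<Sum>x\<in>UNIV. norm (f x) powr p)" by (rule member_le_sum) (use fin in auto)
  then have "norm (f x) powr p \<le> n * (\<integral>x. norm (f x) powr p \<partial>\<mu>)" using n_pos by (simp add: integral_eq)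
  then have "(norm (f x) powr p) powr (1 / p) \<le> (n * (\<integral>x. norm (f x) powr p \<partial>\<mu>)) powr (1 / p)"
    using p by (intro powr_mono2) auto
  then show ?thesis
    unfolding Lp_norm_def using p n_pos
    by (simp add: powr_mult powr_powr Bochner_Integration.integral_nonneg)
qed

lemma Lp_norm_le_sum: "Lp_norm \<mu> p f \<le> (\<Sum>x\<in>UNIV. norm (f x))"
proof -
  let ?S = "\<Sum>x\<in>UNIV. norm (f x)"
  have S: "0 \<le> ?S" by (simp add: sum_nonneg)
  have "(\<integral>x. norm (f x) powr p \<partial>\<mu>) \<le> (\<integral>x. ?S powr p \<partial>\<mu>)"
  proof (rule integral_mono)
    fix x
    have "norm (f x) \<le> ?S" by (rule member_le_sum) (use fin in auto)
    then show "norm (f x) powr p \<le> ?S powr p" using p by (intro powr_mono2) auto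
  qed (intro integrable_continuous continuous_any)+
  then have "(\<integral>x. norm (f x) powr p \<partial>\<mu>) powr (1 / p) \<le> (?S powr p) powr (1 / p)"
    using p by (intro powr_mono2) (auto intro: Bochner_Integration.integral_nonneg)
  then show ?thesis using p S by (simp add: Lp_norm_def powr_powr)
qed

text \<open>The Fourier coefficient of \<open>f\<close> with values in the coefficient algebra. It
  factors \<open>Lp_char p \<xi> \<phi>\<close> through \<open>\<phi>\<close>, so that estimates can
  be made in that algebra uniformly over combinations of characters.\<close>

definition avg :: "('g \<Rightarrow> complex) \<Rightarrow> ('g \<Rightarrow> 'a::complex_normed_algebra) \<Rightarrow> 'a" where
  "avg \<xi> f = (1 / n) *\<^sub>R (\<Sum>x\<in>UNIV. scaleC (\<xi> x) (f x))"

lemma norm_avg_le: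
  assumes "\<xi> \<in> group_chars" shows "norm (avg \<xi> f) \<le> n powr (1 / p) * Lp_norm \<mu> p f"
proof -
  have "norm (\<Sum>x\<in>UNIV. scaleC (\<xi> x) (f x)) \<le> (\<Sum>x\<in>(UNIV :: 'g set). n powr (1 / p) * Lp_norm \<mu> p f)"
    by (rule sum_norm_le) (simp add: norm_scaleC group_charsD(3)[OF assms] norm_le_Lp_norm)
  also have "\<dots> = n * (n powr (1 / p) * Lp_norm \<mu> p f)" by (simp add: n_def)
  finally show ?thesis unfolding avg_def using n_pos by (simp add: field_simps)
qed

lemma Lp_char_avg:
  fixes \<phi> :: "'a::{complex_normed_algebra,comm_ring_1,banach,second_countable_topology} \<Rightarrow> complex"
  assumes \<phi>: "\<phi> \<in> \<Delta> (type_algebra TYPE('a))"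
  shows "Lp_char p \<xi> \<phi> {f} = \<phi> (avg \<xi> f)"
proof -
  interpret bounded_linear \<phi> by (rule type_character_bounded_linear[OF \<phi>])
  have "\<phi> (scaleC c a) = c * \<phi> a" for c a using \<phi> by (simp add: type_characters_iff)
  then show ?thesis
    by (simp add: Lp_char_def Lp_carrier_finite avg_def integral_eq scaleR sum)
qed

text \<open>Since \<open>point x a\<close> is the convolution of \<open>point x 1\<close> and
  \<open>point 0 a\<close>, a character is a product \<open>\<xi> x * \<phi> a\<close> on point
  masses, and every function is an average of point masses.\<close>

lemma Lp_characters_finite:
  fixes \<Phi> :: "('g \<Rightarrow> 'a::{complex_normed_algebra,comm_ring_1,banach,second_countable_topology}) set \<Rightarrow> complex"
  assumes \<Phi>: "\<Phi> \<in> \<Delta> (Lp_algebra \<mu> p)"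
  shows "(\<lambda>a. \<Phi> {point 0 a}) \<in> \<Delta> (type_algebra TYPE('a))"
    and "\<exists>\<xi>\<in>group_chars. \<Phi> = Lp_char p \<xi> (\<lambda>a. \<Phi> {point 0 a})"
proof -
  let ?B = "Lp_algebra \<mu> p :: ('g \<Rightarrow> 'a) set normed_alg"
  define F where "F f = \<Phi> {f}" for f
  have c: "{f} \<in> alg_carrier ?B" for f by (simp add: Lp_carrier_finite)
  have F_add: "F (\<lambda>x. f x + g x) = F f + F g" for f g
    using character_add[OF \<Phi> c c, of f g] by (simp add: Lp_algebra_simps F_def)
  have F_scale: "F (\<lambda>x. scaleC k (f x)) = k * F f" for k f
    using character_scale[OF \<Phi> c, of k f] by (simp add: Lp_algebra_simps F_def)
  have F_mult: "F (convolution \<mu> f g) = F f * F g" for f g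
    using character_mult[OF \<Phi> c c, of f g] by (simp add: Lp_algebra_simps F_def)
  have F_zero: "F (\<lambda>x. 0) = 0" using F_scale[of 0 "\<lambda>x. 0"] scaleC_of_real[of 0 "0 :: 'a"] by simp
  have F_sum: "F (\<lambda>z. \<Sum>x\<in>S. h x z) = (\<Sum>x\<in>S. F (h x))" if "finite S" for S :: "'g set" and h
    using that by (induction S rule: finite_induct) (simp_all add: F_zero F_add)
  define \<phi> where "\<phi> a = F (point 0 a)" for a
  define \<xi> where "\<xi> x = F (point x 1)" for x
  have pt: "F (point x a) = \<xi> x * \<phi> a" for x a
    unfolding \<xi>_def \<phi>_def by (simp flip: F_mult add: convolution_point_point)
  have F_eq: "F f = (1 / n) *\<^sub>R (\<Sum>x\<in>UNIV. \<xi> x * \<phi> (f x))" for f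
  proof -
    have "F f = F (\<lambda>z. scaleC (complex_of_real (1 / n)) (\<Sum>x\<in>UNIV. point x (f x) z))"
      unfolding scaleC_of_real by (rule arg_cong[OF function_eq_sum_points])
    also have "\<dots> = (1 / n) *\<^sub>R (\<Sum>x\<in>UNIV. \<xi> x * \<phi> (f x))"
      unfolding F_scale F_sum[OF fin] pt by (simp add: scaleR_conv_of_real)
    finally show ?thesis .
  qed
  have \<phi>mult: "\<phi> (a * b) = \<phi> a * \<phi> b" for a b
    unfolding \<phi>_def by (simp flip: F_mult add: convolution_point_point)
  have \<xi>mult: "\<xi> (x + y) = \<xi> x * \<xi> y" for x y
    unfolding \<xi>_def by (simp flip: F_mult add: convolution_point_point)
  have \<phi>1: "\<phi> 1 = 1"
  proof -
    \<comment> \<open>Otherwise \<open>\<phi>\<close> vanishes identically, and the formula for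
      \<open>F\<close> makes the whole character zero.\<close>
    have "\<phi> 1 \<noteq> 0"
    proof
      assume "\<phi> 1 = 0"
      then have "\<phi> a = 0" for a using \<phi>mult[of a 1] by simp
      then have "F f = 0" for f using F_eq[of f] by simp
      moreover obtain X where "X \<in> alg_carrier ?B" "\<Phi> X \<noteq> 0" using \<Phi> by (auto simp: characters_def)
      ultimately show False by (auto simp: F_def Lp_carrier_finite)
    qed
    then show ?thesis using \<phi>mult[of 1 1] by simp
  qed
  have "\<phi> (a + b) = \<phi> a + \<phi> b" for a b
  proof -
    have "point 0 (a + b) = (\<lambda>z. point 0 a z + point 0 b z)" by (auto simp: point_def scaleR_add_right)
    then show ?thesis by (simp add: \<phi>_def F_add)
  qed
  moreover have "\<phi> (scaleC k a) = k * \<phi> a" for k a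
  proof -
    interpret bounded_linear "scaleC k :: 'a \<Rightarrow> 'a" by (rule bounded_linear_scaleC)
    have "point 0 (scaleC k a) = (\<lambda>z. scaleC k (point 0 a z))" by (auto simp: point_def scaleR)
    then show ?thesis by (simp add: \<phi>_def F_scale)
  qed
  ultimately have \<phi>ch: "\<phi> \<in> \<Delta> (type_algebra TYPE('a))" using \<phi>mult \<phi>1 by (simp add: type_characters_iff)
  then show "(\<lambda>a. \<Phi> {point 0 a}) \<in> \<Delta> (type_algebra TYPE('a))" by (simp add: \<phi>_def[abs_def] F_def)
  have "\<xi> 0 = 1" using \<phi>1 by (simp add: \<xi>_def \<phi>_def)
  \<comment> \<open>A finite set of values is bounded, which is enough for a homomorphism to be
    unimodular.\<close>
  moreover have "cmod (\<xi> x) \<le> (\<Sum>x\<in>UNIV. cmod (\<xi> x))" for x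
    by (rule member_le_sum) (use fin in auto)
  ultimately have "cmod (\<xi> x) = 1" for x by (intro bounded_hom_norm_eq_1[OF \<xi>mult]) auto
  then have \<xi>ch: "\<xi> \<in> group_chars" using \<xi>mult by (simp add: group_chars_def continuous_any)
  have "\<Phi> = Lp_char p \<xi> \<phi>"
  proof (rule extensionalityI)
    show "\<Phi> \<in> extensional (alg_carrier ?B)" using characters_extensional \<Phi> by blast
    show "Lp_char p \<xi> \<phi> \<in> extensional (alg_carrier ?B)" by (simp add: Lp_char_def)
    fix X assume "X \<in> alg_carrier ?B"
    then obtain f where "X = {f}" by (auto simp: Lp_carrier_finite)
    then show "\<Phi> X = Lp_char p \<xi> \<phi> X"
      using F_eq[of f] by (simp add: F_def Lp_char_def Lp_carrier_finite integral_eq)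
  qed
  then show "\<exists>\<xi>\<in>group_chars. \<Phi> = Lp_char p \<xi> (\<lambda>a. \<Phi> {point 0 a})"
    using \<xi>ch unfolding \<phi>_def[abs_def] F_def[symmetric] by blast
qed

text \<open>All constants come from comparing the p-norm with single values: a point has mass
  \<open>1 / n\<close>, so \<open>norm (f x)\<close> is at most \<open>n powr (1 / p)\<close> times
  the p-norm.\<close>

lemma Lp_unital:
  "unital_normed_alg (Lp_algebra \<mu> p ::
      ('g \<Rightarrow> 'a::{complex_normed_algebra,comm_ring_1,banach,second_countable_topology}) set normed_alg)
    {point 0 1} (n powr (1 / p))"
proof
  let ?B = "Lp_algebra \<mu> p :: ('g \<Rightarrow> 'a) set normed_alg"
  let ?C = "alg_carrier ?B"
  show "{point 0 1} \<in> ?C" by (simp add: Lp_carrier_finite)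
  fix X Y Z :: "('g \<Rightarrow> 'a) set" and c :: complex
  assume X: "X \<in> ?C"
  then obtain f where f: "X = {f}" by (auto simp: Lp_carrier_finite)
  show "alg_scale ?B c X \<in> ?C" by (simp add: f Lp_carrier_finite Lp_algebra_simps)
  show "alg_mult ?B X {point 0 1} = X" by (simp add: f Lp_algebra_simps convolution_unit)
  show "alg_norm ?B (alg_scale ?B c X) = cmod c * alg_norm ?B X"
    by (simp add: f Lp_algebra_simps Lp_norm_scale)
  show "0 \<le> alg_norm ?B X" by (simp add: f Lp_algebra_simps Lp_norm_nonneg)
  show "\<exists>L. \<forall>a\<in>?C. alg_norm ?B (alg_mult ?B a X) \<le> L * alg_norm ?B a"
  proof (intro exI ballI)
    fix W assume "W \<in> ?C"
    then obtain g where g: "W = {g}" by (auto simp: Lp_carrier_finite)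
    let ?L = "\<Sum>x\<in>UNIV. (1 / n) * (\<Sum>y\<in>UNIV. n powr (1 / p) * norm (f (- y + x)))"
    have "Lp_norm \<mu> p (convolution \<mu> g f) \<le> (\<Sum>x\<in>UNIV. norm (convolution \<mu> g f x))"
      by (rule Lp_norm_le_sum)
    also have "\<dots> \<le> (\<Sum>x\<in>UNIV. (1 / n) * (\<Sum>y\<in>UNIV. (n powr (1 / p) * Lp_norm \<mu> p g) * norm (f (- y + x))))"
    proof (rule sum_mono)
      fix x
      have "norm (\<Sum>y\<in>UNIV. g y * f (- y + x)) \<le> (\<Sum>y\<in>UNIV. (n powr (1 / p) * Lp_norm \<mu> p g) * norm (f (- y + x)))"
        by (rule sum_norm_le) (intro order_trans[OF norm_mult_ineq] mult_right_mono norm_le_Lp_norm norm_ge_zero)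
      then show "norm (convolution \<mu> g f x) \<le> (1 / n) * (\<Sum>y\<in>UNIV. (n powr (1 / p) * Lp_norm \<mu> p g) * norm (f (- y + x)))"
        using n_pos by (simp add: convolution_eq divide_right_mono)
    qed
    also have "\<dots> = ?L * Lp_norm \<mu> p g"
      by (simp add: sum_distrib_left sum_distrib_right mult_ac)
    finally show "alg_norm ?B (alg_mult ?B W X) \<le> ?L * alg_norm ?B W" by (simp add: f g Lp_algebra_simps)
  qed
  show "cmod (\<Phi> X) \<le> n powr (1 / p) * alg_norm ?B X" if \<Phi>: "\<Phi> \<in> \<Delta> ?B" for \<Phi>
  proof -
    note \<phi> = Lp_characters_finite(1)[OF \<Phi>]
    obtain \<xi> where \<xi>: "\<xi> \<in> group_chars" "\<Phi> = Lp_char p \<xi> (\<lambda>a. \<Phi> {point 0 a})"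
      using Lp_characters_finite(2)[OF \<Phi>] by blast
    have "\<Phi> X = \<Phi> {point 0 (avg \<xi> f)}" using fun_cong[OF \<xi>(2), of X] Lp_char_avg[OF \<phi>, of \<xi> f] by (simp add: f)
    also have "cmod \<dots> \<le> norm (avg \<xi> f)" by (rule type_character_norm_le[OF \<phi>])
    also have "\<dots> \<le> n powr (1 / p) * Lp_norm \<mu> p f" by (rule norm_avg_le[OF \<xi>(1)])
    finally show ?thesis by (simp add: f Lp_algebra_simps)
  qed
  assume Y: "Y \<in> ?C"
  then obtain g where g: "Y = {g}" by (auto simp: Lp_carrier_finite)
  show "alg_mult ?B X Y \<in> ?C" "alg_add ?B X Y \<in> ?C" by (simp_all add: f g Lp_carrier_finite Lp_algebra_simps)
  show "alg_mult ?B (alg_scale ?B c X) Y = alg_scale ?B c (alg_mult ?B X Y)"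
  proof -
    have "scaleC c ((1 / n) *\<^sub>R (\<Sum>y\<in>UNIV. h y)) = (1 / n) *\<^sub>R (\<Sum>y\<in>UNIV. scaleC c (h y))" for h :: "'g \<Rightarrow> 'a"
    proof -
      interpret bounded_linear "scaleC c :: 'a \<Rightarrow> 'a" by (rule bounded_linear_scaleC)
      show ?thesis by (simp add: scaleR sum)
    qed
    then have "convolution \<mu> (\<lambda>x. scaleC c (f x)) g = (\<lambda>x. scaleC c (convolution \<mu> f g x))"
      by (simp add: fun_eq_iff convolution_eq mult_scaleC_left)
    then show ?thesis by (simp add: f g Lp_algebra_simps)
  qed
  assume Z: "Z \<in> ?C"
  then obtain h where h: "Z = {h}" by (auto simp: Lp_carrier_finite)
  show "alg_mult ?B (alg_mult ?B X Y) Z = alg_mult ?B X (alg_mult ?B Y Z)"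
    by (simp add: f g h Lp_algebra_simps convolution_assoc)
  have "convolution \<mu> (\<lambda>x. f x + g x) h = (\<lambda>x. convolution \<mu> f h x + convolution \<mu> g h x)"
    by (simp add: fun_eq_iff convolution_eq distrib_right sum.distrib scaleR_add_right)
  then show "alg_mult ?B (alg_add ?B X Y) Z = alg_add ?B (alg_mult ?B X Z) (alg_mult ?B Y Z)"
    by (simp add: f g h Lp_algebra_simps)
qed

text \<open>Multiplying a character over all translates of the group shows that its values are roots
  of unity of order dividing the group order, so there are only finitely many choices. Finiteness
  makes the Fourier sum below meaningful.\<close>

lemma finite_group_chars: "finite (group_chars :: ('g \<Rightarrow> complex) set)"
proof -
  let ?N = "card (UNIV :: 'g set)"
  have N: "?N > 0" using n_pos by (simp add: n_def)
  have "\<xi> x ^ ?N = 1" if \<xi>: "\<xi> \<in> group_chars" for \<xi> :: "'g \<Rightarrow> complex" and x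
  proof -
    have "(\<Prod>y\<in>UNIV. \<xi> (x + y)) = (\<Prod>y\<in>UNIV. \<xi> y)"
      by (rule prod.reindex_bij_witness[of _ "\<lambda>y. - x + y" "\<lambda>y. x + y"]) auto
    then have "\<xi> x ^ ?N * (\<Prod>y\<in>UNIV. \<xi> y) = (\<Prod>y\<in>UNIV. \<xi> y)"
      by (simp add: group_charsD(2)[OF \<xi>] prod.distrib)
    moreover have "(\<Prod>y\<in>UNIV. \<xi> y) \<noteq> 0"
      using fin group_charsD(3)[OF \<xi>] by (auto simp: prod_zero_iff) (metis norm_zero zero_neq_one)
    ultimately show ?thesis by simp
  qed
  then have "group_chars \<subseteq> (UNIV :: 'g set) \<rightarrow>\<^sub>E {z :: complex. z ^ ?N = 1}" by auto
  moreover have "finite ((UNIV :: 'g set) \<rightarrow>\<^sub>E {z :: complex. z ^ ?N = 1})"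
    using fin N by (intro finite_PiE finite_roots_unity) auto
  ultimately show ?thesis by (rule finite_subset)
qed

lemma trivial_group_char: "(\<lambda>_. 1) \<in> group_chars"
  by (simp add: group_chars_def)

theorem BSE_Lp_imp_BSE:
  assumes BSE: "BSE_algebra (Lp_algebra \<mu> p ::
      ('g \<Rightarrow> 'a::{complex_normed_algebra,comm_ring_1,banach,second_countable_topology}) set normed_alg)"
  shows "BSE_algebra (type_algebra TYPE('a))"
  unfolding type_alg.BSE_algebra_iff
proof
  let ?A = "type_algebra TYPE('a)"
  let ?B = "Lp_algebra \<mu> p :: ('g \<Rightarrow> 'a) set normed_alg"
  interpret B: unital_normed_alg ?B "{point 0 1}" "n powr (1 / p)" by (rule Lp_unital)
  fix \<sigma> assume \<sigma>: "\<sigma> \<in> BSE_functions ?A"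
  let ?\<Theta> = "\<lambda>\<Phi> a. \<Phi> {point 0 a :: 'g \<Rightarrow> 'a}"
  have c: "{f} \<in> alg_carrier ?B" for f by (simp add: Lp_carrier_finite)
  have "(\<lambda>\<Phi>\<in>\<Delta> ?B. \<sigma> (?\<Theta> \<Phi>)) \<in> BSE_functions ?B"
  proof (rule BSE_functions_pullback[OF \<sigma> type_alg.characters_in_dual B.characters_in_dual, where C=n])
    fix N :: nat and \<alpha> :: "nat \<Rightarrow> complex" and \<Phi>
    assume \<Phi>: "\<And>k. k \<in> {1..N} \<Longrightarrow> \<Phi> k \<in> \<Delta> ?B"
    let ?D = "dual_norm ?B (\<lambda>b\<in>alg_carrier ?B. \<Sum>k = 1..N. \<alpha> k * \<Phi> k b)"
    have D: "0 \<le> ?D" by (rule B.dual_norm_combination_nonneg[OF \<Phi>])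
    show "dual_norm ?A (\<lambda>a\<in>alg_carrier ?A. \<Sum>k = 1..N. \<alpha> k * \<Phi> k {point 0 a}) \<le> n * ?D"
    proof (rule dual_norm_le[where ?b0.0="0 :: 'a"])
      fix a :: 'a assume a: "alg_norm ?A a \<le> 1"
      \<comment> \<open>The transfer constant is \<open>n\<close>: the only nonzero value of
        \<open>point 0 a\<close> has norm \<open>n * norm a\<close>.\<close>
      have nl: "Lp_norm \<mu> p (point 0 a :: 'g \<Rightarrow> 'a) \<le> n"
      proof -
        have "(\<Sum>x\<in>UNIV. norm ((point 0 a :: 'g \<Rightarrow> 'a) x)) = (\<Sum>x\<in>(UNIV :: 'g set). if x = 0 then n * norm a else 0)"
          using n_pos by (intro sum.cong) (auto simp: point_def)
        also have "\<dots> = n * norm a" using fin by simp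
        also have "\<dots> \<le> n" using a n_pos by (simp add: mult_left_le)
        finally show ?thesis using Lp_norm_le_sum[of "point 0 a"] by linarith
      qed
      have "cmod (\<Sum>k = 1..N. \<alpha> k * \<Phi> k {point 0 a}) \<le> ?D * Lp_norm \<mu> p (point 0 a :: 'g \<Rightarrow> 'a)"
        using B.abs_combination_le_dual_norm[OF \<Phi> c[of "point 0 a"], where \<alpha>=\<alpha>] by (simp add: Lp_algebra_simps)
      also have "\<dots> \<le> ?D * n" by (rule mult_left_mono[OF nl D])
      finally show "cmod ((\<lambda>a\<in>alg_carrier ?A. \<Sum>k = 1..N. \<alpha> k * \<Phi> k {point 0 a}) a) \<le> n * ?D"
        by (simp add: mult.commute)
    qed simp_all
  qed (auto simp: n_pos Lp_characters_finite(1) intro!: continuous_map_eval_character c)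
  then obtain X where X: "X \<in> alg_carrier ?B" "\<And>\<Phi>. \<Phi> \<in> \<Delta> ?B \<Longrightarrow> \<Phi> X = (\<lambda>\<Phi>\<in>\<Delta> ?B. \<sigma> (?\<Theta> \<Phi>)) \<Phi>"
    using BSE unfolding B.BSE_algebra_iff by blast
  obtain f where f: "X = {f}" using X(1) by (auto simp: Lp_carrier_finite)
  \<comment> \<open>The candidate element is the mean of \<open>f\<close>. Tensoring
    \<open>\<phi>\<close> with the trivial character gives a character that restricts to
    \<open>\<phi>\<close> on point masses at 0, so the pulled-back function has value
    \<open>\<sigma> \<phi>\<close> there.\<close>
  have "\<phi> (avg (\<lambda>_. 1) f) = \<sigma> \<phi>" if \<phi>: "\<phi> \<in> \<Delta> ?A" for \<phi>
  proof -
    have one: "scaleC 1 a = a" for a :: 'a using scaleC_of_real[of 1 a] by simp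
    have zero: "avg (\<lambda>_. 1) (point 0 a) = a" for a :: 'a
    proof -
      have "(\<Sum>x\<in>UNIV. (point 0 a :: 'g \<Rightarrow> 'a) x) = n *\<^sub>R a"
        using fin by (simp add: point_def)
      then show ?thesis using n_pos by (simp add: avg_def one)
    qed
    have "?\<Theta> (Lp_char p (\<lambda>_. 1) \<phi>) = \<phi>" by (simp add: fun_eq_iff Lp_char_avg[OF \<phi>] zero)
    then show ?thesis
      using X(2)[OF Lp_char_character[OF p trivial_group_char \<phi>]]
        Lp_char_character[OF p trivial_group_char \<phi>] by (simp add: f Lp_char_avg[OF \<phi>])
  qed
  then show "\<exists>a\<in>alg_carrier ?A. \<forall>\<phi>\<in>\<Delta> ?A. \<phi> a = \<sigma> \<phi>" by auto
qed

text \<open>For a fixed \<open>\<xi>\<close>, the function sending \<open>\<phi>\<close> to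
  \<open>\<sigma> (Lp_char p \<xi> \<phi>)\<close> is a BSE-function because the Fourier coefficient
  \<open>avg \<xi>\<close> is bounded from the p-norm; the hypothesis represents it by an element
  \<open>a \<xi>\<close>, to be used as a prescribed Fourier coefficient.\<close>

theorem BSE_imp_BSE_Lp:
  assumes BSE: "BSE_algebra (type_algebra
      TYPE('a::{complex_normed_algebra,comm_ring_1,banach,second_countable_topology}))"
  shows "BSE_algebra (Lp_algebra \<mu> p :: ('g \<Rightarrow> 'a) set normed_alg)"
proof -
  let ?A = "type_algebra TYPE('a)"
  let ?B = "Lp_algebra \<mu> p :: ('g \<Rightarrow> 'a) set normed_alg"
  let ?X = "group_chars :: ('g \<Rightarrow> complex) set"
  interpret B: unital_normed_alg ?B "{point 0 1}" "n powr (1 / p)" by (rule Lp_unital)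
  have c: "{f} \<in> alg_carrier ?B" for f by (simp add: Lp_carrier_finite)
  show ?thesis
    unfolding B.BSE_algebra_iff
  proof
    fix \<sigma> assume \<sigma>: "\<sigma> \<in> BSE_functions ?B"
    have ex: "\<exists>a. \<forall>\<phi>\<in>\<Delta> ?A. \<phi> a = \<sigma> (Lp_char p \<xi> \<phi>)" if \<xi>: "\<xi> \<in> ?X" for \<xi>
    proof -
      have "(\<lambda>\<phi>\<in>\<Delta> ?A. \<sigma> (Lp_char p \<xi> \<phi>)) \<in> BSE_functions ?A"
      proof (rule BSE_functions_pullback[OF \<sigma> B.characters_in_dual type_alg.characters_in_dual, where C="n powr (1 / p)"])
        show "Lp_char p \<xi> \<phi> \<in> \<Delta> ?B" if "\<phi> \<in> \<Delta> ?A" for \<phi> by (rule Lp_char_character[OF p \<xi> that])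
        show "continuous_map (character_topology ?A) euclidean (\<lambda>\<phi>. Lp_char p \<xi> \<phi> X)"
          if X: "X \<in> alg_carrier ?B" for X
        proof -
          obtain f where f: "X = {f}" using X by (auto simp: Lp_carrier_finite)
          have "continuous_map (character_topology ?A) euclidean (\<lambda>\<phi>. \<phi> (avg \<xi> f))"
            by (rule continuous_map_eval_character) simp
          then show ?thesis
            by (rule continuous_map_eq)
              (simp add: topspace_character_topology[OF type_alg.characters_in_dual] f Lp_char_avg)
        qed
        fix N :: nat and \<alpha> :: "nat \<Rightarrow> complex" and \<phi> :: "nat \<Rightarrow> 'a \<Rightarrow> complex"
        assume \<phi>: "\<And>k. k \<in> {1..N} \<Longrightarrow> \<phi> k \<in> \<Delta> ?A"
        let ?D = "dual_norm ?A (\<lambda>b\<in>alg_carrier ?A. \<Sum>k = 1..N. \<alpha> k * \<phi> k b)"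
        have le: "cmod (\<Sum>k = 1..N. \<alpha> k * \<phi> k a) \<le> ?D * norm a" for a
          using type_alg.abs_combination_le_dual_norm[OF \<phi>, where b=a and \<alpha>=\<alpha>] by simp
        have D: "?D \<ge> 0" using type_alg.dual_norm_combination_nonneg[OF \<phi>, where \<alpha>=\<alpha>] by simp
        show "dual_norm ?B (\<lambda>b\<in>alg_carrier ?B. \<Sum>k = 1..N. \<alpha> k * Lp_char p \<xi> (\<phi> k) b) \<le> n powr (1 / p) * ?D"
        proof (rule dual_norm_le)
          show "{\<lambda>_. 0} \<in> alg_carrier ?B" "alg_norm ?B {\<lambda>_. 0} \<le> 1"
            by (simp_all add: c Lp_algebra_simps Lp_norm_def)
          fix X assume X: "X \<in> alg_carrier ?B" "alg_norm ?B X \<le> 1"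
          then obtain f where f: "X = {f}" by (auto simp: Lp_carrier_finite)
          have "(\<Sum>k = 1..N. \<alpha> k * Lp_char p \<xi> (\<phi> k) X) = (\<Sum>k = 1..N. \<alpha> k * \<phi> k (avg \<xi> f))"
            by (rule sum.cong) (simp_all add: f Lp_char_avg[OF \<phi>])
          also have "cmod \<dots> \<le> ?D * norm (avg \<xi> f)" by (rule le)
          also have "\<dots> \<le> ?D * (n powr (1 / p) * 1)"
          proof (rule mult_left_mono[OF _ D])
            have "norm (avg \<xi> f) \<le> n powr (1 / p) * Lp_norm \<mu> p f" by (rule norm_avg_le[OF \<xi>])
            also have "\<dots> \<le> n powr (1 / p) * 1"
              using X(2) by (intro mult_left_mono) (simp_all add: f Lp_algebra_simps)
            finally show "norm (avg \<xi> f) \<le> n powr (1 / p) * 1" .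
          qed
          finally show "cmod ((\<lambda>b\<in>alg_carrier ?B. \<Sum>k = 1..N. \<alpha> k * Lp_char p \<xi> (\<phi> k) b) X) \<le> n powr (1 / p) * ?D"
            using X(1) by (simp add: mult.commute)
        qed
      qed (use n_pos in simp)
      then show ?thesis using BSE unfolding type_alg.BSE_algebra_iff by force
    qed
    have "\<exists>a. \<forall>\<xi>\<in>?X. \<forall>\<phi>\<in>\<Delta> ?A. \<phi> (a \<xi>) = \<sigma> (Lp_char p \<xi> \<phi>)"
      by (rule bchoice) (use ex in blast)
    then obtain a where a: "\<And>\<xi> \<phi>. \<xi> \<in> ?X \<Longrightarrow> \<phi> \<in> \<Delta> ?A \<Longrightarrow> \<phi> (a \<xi>) = \<sigma> (Lp_char p \<xi> \<phi>)" by blast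
    \<comment> \<open>Fourier synthesis: by orthogonality the coefficient of \<open>f\<close> at
      \<open>\<psi>\<close> is \<open>a \<psi>\<close>. The conjugate matches the unconjugated
      \<open>\<xi>\<close> in \<open>Lp_char\<close>.\<close>
    define f where "f x = (\<Sum>\<xi>\<in>?X. scaleC (cnj (\<xi> x)) (a \<xi>))" for x
    have "\<Phi> {f} = \<sigma> \<Phi>" if \<Phi>: "\<Phi> \<in> \<Delta> ?B" for \<Phi>
    proof -
      define \<phi> where "\<phi> a = \<Phi> {point 0 a}" for a
      have \<phi>: "\<phi> \<in> \<Delta> ?A" using Lp_characters_finite(1)[OF \<Phi>] by (simp add: \<phi>_def[abs_def])
      obtain \<psi> where \<psi>: "\<psi> \<in> ?X" "\<Phi> = Lp_char p \<psi> \<phi>"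
        using Lp_characters_finite(2)[OF \<Phi>] by (auto simp: \<phi>_def[abs_def])
      interpret bounded_linear \<phi> by (rule type_character_bounded_linear[OF \<phi>])
      have sc: "\<phi> (scaleC k b) = k * \<phi> b" for k b using \<phi> by (simp add: type_characters_iff)
      have "\<Phi> {f} = (\<integral>x. \<psi> x * \<phi> (f x) \<partial>\<mu>)" using Lp_char_eq[OF \<psi>(1) \<phi>, of f p] by (simp add: \<psi>(2))
      also have "\<dots> = (\<integral>x. (\<Sum>\<xi>\<in>?X. \<phi> (a \<xi>) * (\<psi> x * cnj (\<xi> x))) \<partial>\<mu>)"
        by (simp add: f_def sum sc sum_distrib_left mult_ac)
      also have "\<dots> = (\<Sum>\<xi>\<in>?X. \<phi> (a \<xi>) * (\<integral>x. \<psi> x * cnj (\<xi> x) \<partial>\<mu>))"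
        by (subst Bochner_Integration.integral_sum)
          (intro integrable_continuous continuous_any, simp only: integral_mult_right_zero)
      also have "\<dots> = (\<Sum>\<xi>\<in>?X. if \<psi> = \<xi> then \<phi> (a \<xi>) else 0)"
        by (rule sum.cong) (simp_all add: char_orthogonal[OF \<psi>(1)])
      also have "\<dots> = \<phi> (a \<psi>)" using finite_group_chars \<psi>(1) by simp
      also have "\<dots> = \<sigma> \<Phi>" using a[OF \<psi>(1) \<phi>] \<psi>(2) by simp
      finally show ?thesis .
    qed
    then show "\<exists>X\<in>alg_carrier ?B. \<forall>\<Phi>\<in>\<Delta> ?B. \<Phi> X = \<sigma> \<Phi>" using c by blast
  qed
qed

end

end

theorem theorem3p4:
  fixes \<mu> :: "'g::{topological_ab_group_add, t2_space} measure" and p :: real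
  assumes "compact (UNIV :: 'g set)"
    and "haar_prob \<mu>"
    and "semisimple
      (type_algebra TYPE('a::{complex_normed_algebra, comm_ring_1, banach, separable_metric_space}))"
    and "\<Delta> (type_algebra TYPE('a)) \<noteq> {}"
    and "1 < p"
  shows "BSE_algebra (Lp_algebra \<mu> p :: ('g \<Rightarrow> 'a) set normed_alg) \<longleftrightarrow>
    BSE_algebra (type_algebra TYPE('a)) \<and> finite (UNIV :: 'g set)"
proof -
  interpret compact_haar \<mu> by unfold_locales (fact assms)+
  \<comment> \<open>One fixed character of the coefficient algebra suffices to embed the characters
    of \<open>G\<close> among those of the convolution algebra.\<close>
  obtain \<phi> where \<phi>: "\<phi> \<in> \<Delta> (type_algebra TYPE('a))" using assms(4) by blast
  show ?thesis
  proof
    assume BSE: "BSE_algebra (Lp_algebra \<mu> p :: ('g \<Rightarrow> 'a) set normed_alg)"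
    have fin: "finite (UNIV :: 'g set)"
      by (rule finite_if_finite_group_chars[OF BSE_imp_finite_group_chars[OF assms(5) refl BSE \<phi>]])
    interpret finite_haar \<mu> by unfold_locales (rule fin)
    show "BSE_algebra (type_algebra TYPE('a)) \<and> finite (UNIV :: 'g set)"
      using BSE_Lp_imp_BSE[OF assms(5) BSE] fin by blast
  next
    assume *: "BSE_algebra (type_algebra TYPE('a)) \<and> finite (UNIV :: 'g set)"
    interpret finite_haar \<mu> by unfold_locales (use * in blast)
    show "BSE_algebra (Lp_algebra \<mu> p :: ('g \<Rightarrow> 'a) set normed_alg)"
      using BSE_imp_BSE_Lp[OF assms(5)] * by blast
  qed
qed

end
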